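(* Let $d\in\mathbb N$, $r>1/2$ and $1<q\le 2\le p<\infty$. Then $$\varrho_n\big(\boldsymbol W^r_p(\mathbb T^d),L_q(\mathbb T^d)\big)\asymp\left(\frac{(\log n)^{d-1}}{n}\right)^{r},\qquad n\in\mathbb N,\ n\ge 2 .$$
   Context: $\mathbb T^d=[0,1]^d$ with opposite faces identified; functions on $\mathbb T^d$ are functions on $\mathbb R^d$ that are $1$-periodic in each variable, and $\|\cdot\|_p$ is the norm of $L_p(\mathbb T^d)$. For $r>0$ let $F_r(x)=1+2\sum_{k=1}^\infty k^{-r}\cos(2\pi kx-r\pi/2)$, $x\in\mathbb T$, and $F_r(\boldsymbol x)=\prod_{j=1}^dF_r(x_j)$, $\boldsymbol x\in\mathbb T^d$. The Sobolev space of mixed smoothness $r$ is $$W^r_p(\mathbb T^d)=\Big\{f\in L_p(\mathbb T^d): f=\int_{\mathbb T^d}F_r(\cdot-\boldsymbol y)\varphi(\boldsymbol y)\,d\boldsymbol y,\ \|\varphi\|_p<\infty\Big\},\qquad \|f\|_{W^r_p(\mathbb T^d)}:=\|\varphi\|_p ,$$ and $\boldsymbol W^r_p(\mathbb T^d)$ is its unit ball. For $r>1/p$ its elements are identified with their continuous representatives, so point values make sense. For a set $\boldsymbol W$ of functions on a domain $\Omega$ contained in a normed space $X$ of functions on $\Omega$, the linear sampling $n$-width is $$\varrho_n(\boldsymbol W,X)=\inf_{k\le n,\ \boldsymbol x_1,\dots,\boldsymbol x_k\in\Omega,\ \varphi_1,\dots,\varphi_k\in X}\ \sup_{f\in \boldsymbol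 W}\Big\|f-\sum_{i=1}^kf(\boldsymbol x_i)\varphi_i\Big\|_X .$$ $A_n\asymp B_n$ means $cB_n\le A_n\le CB_n$ with constants $c,C>0$ independent of $n$. *)

theory Defs
  imports "HOL-Analysis.Analysis"
begin

text \<open>
  The dimension is \<open>CARD('d)\<close>. Scalars range over a type \<open>'k\<close> of class
  \<open>{real_normed_field, euclidean_space}\<close>, which up to isomorphism leaves exactly the real and
  the complex numbers, so real-valued and complex-valued functions are treated together.
  Functions on the torus are 1-periodic functions on \<open>real ^ 'd\<close>. Elements of
  \<open>L\<^sub>p\<close> are represented by functions, with equality almost everywhere made explicit.
\<close>

definition torus :: "(real ^ 'd) set" where
  "torus = cbox 0 1"

abbreviation torus_measure :: "(real ^ 'd) measure" where
  "torus_measure \<equiv> lebesgue_on torus"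

definition periodic :: "(real ^ 'd \<Rightarrow> 'k) \<Rightarrow> bool" where
  "periodic f \<longleftrightarrow> (\<forall>x i. f (x + axis i 1) = f x)"

definition Lp_space :: "real \<Rightarrow> (real ^ 'd \<Rightarrow> 'k :: {real_normed_field, euclidean_space}) set" where
  "Lp_space p = {f. periodic f \<and> f \<in> borel_measurable torus_measure \<and>
     integrable torus_measure (\<lambda>x. norm (f x) powr p)}"

definition Lp_norm :: "real \<Rightarrow> (real ^ 'd \<Rightarrow> 'k :: {real_normed_field, euclidean_space}) \<Rightarrow> real" where
  "Lp_norm p f = (LINT x|torus_measure. norm (f x) powr p) powr (1 / p)"

text \<open>
  For \<open>0 < r \<le> 1\<close> the series converges (conditionally) at every non-integer \<open>x\<close>, but in general
  not at the integers. The arbitrary value of \<open>suminf\<close> there is harmless, since the kernel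
  is only used under an integral.
\<close>

definition bernoulli_kernel :: "real \<Rightarrow> real \<Rightarrow> real" where
  "bernoulli_kernel r x =
     1 + 2 * (\<Sum>k. real (Suc k) powr (- r) * cos (2 * pi * real (Suc k) * x - r * pi / 2))"

definition mixed_kernel :: "real \<Rightarrow> real ^ 'd \<Rightarrow> real" where
  "mixed_kernel r x = (\<Prod>j\<in>UNIV. bernoulli_kernel r (x $ j))"

definition sobolev_density :: "real \<Rightarrow> real \<Rightarrow>
    (real ^ 'd \<Rightarrow> 'k :: {real_normed_field, euclidean_space}) \<Rightarrow> (real ^ 'd \<Rightarrow> 'k) \<Rightarrow> bool" where
  "sobolev_density r p f \<phi> \<longleftrightarrow> \<phi> \<in> Lp_space p \<and>
     (AE x in torus_measure. f x = (LINT y|torus_measure. mixed_kernel r (x - y) *\<^sub>R \<phi> y))"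

definition sobolev_space ::
    "real \<Rightarrow> real \<Rightarrow> (real ^ 'd \<Rightarrow> 'k :: {real_normed_field, euclidean_space}) set" where
  "sobolev_space r p = {f \<in> Lp_space p. \<exists>\<phi>. sobolev_density r p f \<phi>}"

text \<open>
  No Fourier coefficient of the kernel vanishes, so the density \<open>\<phi>\<close> of \<open>f\<close> is unique
  up to null sets and the infimum below is taken over the single value \<open>Lp_norm p \<phi>\<close>.
\<close>

definition sobolev_norm :: "real \<Rightarrow> real \<Rightarrow>
    (real ^ 'd \<Rightarrow> 'k :: {real_normed_field, euclidean_space}) \<Rightarrow> real" where
  "sobolev_norm r p f = (INF \<phi>\<in>{\<phi>. sobolev_density r p f \<phi>}. Lp_norm p \<phi>)"

text \<open>
  The unit ball consists of continuous representatives, which exist and are unique for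
  \<open>r > 1 / p\<close>, so that point evaluation is meaningful.
\<close>

definition sobolev_ball ::
    "real \<Rightarrow> real \<Rightarrow> (real ^ 'd \<Rightarrow> 'k :: {real_normed_field, euclidean_space}) set" where
  "sobolev_ball r p =
     {f \<in> sobolev_space r p. continuous_on UNIV f \<and> sobolev_norm r p f \<le> 1}"

text \<open>
  \<open>X\<close> and \<open>N\<close> are the carrier and the norm of the target space. The value is extended
  because the worst-case error of an algorithm may be infinite.
\<close>

definition sampling_width :: "nat \<Rightarrow> 'a set \<Rightarrow> ('a \<Rightarrow> 'k :: real_normed_field) set \<Rightarrow>
    ('a \<Rightarrow> 'k) set \<Rightarrow> (('a \<Rightarrow> 'k) \<Rightarrow> real) \<Rightarrow> ennreal" where
  "sampling_width n \<Omega> W X N =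
     (INF (k, x, \<phi>) \<in> {(k :: nat, x :: nat \<Rightarrow> 'a, \<phi> :: nat \<Rightarrow> 'a \<Rightarrow> 'k).
          k \<le> n \<and> (\<forall>i<k. x i \<in> \<Omega>) \<and> (\<forall>i<k. \<phi> i \<in> X)}.
        SUP f\<in>W. ennreal (N (\<lambda>t. f t - (\<Sum>i<k. f (x i) * \<phi> i t))))"

end

theory Submission
  imports Defs "HOL-Probability.Probability_Measure"
begin

text \<open>
  Upper bound. As \<open>q \<le> 2 \<le> p\<close>, it suffices to treat \<open>p = q = 2\<close>. In the trigonometric basis,
  functions of the unit ball have coefficients \<open>\<sigma>\<^sub>k b\<^sub>k\<close> with \<open>\<Sum>\<^sub>k b\<^sub>k\<^sup>2 \<le> 1\<close> and \<open>\<sigma>\<^sub>k = (\<Prod>\<^sub>j max 1 \<bar>k\<^sub>j\<bar>) powr - r\<close>.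
  A single lower barrier in the style of Batson, Spielman and Srivastava yields, for every \<open>\<epsilon>\<close>,
  \<open>O(m)\<close> points with
  \<open>\<parallel>f\<parallel>\<^sub>2\<^sup>2 \<le> \<epsilon>\<^sup>2 \<Sum>\<^sub>k b\<^sub>k\<^sup>2 + (1 / (4 m)) \<Sum>\<^sub>i f(x\<^sub>i)\<^sup>2\<close>, where \<open>m \<ge> \<Sum>\<^sub>k 1 / (1 + \<epsilon>\<^sup>2 / \<sigma>\<^sub>k\<^sup>2)\<close> bounds the
  effective dimension; no upper barrier is needed, because regularised least squares from these
  samples already has error \<open>O(\<epsilon>)\<close>. For \<open>\<epsilon> = L powr - r\<close> the effective dimension is of order
  \<open>L (ln L)\<^sup>d\<^sup>-\<^sup>1\<close>.

  Lower bound. There are at least \<open>2 n\<close> frequencies with \<open>\<sigma>\<^sub>k\<close> comparable to \<open>M powr - r\<close>, where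
  \<open>M (ln M)\<^sup>d\<^sup>-\<^sup>1\<close> is of order \<open>n\<close>. In their span, the functions vanishing at \<open>n\<close> given points form a
  subspace of at least half the dimension. A random signed sum over an orthonormal basis of it has
  comparable \<open>L\<^sub>s\<close> norms for all \<open>s < \<infinity>\<close> (Khintchine), hence violates any better rate.
\<close>

section \<open>Positive definite matrices on a finite index set\<close>

text \<open>The barrier works with finitely many frequencies, whereas the ball is
  infinite-dimensional. For r > 1/2 the kernel lies in L2, so by Cauchy-Schwarz the part of f
  outside a large frequency box is small in the supremum norm, uniformly over the ball. The box is
  chosen after \<epsilon> and may be enormous: the number of points depends only on a bound of the
  effective dimension that holds for every box. At the sample points the discarded part is merely
  bounded noise in the data of the least squares problem. The regularised quadratic form itself
  dominates the error, which is why the sampling operator needs a bound from below only.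

  In the lower bound one function has to vanish at the nodes, have a density with bounded L_p norm
  for a possibly large p, and still have a large L_q norm for q possibly close to 1. One choice of
  signs must therefore control exponential moments of the density and of the function at once; the
  fourth moment of the function then turns its L2 norm into a lower bound for its L_q norm.

  The real Hartley functions keep all matrices real; complex values are handled by
  components.\<close>

lemma homogeneous_system_nontrivial:
  fixes a :: "'e \<Rightarrow> 'i \<Rightarrow> 'f::field"
  assumes "finite E" "finite K" "card E < card K"
  shows "\<exists>c. (\<exists>k\<in>K. c k \<noteq> 0) \<and> (\<forall>e\<in>E. (\<Sum>k\<in>K. a e k * c k) = 0)"
  using assms
proof (induction E arbitrary: K a rule: finite_induct)
  case empty
  then obtain k where "k \<in> K" by fastforce
  then show ?case by (intro exI[of _ "\<lambda>_. 1"]) auto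
next
  case (insert e E)
  show ?case
  proof (cases "\<forall>k\<in>K. a e k = 0")
    case True
    have "card E < card K" using insert by simp
    from insert.IH[OF insert.prems(1) this, of a] obtain c
      where "\<exists>k\<in>K. c k \<noteq> 0" "\<forall>e\<in>E. (\<Sum>k\<in>K. a e k * c k) = 0" by blast
    with True show ?thesis by (intro exI[of _ c]) auto
  next
    case False
    \<comment> \<open>Gaussian elimination: equation \<open>e\<close> is solved for the unknown
      \<open>k0\<close> and substituted into the others, which leaves one equation and one unknown
      fewer.\<close>
    then obtain k0 where k0: "k0 \<in> K" "a e k0 \<noteq> 0" by blast
    have "card E < card (K - {k0})" using insert k0 by (simp add: card_Diff_singleton)
    from insert.IH[OF _ this, of "\<lambda>e' k. a e' k - a e' k0 * a e k / a e k0"] insert.prems(1)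
    obtain c where c: "\<exists>k\<in>K - {k0}. c k \<noteq> 0"
      "\<And>e'. e' \<in> E \<Longrightarrow> (\<Sum>k\<in>K - {k0}. (a e' k - a e' k0 * a e k / a e k0) * c k) = 0"
      by blast
    define t where "t = - (\<Sum>k\<in>K - {k0}. a e k * c k) / a e k0"
    define d where "d = c(k0 := t)"
    have split: "(\<Sum>k\<in>K. a e' k * d k) = a e' k0 * t + (\<Sum>k\<in>K - {k0}. a e' k * c k)" for e'
      using insert.prems(1) k0(1) by (simp add: sum.remove d_def)
    have "(\<Sum>k\<in>K. a e k * d k) = 0"
      unfolding split t_def using k0 by simp
    moreover have "(\<Sum>k\<in>K. a e' k * d k) = 0" if "e' \<in> E" for e'
    proof -
      have "0 = (\<Sum>k\<in>K - {k0}. a e' k * c k) - (\<Sum>k\<in>K - {k0}. a e' k0 / a e k0 * (a e k * c k))"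
        using c(2)[OF that] by (simp add: algebra_simps sum_subtractf)
      also have "\<dots> = (\<Sum>k\<in>K. a e' k * d k)"
        unfolding split t_def sum_distrib_left[symmetric] by (simp add: field_simps)
      finally show ?thesis by simp
    qed
    moreover have "\<exists>k\<in>K. d k \<noteq> 0" using c(1) by (auto simp: d_def)
    ultimately show ?thesis by blast
  qed
qed

text \<open>Matrices are functions of two indices of which only the entries on K x K count. The
  index sets will be frequency sets that depend on parameters fixed in the course of a proof, so
  they cannot be types.\<close>

definition quad_form :: "'i set \<Rightarrow> ('i \<Rightarrow> 'i \<Rightarrow> real) \<Rightarrow> ('i \<Rightarrow> real) \<Rightarrow> real" where
  "quad_form K B c = (\<Sum>i\<in>K. \<Sum>j\<in>K. B i j * c i * c j)"

definition posdef_on :: "'i set \<Rightarrow> ('i \<Rightarrow> 'i \<Rightarrow> real) \<Rightarrow> bool" where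
  "posdef_on K B \<longleftrightarrow> (\<forall>i\<in>K. \<forall>j\<in>K. B i j = B j i) \<and>
     (\<forall>c. (\<exists>k\<in>K. c k \<noteq> 0) \<longrightarrow> 0 < quad_form K B c)"

definition inverse_on :: "'i set \<Rightarrow> ('i \<Rightarrow> 'i \<Rightarrow> real) \<Rightarrow> ('i \<Rightarrow> 'i \<Rightarrow> real) \<Rightarrow> bool" where
  "inverse_on K B R \<longleftrightarrow>
     (\<forall>i\<in>K. \<forall>j\<in>K. (\<Sum>l\<in>K. B i l * R l j) = (if i = j then 1 else 0))"

definition trace_on :: "'i set \<Rightarrow> ('i \<Rightarrow> 'i \<Rightarrow> real) \<Rightarrow> real" where
  "trace_on K R = (\<Sum>i\<in>K. R i i)"

definition apply_on :: "'i set \<Rightarrow> ('i \<Rightarrow> 'i \<Rightarrow> real) \<Rightarrow> ('i \<Rightarrow> real) \<Rightarrow> 'i \<Rightarrow> real" where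
  "apply_on K R v i = (\<Sum>j\<in>K. R i j * v j)"

lemma posdef_on_sym: "posdef_on K B \<Longrightarrow> i \<in> K \<Longrightarrow> j \<in> K \<Longrightarrow> B i j = B j i"
  by (simp add: posdef_on_def)

lemma quad_form_apply: "quad_form K B c = (\<Sum>i\<in>K. c i * apply_on K B c i)"
  by (simp add: quad_form_def apply_on_def sum_distrib_left mult_ac)

lemma posdef_on_nonneg:
  assumes "posdef_on K B" shows "0 \<le> quad_form K B c"
proof (cases "\<exists>k\<in>K. c k \<noteq> 0")
  case True
  then show ?thesis using assms by (auto simp: posdef_on_def less_imp_le)
next
  case False
  then show ?thesis by (simp add: quad_form_def)
qed

text \<open>Each column of the inverse is found by counting: \<open>card K\<close> equations in
  \<open>card K + 1\<close> unknowns, where the extra unknown \<open>None\<close> multiplies the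
  right-hand side. It cannot vanish, since the form would then be zero at a nonzero vector; dividing
  by it solves the system.\<close>

lemma posdef_on_inverse_exists:
  assumes "finite K" "posdef_on K B"
  shows "\<exists>R. inverse_on K B R"
proof -
  have "\<exists>x. \<forall>i\<in>K. (\<Sum>l\<in>K. B i l * x l) = (if i = j then 1 else 0)" if j: "j \<in> K" for j
  proof -
    define L where "L = insert None (Some ` K)"
    have cL: "card L = Suc (card K)"
      unfolding L_def using assms(1) by (simp add: card_image)
    obtain c where c: "\<exists>k\<in>L. c k \<noteq> (0::real)"
      "\<And>i. i \<in> K \<Longrightarrow> (\<Sum>k\<in>L. (case k of None \<Rightarrow> - (if i = j then 1 else 0) | Some l \<Rightarrow> B i l) * c k) = 0"
      using homogeneous_system_nontrivial[of K L
          "\<lambda>i k. case k of None \<Rightarrow> - (if i = j then 1 else 0) | Some l \<Rightarrow> B i l"] assms(1) cL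
      by (auto simp: L_def)
    have eq: "(\<Sum>l\<in>K. B i l * c (Some l)) = (if i = j then 1 else 0) * c None" if "i \<in> K" for i
      using c(2)[OF that] assms(1)
      unfolding L_def by (subst (asm) sum.insert) (auto simp: sum.reindex)
    have "c None \<noteq> 0"
    proof
      assume c0: "c None = 0"
      then have nz: "\<exists>k\<in>K. c (Some k) \<noteq> 0" using c(1) by (auto simp: L_def)
      have "quad_form K B (\<lambda>k. c (Some k)) = 0"
        unfolding quad_form_apply apply_on_def using eq c0 by simp
      then show False using assms(2) nz unfolding posdef_on_def by fastforce
    qed
    then have "\<forall>i\<in>K. (\<Sum>l\<in>K. B i l * (c (Some l) / c None)) = (if i = j then 1 else 0)"
      using eq by (simp flip: sum_divide_distrib)
    then show ?thesis by (intro exI[of _ "\<lambda>l. c (Some l) / c None"])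
  qed
  then obtain x where "\<And>j. j \<in> K \<Longrightarrow> \<forall>i\<in>K. (\<Sum>l\<in>K. B i l * x j l) = (if i = j then 1 else 0)"
    by metis
  then show ?thesis
    unfolding inverse_on_def by (intro exI[of _ "\<lambda>l j. x j l"]) auto
qed

context
  fixes K :: "'i set" and B R :: "'i \<Rightarrow> 'i \<Rightarrow> real"
  assumes fin: "finite K" and B: "posdef_on K B" and R: "inverse_on K B R"
begin

lemma apply_inverse:
  assumes "i \<in> K" shows "apply_on K B (apply_on K R c) i = c i"
proof -
  have "apply_on K B (apply_on K R c) i = (\<Sum>l\<in>K. \<Sum>j\<in>K. B i l * R l j * c j)"
    by (simp add: apply_on_def sum_distrib_left mult.assoc)
  also have "\<dots> = (\<Sum>j\<in>K. (\<Sum>l\<in>K. B i l * R l j) * c j)"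
    by (subst sum.swap) (simp add: sum_distrib_right)
  also have "\<dots> = (\<Sum>j\<in>K. (if i = j then c j else 0))"
    using R assms by (intro sum.cong) (auto simp: inverse_on_def)
  finally show ?thesis using fin assms by simp
qed

lemma inverse_on_sym:
  assumes "i \<in> K" "j \<in> K" shows "R i j = R j i"
proof -
  have "R j i = (\<Sum>l\<in>K. R l i * (if l = j then 1 else 0))"
    using fin assms by (simp add: if_distrib[of "\<lambda>x. _ * x"] cong: if_cong)
  also have "\<dots> = (\<Sum>l\<in>K. R l i * (\<Sum>m\<in>K. B l m * R m j))"
    using R assms by (intro sum.cong) (auto simp: inverse_on_def)
  also have "\<dots> = (\<Sum>m\<in>K. (\<Sum>l\<in>K. B l m * R l i) * R m j)"
    unfolding sum_distrib_left sum_distrib_right by (subst sum.swap) (simp add: mult_ac)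
  also have "\<dots> = (\<Sum>m\<in>K. (\<Sum>l\<in>K. B m l * R l i) * R m j)"
    by (intro sum.cong refl arg_cong2[where f="(*)"]) (auto simp: posdef_on_sym[OF B])
  also have "\<dots> = (\<Sum>m\<in>K. (if m = i then 1 else 0) * R m j)"
    using R assms by (intro sum.cong) (auto simp: inverse_on_def)
  also have "\<dots> = R i j"
    using fin assms by (simp add: if_distrib[of "\<lambda>x. x * _"] cong: if_cong)
  finally show ?thesis by simp
qed

lemma left_inverse_on:
  assumes "i \<in> K" "j \<in> K" shows "(\<Sum>l\<in>K. R i l * B l j) = (if i = j then 1 else 0)"
proof -
  have "(\<Sum>l\<in>K. R i l * B l j) = (\<Sum>l\<in>K. B j l * R l i)"
    using assms by (intro sum.cong) (auto simp: inverse_on_sym[of i] posdef_on_sym[OF B, of j])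
  then show ?thesis using R assms by (auto simp: inverse_on_def)
qed

lemma quad_form_inverse: "quad_form K R c = quad_form K B (apply_on K R c)"
  unfolding quad_form_apply[of K B]
  by (simp add: apply_inverse quad_form_apply mult.commute)

lemma inverse_on_nonneg: "0 \<le> quad_form K R c"
  unfolding quad_form_inverse by (rule posdef_on_nonneg[OF B])

end

section \<open>Trace inequalities for positive semidefinite matrices\<close>

lemma quad_form_two:
  assumes "finite K" "i \<in> K" "j \<in> K" "i \<noteq> j"
  shows "quad_form K P (\<lambda>k. if k = i then s else if k = j then t else 0)
           = P i i * s\<^sup>2 + (P i j + P j i) * s * t + P j j * t\<^sup>2"
proof -
  let ?c = "\<lambda>k. if k = i then s else if k = j then t else 0"
  have red: "(\<Sum>k\<in>K. f k * ?c k) = f i * s + f j * t" for f :: "'a \<Rightarrow> real"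
  proof -
    have "(\<Sum>k\<in>K. f k * ?c k) = (\<Sum>k\<in>{i, j}. f k * ?c k)"
      using assms by (intro sum.mono_neutral_right) auto
    then show ?thesis using assms by simp
  qed
  have "quad_form K P ?c = (\<Sum>k\<in>K. (\<Sum>l\<in>K. P k l * ?c l) * ?c k)"
    unfolding quad_form_def sum_distrib_right by (simp add: mult_ac)
  then show ?thesis unfolding red by (simp add: algebra_simps power2_eq_square)
qed

lemma psd_entry_bound:
  assumes "finite K" "i \<in> K" "j \<in> K"
    and sym: "P i j = P j i" and psd: "\<And>c. 0 \<le> quad_form K P c"
  shows "0 \<le> P i i" "(P i j)\<^sup>2 \<le> P i i * P j j"
proof -
  have diag: "0 \<le> P k k" if "k \<in> K" for k
  proof -
    have "quad_form K P (\<lambda>l. if l = k then 1 else 0) = P k k"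
      using assms(1) that
      by (simp add: quad_form_apply apply_on_def if_distrib[of "\<lambda>x. _ * x"]
          if_distrib[of "\<lambda>x. x * _"] cong: if_cong)
    then show ?thesis using psd by metis
  qed
  then show "0 \<le> P i i" using assms by simp
  show "(P i j)\<^sup>2 \<le> P i i * P j j"
  proof (cases "i = j")
    case True
    then show ?thesis by (simp add: power2_eq_square)
  next
    case False
    have q: "0 \<le> P i i * s\<^sup>2 + 2 * P i j * s * t + P j j * t\<^sup>2" for s t
      using psd[of "\<lambda>k. if k = i then s else if k = j then t else 0"]
      unfolding quad_form_two[OF assms(1-3) False] using sym by (simp add: algebra_simps)
    show ?thesis
    proof (cases "P i i = 0")
      case True
      have "P i j = 0"
      proof (rule ccontr)
        assume "P i j \<noteq> 0"
        \<comment> \<open>With \<open>P i i = 0\<close> the form is affine in \<open>s\<close> for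
          \<open>t = 1\<close>; this \<open>s\<close> gives it the value -1.\<close>
        with q[of "- (P j j + 1) / (2 * P i j)" 1] True show False by (simp add: field_simps)
      qed
      then show ?thesis using True by simp
    next
      case False
      then have pos: "P i i > 0" using diag[OF assms(2)] by simp
      have "0 \<le> P i i * (P i i * P j j - (P i j)\<^sup>2)"
        using q[of "- P i j" "P i i"] by (simp add: algebra_simps power2_eq_square)
      then show ?thesis using pos by (simp add: zero_le_mult_iff)
    qed
  qed
qed

text \<open>No spectral theorem is involved: the 2 x 2 minors bound \<open>P i j * Q i j\<close> by
  the geometric mean of \<open>P i i * Q j j\<close> and \<open>P j j * Q i i\<close>. After passing
  to the arithmetic mean, each half sums to half the product of the traces.\<close>

lemma psd_inner_le_traces:
  assumes "finite K"
    and P: "\<And>i j. i \<in> K \<Longrightarrow> j \<in> K \<Longrightarrow> P i j = P j i" "\<And>c. 0 \<le> quad_form K P c"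
    and Q: "\<And>i j. i \<in> K \<Longrightarrow> j \<in> K \<Longrightarrow> Q i j = Q j i" "\<And>c. 0 \<le> quad_form K Q c"
  shows "(\<Sum>i\<in>K. \<Sum>j\<in>K. P i j * Q i j) \<le> trace_on K P * trace_on K Q"
proof -
  have "P i j * Q i j \<le> (P i i * Q j j + P j j * Q i i) / 2" if ij: "i \<in> K" "j \<in> K" for i j
  proof -
    have d: "0 \<le> P i i" "0 \<le> P j j" "0 \<le> Q i i" "0 \<le> Q j j"
      using psd_entry_bound(1)[OF assms(1) _ _ _ P(2)] psd_entry_bound(1)[OF assms(1) _ _ _ Q(2)] ij
      by blast+
    have "(P i j)\<^sup>2 * (Q i j)\<^sup>2 \<le> (P i i * P j j) * (Q i i * Q j j)"
      by (intro mult_mono psd_entry_bound(2)[OF assms(1) ij P(1)[OF ij] P(2)]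
          psd_entry_bound(2)[OF assms(1) ij Q(1)[OF ij] Q(2)] mult_nonneg_nonneg d zero_le_power2)
    also have "\<dots> = (P i i * Q j j) * (P j j * Q i i)" by simp
    also have "\<dots> \<le> ((P i i * Q j j + P j j * Q i i) / 2)\<^sup>2"
      using zero_le_power2[of "P i i * Q j j - P j j * Q i i"]
      by (simp add: power2_eq_square field_simps)
    finally have "(P i j * Q i j)\<^sup>2 \<le> ((P i i * Q j j + P j j * Q i i) / 2)\<^sup>2"
      by (simp add: power_mult_distrib)
    then show ?thesis
      by (rule power2_le_imp_le) (intro divide_nonneg_pos add_nonneg_nonneg mult_nonneg_nonneg d, simp)
  qed
  then have "(\<Sum>i\<in>K. \<Sum>j\<in>K. P i j * Q i j) \<le> (\<Sum>i\<in>K. \<Sum>j\<in>K. (P i i * Q j j + P j j * Q i i) / 2)"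
    by (intro sum_mono)
  also have "\<dots> = ((\<Sum>i\<in>K. \<Sum>j\<in>K. P i i * Q j j) + (\<Sum>i\<in>K. \<Sum>j\<in>K. P j j * Q i i)) / 2"
    by (simp only: sum.distrib sum_divide_distrib[symmetric])
  also have "(\<Sum>i\<in>K. \<Sum>j\<in>K. P j j * Q i i) = (\<Sum>i\<in>K. \<Sum>j\<in>K. P i i * Q j j)"
    by (rule sum.swap)
  also have "(\<Sum>i\<in>K. \<Sum>j\<in>K. P i i * Q j j) = trace_on K P * trace_on K Q"
    unfolding trace_on_def by (rule sum_product[symmetric])
  also have "(trace_on K P * trace_on K Q + trace_on K P * trace_on K Q) / 2 = trace_on K P * trace_on K Q"
    by simp
  finally show ?thesis .
qed

text \<open>The trace replaces the largest eigenvalue of \<open>R\<close>. This is the preceding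
  inequality for \<open>R\<close> and the rank-one matrix \<open>c i * c j\<close>, whose trace is
  the squared norm of \<open>c\<close>.\<close>

lemma quad_form_inverse_le_trace:
  assumes "finite K" "posdef_on K B" "inverse_on K B R"
  shows "quad_form K R c \<le> trace_on K R * (\<Sum>k\<in>K. (c k)\<^sup>2)"
proof -
  have "quad_form K (\<lambda>i j. c i * c j) d = (\<Sum>i\<in>K. c i * d i)\<^sup>2" for d
    unfolding quad_form_def power2_eq_square sum_product by (simp add: mult_ac)
  then have "(\<Sum>i\<in>K. \<Sum>j\<in>K. R i j * (c i * c j)) \<le> trace_on K R * trace_on K (\<lambda>i j. c i * c j)"
    by (intro psd_inner_le_traces[OF assms(1)] inverse_on_sym[OF assms] inverse_on_nonneg[OF assms])
      (simp_all add: mult.commute)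
  then show ?thesis by (simp add: quad_form_def trace_on_def power2_eq_square mult_ac)
qed

text \<open>In terms of eigenvalues: the smallest one of \<open>B\<close> is at least the reciprocal
  of the trace of the inverse. The proof expands the nonnegative form \<open>B\<close> at
  \<open>c - R c / m\<close> and bounds the term of second order in 1 / m by the previous
  lemma.\<close>

lemma posdef_on_lower_bound:
  assumes "finite K" "posdef_on K B" "inverse_on K B R" "trace_on K R \<le> m" "m > 0"
  shows "(\<Sum>k\<in>K. (c k)\<^sup>2) / m \<le> quad_form K B c"
proof -
  define d where "d = apply_on K R c"
  define t where "t = 1 / m"
  have Bd: "apply_on K B d i = c i" if "i \<in> K" for i
    unfolding d_def by (rule apply_inverse[OF assms(1-3) that])
  have cross: "(\<Sum>i\<in>K. d i * apply_on K B c i) = (\<Sum>k\<in>K. (c k)\<^sup>2)"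
  proof -
    have "(\<Sum>i\<in>K. d i * apply_on K B c i) = (\<Sum>j\<in>K. \<Sum>i\<in>K. B j i * d i * c j)"
      unfolding apply_on_def sum_distrib_left using posdef_on_sym[OF assms(2)]
      by (subst sum.swap) (auto intro!: sum.cong simp: mult_ac)
    also have "\<dots> = (\<Sum>j\<in>K. c j * apply_on K B d j)"
      unfolding apply_on_def sum_distrib_left by (simp add: mult_ac)
    finally show ?thesis by (simp add: Bd power2_eq_square)
  qed
  have lin: "apply_on K B (\<lambda>k. c k - t * d k) i = apply_on K B c i - t * apply_on K B d i" for i
    unfolding apply_on_def by (simp add: algebra_simps sum_subtractf sum_distrib_left)
  have "0 \<le> quad_form K B (\<lambda>k. c k - t * d k)" by (rule posdef_on_nonneg[OF assms(2)])
  also have "\<dots> = quad_form K B c - t * (\<Sum>i\<in>K. c i * apply_on K B d i)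
      - t * (\<Sum>i\<in>K. d i * apply_on K B c i) + t\<^sup>2 * (\<Sum>i\<in>K. d i * apply_on K B d i)"
    unfolding quad_form_apply lin
    by (simp add: algebra_simps sum_subtractf sum.distrib sum_distrib_left power2_eq_square)
  also have "(\<Sum>i\<in>K. c i * apply_on K B d i) = (\<Sum>k\<in>K. (c k)\<^sup>2)"
    by (simp add: Bd power2_eq_square)
  also have "(\<Sum>i\<in>K. d i * apply_on K B d i) = quad_form K R c"
    unfolding quad_form_apply[of K R] d_def[symmetric] by (simp add: Bd mult.commute)
  also have "t\<^sup>2 * quad_form K R c \<le> t\<^sup>2 * (m * (\<Sum>k\<in>K. (c k)\<^sup>2))"
    using quad_form_inverse_le_trace[OF assms(1-3), of c]
      mult_right_mono[OF assms(4), of "\<Sum>k\<in>K. (c k)\<^sup>2"]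
    by (intro mult_left_mono) (auto simp: sum_nonneg)
  also have "t\<^sup>2 * (m * (\<Sum>k\<in>K. (c k)\<^sup>2)) = t * (\<Sum>k\<in>K. (c k)\<^sup>2)"
    using assms(5) by (simp add: t_def power2_eq_square)
  finally show ?thesis unfolding cross by (simp add: t_def field_simps)
qed

text \<open>The price of raising the barrier by \<delta>. The smallest eigenvalue of
  \<open>B\<close> is at least 1 / m, so a shift of at most half of that keeps the matrix positive
  definite and at most doubles the bound on the trace of the inverse. The finer estimate, \<delta>
  times the squared Frobenius norm of the new inverse, has the form that a new sample point can
  repay.\<close>

lemma shift_step:
  fixes K :: "'i set" and \<delta> m :: real
  assumes fin: "finite K" and B: "posdef_on K B" and R: "inverse_on K B R"
    and tr: "trace_on K R \<le> m" and m: "m > 0" and \<delta>: "0 < \<delta>" "\<delta> * m \<le> 1/2"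
  defines "B' \<equiv> \<lambda>i j. B i j - (if i = j then \<delta> else 0)"
  obtains R' where "posdef_on K B'" "inverse_on K B' R'" "trace_on K R' \<le> 2 * m"
    "trace_on K R' - trace_on K R \<le> \<delta> * (\<Sum>i\<in>K. \<Sum>j\<in>K. (R' i j)\<^sup>2)"
proof -
  have qf: "quad_form K B' c = quad_form K B c - \<delta> * (\<Sum>k\<in>K. (c k)\<^sup>2)" for c
  proof -
    have "quad_form K B' c
        = quad_form K B c - (\<Sum>i\<in>K. \<Sum>j\<in>K. (if i = j then \<delta> * (c j)\<^sup>2 else 0))"
      unfolding quad_form_def B'_def sum_subtractf[symmetric]
      by (intro sum.cong) (auto simp: algebra_simps power2_eq_square)
    then show ?thesis using fin by (simp add: sum_distrib_left)
  qed
  have B': "posdef_on K B'"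
    unfolding posdef_on_def
  proof (intro conjI ballI allI impI)
    fix i j assume "i \<in> K" "j \<in> K"
    then show "B' i j = B' j i" using posdef_on_sym[OF B] by (auto simp: B'_def)
  next
    fix c assume "\<exists>k\<in>K. c k \<noteq> (0::real)"
    then have S: "0 < (\<Sum>k\<in>K. (c k)\<^sup>2)" using fin by (auto intro!: sum_pos2)
    have "\<delta> < 1 / m" using \<delta> m by (simp add: field_simps)
    then have "\<delta> * (\<Sum>k\<in>K. (c k)\<^sup>2) < 1 / m * (\<Sum>k\<in>K. (c k)\<^sup>2)" using S by (rule mult_strict_right_mono)
    also have "\<dots> \<le> quad_form K B c"
      using posdef_on_lower_bound[OF fin B R tr m, of c] by simp
    finally show "0 < quad_form K B' c" unfolding qf by simp
  qed
  obtain R' where R': "inverse_on K B' R'" using posdef_on_inverse_exists[OF fin B'] by blast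
  \<comment> \<open>The resolvent identity \<open>R' - R = \<delta> R R'\<close>.\<close>
  have res: "R' i j - R i j = \<delta> * (\<Sum>k\<in>K. R i k * R' k j)" if ij: "i \<in> K" "j \<in> K" for i j
  proof -
    have "R i j = (\<Sum>k\<in>K. R i k * (if k = j then 1 else 0))"
      using fin ij by (simp add: if_distrib[of "\<lambda>x. _ * x"] cong: if_cong)
    also have "\<dots> = (\<Sum>k\<in>K. R i k * (\<Sum>l\<in>K. B' k l * R' l j))"
      using R' ij by (intro sum.cong) (auto simp: inverse_on_def)
    also have "\<dots> = (\<Sum>k\<in>K. R i k * ((\<Sum>l\<in>K. B k l * R' l j) - \<delta> * R' k j))"
    proof (intro sum.cong refl arg_cong2[where f="(*)"])
      fix k assume k: "k \<in> K"
      have "(\<Sum>l\<in>K. B' k l * R' l j)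
          = (\<Sum>l\<in>K. B k l * R' l j) - (\<Sum>l\<in>K. if k = l then \<delta> * R' l j else 0)"
        unfolding B'_def sum_subtractf[symmetric] by (intro sum.cong) (auto simp: algebra_simps)
      then show "(\<Sum>l\<in>K. B' k l * R' l j) = (\<Sum>l\<in>K. B k l * R' l j) - \<delta> * R' k j"
        using fin k by simp
    qed
    also have "\<dots> = (\<Sum>k\<in>K. R i k * (\<Sum>l\<in>K. B k l * R' l j)) - \<delta> * (\<Sum>k\<in>K. R i k * R' k j)"
      by (simp add: algebra_simps sum_subtractf sum_distrib_left)
    also have "(\<Sum>k\<in>K. R i k * (\<Sum>l\<in>K. B k l * R' l j)) = (\<Sum>l\<in>K. (\<Sum>k\<in>K. R i k * B k l) * R' l j)"
      unfolding sum_distrib_left sum_distrib_right by (subst sum.swap) (simp add: mult_ac)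
    also have "\<dots> = (\<Sum>l\<in>K. (if i = l then R' l j else 0))"
      using left_inverse_on[OF fin B R] ij by (intro sum.cong) auto
    also have "\<dots> = R' i j" using fin ij by simp
    finally show ?thesis by simp
  qed
  have symR: "R i j = R j i" if "i \<in> K" "j \<in> K" for i j
    by (rule inverse_on_sym[OF fin B R that])
  have symR': "R' i j = R' j i" if "i \<in> K" "j \<in> K" for i j
    by (rule inverse_on_sym[OF fin B' R' that])
  have posR: "0 \<le> quad_form K R c" for c by (rule inverse_on_nonneg[OF fin B R])
  have posR': "0 \<le> quad_form K R' c" for c by (rule inverse_on_nonneg[OF fin B' R'])
  have tr_diff: "trace_on K R' - trace_on K R = \<delta> * (\<Sum>i\<in>K. \<Sum>k\<in>K. R i k * R' i k)"
  proof -
    have "trace_on K R' - trace_on K R = (\<Sum>i\<in>K. \<delta> * (\<Sum>k\<in>K. R i k * R' k i))"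
      unfolding trace_on_def sum_subtractf[symmetric] using res by (intro sum.cong) auto
    also have "\<dots> = \<delta> * (\<Sum>i\<in>K. \<Sum>k\<in>K. R i k * R' i k)"
      unfolding sum_distrib_left using symR' by (intro sum.cong) auto
    finally show ?thesis .
  qed
  have trR'0: "0 \<le> trace_on K R'"
    unfolding trace_on_def using psd_entry_bound(1)[OF fin, of _ _ R'] posR'
    by (intro sum_nonneg) auto
  have "trace_on K R' - trace_on K R \<le> \<delta> * (trace_on K R * trace_on K R')"
    unfolding tr_diff using \<delta>(1)
    by (intro mult_left_mono psd_inner_le_traces fin posR posR' symR symR') auto
  also have "\<dots> \<le> \<delta> * (m * trace_on K R')"
    using tr trR'0 \<delta>(1) by (intro mult_left_mono mult_right_mono) auto
  also have "\<dots> = (\<delta> * m) * trace_on K R'" by simp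
  also have "\<dots> \<le> 1/2 * trace_on K R'" using \<delta>(2) trR'0 by (rule mult_right_mono)
  finally have 1: "trace_on K R' \<le> 2 * m" using tr by simp
  \<comment> \<open>The sum is the trace of \<open>R' R R'\<close>. By the resolvent identity,
    \<delta> times it is the trace of \<open>R' (R' - R)\<close>; its nonnegativity allows
    \<open>R\<close> to be replaced by \<open>R'\<close> in \<open>tr_diff\<close>.\<close>
  have "0 \<le> \<delta> * (\<Sum>i\<in>K. quad_form K R (\<lambda>k. R' k i))"
    using posR \<delta>(1) by (intro mult_nonneg_nonneg sum_nonneg) auto
  also have "\<dots> = (\<Sum>i\<in>K. \<Sum>j\<in>K. R' j i * (\<delta> * (\<Sum>k\<in>K. R j k * R' k i)))"
    unfolding quad_form_def by (simp add: sum_distrib_left mult_ac)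
  also have "\<dots> = (\<Sum>i\<in>K. \<Sum>j\<in>K. R' i j * (R' i j - R i j))"
  proof (intro sum.cong refl)
    fix i j assume ij: "i \<in> K" "j \<in> K"
    then show "R' j i * (\<delta> * (\<Sum>k\<in>K. R j k * R' k i)) = R' i j * (R' i j - R i j)"
      using res[of j i] symR[of i j] symR'[of i j] by simp
  qed
  finally have 2: "(\<Sum>i\<in>K. \<Sum>j\<in>K. R i j * R' i j) \<le> (\<Sum>i\<in>K. \<Sum>j\<in>K. (R' i j)\<^sup>2)"
    by (simp add: algebra_simps sum_subtractf power2_eq_square)
  show ?thesis
    using that[OF B' R' 1] 2 \<delta>(1) unfolding tr_diff by simp
qed

lemma quad_form_rank_one:
  "quad_form K (\<lambda>i j. B i j + s * v i * v j) c = quad_form K B c + s * (\<Sum>k\<in>K. v k * c k)\<^sup>2"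
proof -
  have "s * (\<Sum>k\<in>K. v k * c k)\<^sup>2 = (\<Sum>i\<in>K. \<Sum>j\<in>K. s * v i * v j * c i * c j)"
    unfolding power2_eq_square sum_product by (simp add: sum_distrib_left mult_ac)
  then show ?thesis
    unfolding quad_form_def by (simp add: distrib_right sum.distrib)
qed

lemma rank_one_step:
  fixes K :: "'i set" and v :: "'i \<Rightarrow> real"
  assumes fin: "finite K" and B: "posdef_on K B" and R: "inverse_on K B R" and s: "s > 0"
  defines "B' \<equiv> \<lambda>i j. B i j + s * v i * v j"
  obtains R' where "posdef_on K B'" "inverse_on K B' R'"
    "trace_on K R' = trace_on K R
       - s * (\<Sum>i\<in>K. (apply_on K R v i)\<^sup>2) / (1 + s * quad_form K R v)"
proof -
  define u where "u = apply_on K R v"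
  define b where "b = quad_form K R v"
  have b: "b = (\<Sum>i\<in>K. v i * u i)" unfolding b_def u_def by (rule quad_form_apply)
  have b0: "0 \<le> b" unfolding b_def by (rule inverse_on_nonneg[OF fin B R])
  have sb: "1 + s * b > 0" using b0 s by (simp add: add_pos_nonneg)
  \<comment> \<open>The Sherman-Morrison formula for the inverse after a rank-one update.\<close>
  define R' where "R' = (\<lambda>i j. R i j - s / (1 + s * b) * u i * u j)"
  have B': "posdef_on K B'"
    unfolding posdef_on_def
  proof (intro conjI ballI allI impI)
    fix i j assume "i \<in> K" "j \<in> K"
    then show "B' i j = B' j i" using posdef_on_sym[OF B] by (auto simp: B'_def)
  next
    fix c assume "\<exists>k\<in>K. c k \<noteq> (0::real)"
    then have "0 < quad_form K B c" using B by (simp add: posdef_on_def)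
    then show "0 < quad_form K B' c"
      unfolding B'_def quad_form_rank_one using s by (simp add: add_pos_nonneg)
  qed
  have R': "inverse_on K B' R'"
    unfolding inverse_on_def
  proof (intro ballI)
    fix i j assume ij: "i \<in> K" "j \<in> K"
    have vR: "(\<Sum>l\<in>K. v l * R l j) = u j"
      unfolding u_def apply_on_def using inverse_on_sym[OF fin B R] ij
      by (intro sum.cong) (auto simp: mult.commute)
    have Bu: "(\<Sum>l\<in>K. B i l * u l) = v i"
      using apply_inverse[OF fin B R ij(1), of v] by (simp add: u_def apply_on_def)
    have "(\<Sum>l\<in>K. B' i l * R' l j)
        = (\<Sum>l\<in>K. B i l * R l j) + s * v i * (\<Sum>l\<in>K. v l * R l j)
          - s / (1 + s * b) * u j * (\<Sum>l\<in>K. B i l * u l)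
          - s * v i * (s / (1 + s * b)) * u j * (\<Sum>l\<in>K. v l * u l)"
    proof -
      define q where "q = s / (1 + s * b)"
      show ?thesis
        unfolding B'_def R'_def q_def[symmetric]
        by (simp add: algebra_simps sum_subtractf sum.distrib sum_distrib_left)
    qed
    also have "\<dots> = (if i = j then 1 else 0) + s * v i * u j
        - s / (1 + s * b) * u j * v i - s * v i * (s / (1 + s * b)) * u j * b"
      using R ij unfolding vR Bu b[symmetric] by (simp add: inverse_on_def)
    also have "\<dots> = (if i = j then 1 else 0)
        + s * v i * u j * (1 - 1 / (1 + s * b) - s * b / (1 + s * b))"
      by (simp add: algebra_simps)
    also have "1 - 1 / (1 + s * b) - s * b / (1 + s * b) = 0" using sb by (simp add: field_simps)
    finally show "(\<Sum>l\<in>K. B' i l * R' l j) = (if i = j then 1 else 0)" by simp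
  qed
  have "trace_on K R' = trace_on K R - s * (\<Sum>i\<in>K. (u i)\<^sup>2) / (1 + s * b)"
    unfolding trace_on_def R'_def
    by (simp add: sum_subtractf power2_eq_square sum_distrib_left sum_divide_distrib mult.assoc)
  then show ?thesis using that[OF B' R'] by (simp add: u_def b_def)
qed

section \<open>One-sided barrier sampling\<close>

locale orthonormal_system = prob_space M for M :: "'a measure" +
  fixes K :: "'i set" and e :: "'i \<Rightarrow> 'a \<Rightarrow> real"
  assumes fin: "finite K"
    and integrable_mult: "\<And>k l. k \<in> K \<Longrightarrow> l \<in> K \<Longrightarrow> integrable M (\<lambda>x. e k x * e l x)"
    and integral_mult: "\<And>k l. k \<in> K \<Longrightarrow> l \<in> K \<Longrightarrow> (LINT x|M. e k x * e l x) = (if k = l then 1 else 0)"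
begin

lemma
  shows integrable_quad_form: "integrable M (\<lambda>x. quad_form K B (\<lambda>k. e k x))"
    and integral_quad_form: "(LINT x|M. quad_form K B (\<lambda>k. e k x)) = trace_on K B"
proof -
  have int: "integrable M (\<lambda>x. B i j * e i x * e j x)" if "i \<in> K" "j \<in> K" for i j
    using integrable_mult_right[OF integrable_mult[OF that], of "B i j"] by (simp add: mult.assoc)
  show "integrable M (\<lambda>x. quad_form K B (\<lambda>k. e k x))"
    unfolding quad_form_def by (intro Bochner_Integration.integrable_sum int)
  have "(LINT x|M. quad_form K B (\<lambda>k. e k x)) = (\<Sum>i\<in>K. \<Sum>j\<in>K. LINT x|M. B i j * e i x * e j x)"
    unfolding quad_form_def by (simp add: Bochner_Integration.integral_sum int)
  also have "\<dots> = (\<Sum>i\<in>K. \<Sum>j\<in>K. B i j * (if i = j then 1 else 0))"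
    by (intro sum.cong refl) (simp add: mult.assoc integral_mult)
  finally show "(LINT x|M. quad_form K B (\<lambda>k. e k x)) = trace_on K B"
    using fin by (simp add: trace_on_def if_distrib[of "\<lambda>x. _ * x"] cong: if_cong)
qed

lemma square_sum_quad_form: "(\<Sum>k\<in>K. c k * u k)\<^sup>2 = quad_form K (\<lambda>i j. c i * c j) u"
  unfolding quad_form_def power2_eq_square sum_product by (simp add: mult_ac)

lemma
  shows integrable_square_sum: "integrable M (\<lambda>x. (\<Sum>k\<in>K. c k * e k x)\<^sup>2)"
    and integral_square_sum: "(LINT x|M. (\<Sum>k\<in>K. c k * e k x)\<^sup>2) = (\<Sum>k\<in>K. (c k)\<^sup>2)"
  using integrable_quad_form[of "\<lambda>i j. c i * c j"] integral_quad_form[of "\<lambda>i j. c i * c j"]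
  by (simp_all add: square_sum_quad_form trace_on_def power2_eq_square[of "c _"])

text \<open>By orthonormality the mean over \<open>y\<close> of the squared norm of
  \<open>R e(y)\<close> is the squared Frobenius norm of \<open>R\<close>, and the mean of the form
  \<open>R\<close> at \<open>e(y)\<close> is its trace. Hence the inequality holds on average over
  the probability space, so it cannot fail everywhere. With a single barrier there is only one
  inequality to satisfy at the point.\<close>

lemma exists_good_point:
  assumes tr: "trace_on K R \<le> 2 * m" and s: "s \<ge> 0"
  shows "\<exists>y\<in>space M. (\<Sum>i\<in>K. \<Sum>j\<in>K. (R i j)\<^sup>2) * (1 + s * quad_form K R (\<lambda>k. e k y))
     \<le> (\<Sum>i\<in>K. (apply_on K R (\<lambda>k. e k y) i)\<^sup>2) * (1 + 2 * m * s)"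
proof (rule ccontr)
  define T where "T = (\<Sum>i\<in>K. \<Sum>j\<in>K. (R i j)\<^sup>2)"
  define f where "f = (\<lambda>y. (\<Sum>i\<in>K. (apply_on K R (\<lambda>k. e k y) i)\<^sup>2) * (1 + 2 * m * s))"
  define g where "g = (\<lambda>y. T * (1 + s * quad_form K R (\<lambda>k. e k y)))"
  assume "\<not> ?thesis"
  then have lt: "f y < g y" if "y \<in> space M" for y
    using that unfolding f_def g_def T_def by (auto simp: not_le)
  have sq: "integrable M (\<lambda>y. \<Sum>i\<in>K. (apply_on K R (\<lambda>k. e k y) i)\<^sup>2)"
    unfolding apply_on_def by (intro Bochner_Integration.integrable_sum integrable_square_sum)
  have f: "integrable M f" unfolding f_def using sq by simp
  have g: "integrable M g"
    unfolding g_def using integrable_quad_form[of R] by simp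
  have "T * (1 + 2 * m * s) = integral\<^sup>L M f"
    unfolding f_def using integrable_square_sum
    by (simp add: apply_on_def integral_square_sum T_def)
  also have "\<dots> < integral\<^sup>L M g"
    using lt by (intro integral_less_AE_space f g) (auto simp: emeasure_space_1)
  also have "\<dots> = T * (1 + s * trace_on K R)"
    unfolding g_def using integrable_quad_form[of R] by (simp add: integral_quad_form prob_space)
  also have "\<dots> \<le> T * (1 + 2 * m * s)"
    using mult_left_mono[OF tr s] by (intro mult_left_mono) (auto simp: T_def sum_nonneg mult_ac)
  finally show False by simp
qed

text \<open>
  One barrier of Batson, Spielman and Srivastava: the invariant is that the trace of
  \<open>(diag a + s (\<Sum>i<j. e(x\<^sub>i) e(x\<^sub>i)\<^sup>T) - l\<^sub>j)\<inverse>\<close> stays below \<open>m\<close> while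
  \<open>l\<^sub>j = -1 + j / (8 m)\<close> moves from \<open>-1\<close> to \<open>1\<close>.
\<close>

theorem barrier_sampling:
  assumes a: "\<And>k. k \<in> K \<Longrightarrow> 0 \<le> a k" and m: "m > 0" and am: "(\<Sum>k\<in>K. 1 / (1 + a k)) \<le> m"
    and J: "16 * m \<le> real J"
  shows "\<exists>x. (\<forall>i<J. x i \<in> space M) \<and> (\<forall>c. (\<Sum>k\<in>K. (c k)\<^sup>2) \<le>
     (\<Sum>k\<in>K. a k * (c k)\<^sup>2) + 1 / (4 * m) * (\<Sum>i<J. (\<Sum>k\<in>K. e k (x i) * c k)\<^sup>2))"
proof -
  \<comment> \<open>With this \<open>s\<close> the factor \<open>1 + 2 * m * s\<close> of a good
    point is 3/2, so the new point lowers the trace by at least \<open>2/3 * s = 1 / (6 * m)\<close>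
    times the squared Frobenius norm. This exceeds the cost \<open>\<delta> = 1 / (8 * m)\<close> of
    the shift, and \<open>16 * m\<close> shifts move the barrier by 2.\<close>
  define s where "s = 1 / (4 * m)"
  define \<delta> where "\<delta> = 1 / (8 * m)"
  have s: "s > 0" and \<delta>: "\<delta> > 0" and \<delta>m: "\<delta> * m \<le> 1/2" using m by (auto simp: s_def \<delta>_def)
  define B where "B = (\<lambda>j x i k. (if i = k then a i + 1 - real j * \<delta> else 0)
     + s * (\<Sum>t<j. e i (x t) * e k (x t)))"
  have "\<exists>x R. (\<forall>t<j. x t \<in> space M) \<and> posdef_on K (B j x) \<and> inverse_on K (B j x) R \<and> trace_on K R \<le> m"
    for j
  proof (induction j)
    case 0
    define R where "R = (\<lambda>i k. if i = k then 1 / (1 + a i) else 0)"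
    obtain x0 where "x0 \<in> space M" using not_empty by blast
    have B0: "B 0 x = (\<lambda>i k. if i = k then a i + 1 else 0)" for x by (auto simp: B_def fun_eq_iff)
    have "apply_on K (B 0 x) c k = (a k + 1) * c k" if "k \<in> K" for x c k
      unfolding B0 apply_on_def using fin that
      by (simp add: if_distrib[of "\<lambda>x. x * _"] cong: if_cong)
    then have q: "quad_form K (B 0 x) c = (\<Sum>k\<in>K. (a k + 1) * (c k)\<^sup>2)" for x c
      unfolding quad_form_apply by (intro sum.cong) (auto simp: power2_eq_square)
    have "posdef_on K (B 0 (\<lambda>_. x0))"
      unfolding posdef_on_def q
    proof (intro conjI allI impI ballI)
      fix c :: "'i \<Rightarrow> real" assume "\<exists>k\<in>K. c k \<noteq> 0"
      then obtain k where k: "k \<in> K" "c k \<noteq> 0" by blast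
      show "0 < (\<Sum>k\<in>K. (a k + 1) * (c k)\<^sup>2)"
        using a k fin
        by (intro sum_pos2[OF fin k(1)] mult_pos_pos mult_nonneg_nonneg) (auto simp: add_nonneg_pos)
    qed (auto simp: B0)
    moreover have "a k + 1 \<noteq> 0" if "k \<in> K" for k using a[OF that] by linarith
    then have "inverse_on K (B 0 (\<lambda>_. x0)) R"
      unfolding inverse_on_def B0 R_def using fin
      by (auto simp: if_distrib[of "\<lambda>x. x * _"] if_distrib[of "\<lambda>x. _ * x"] field_simps cong: if_cong)
    moreover have "trace_on K R \<le> m" using am by (simp add: trace_on_def R_def)
    ultimately show ?case by blast
  next
    case (Suc j)
    then obtain x R where x: "\<forall>t<j. x t \<in> space M" and pd: "posdef_on K (B j x)"
      and inv: "inverse_on K (B j x) R" and tr: "trace_on K R \<le> m" by blast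
    obtain R1 where R1: "posdef_on K (\<lambda>i k. B j x i k - (if i = k then \<delta> else 0))"
      "inverse_on K (\<lambda>i k. B j x i k - (if i = k then \<delta> else 0)) R1" "trace_on K R1 \<le> 2 * m"
      "trace_on K R1 - trace_on K R \<le> \<delta> * (\<Sum>i\<in>K. \<Sum>j\<in>K. (R1 i j)\<^sup>2)"
      using shift_step[OF fin pd inv tr m \<delta> \<delta>m] by blast
    define T where "T = (\<Sum>i\<in>K. \<Sum>j\<in>K. (R1 i j)\<^sup>2)"
    have T0: "T \<ge> 0" by (simp add: T_def sum_nonneg)
    obtain y where y: "y \<in> space M" and good: "T * (1 + s * quad_form K R1 (\<lambda>k. e k y))
     \<le> (\<Sum>i\<in>K. (apply_on K R1 (\<lambda>k. e k y) i)\<^sup>2) * (1 + 2 * m * s)"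
      using exists_good_point[OF R1(3), of s] s unfolding T_def by auto
    obtain R2 where R2: "posdef_on K (\<lambda>i k. B j x i k - (if i = k then \<delta> else 0) + s * e i y * e k y)"
      "inverse_on K (\<lambda>i k. B j x i k - (if i = k then \<delta> else 0) + s * e i y * e k y) R2"
      "trace_on K R2 = trace_on K R1 - s * (\<Sum>i\<in>K. (apply_on K R1 (\<lambda>k. e k y) i)\<^sup>2)
          / (1 + s * quad_form K R1 (\<lambda>k. e k y))"
      using rank_one_step[OF fin R1(1,2) s, of "\<lambda>k. e k y"] by blast
    define q where "q = 1 + s * quad_form K R1 (\<lambda>k. e k y)"
    define S where "S = (\<Sum>i\<in>K. (apply_on K R1 (\<lambda>k. e k y) i)\<^sup>2)"
    have q: "q > 0"
      using inverse_on_nonneg[OF fin R1(1,2), of "\<lambda>k. e k y"] s by (simp add: q_def add_pos_nonneg)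
    have "T * q \<le> S * (3/2)" using good m by (simp add: q_def S_def s_def)
    then have "s * (T * q) \<le> s * (S * (3/2))" using s by (intro mult_left_mono) auto
    then have "2/3 * s * T \<le> s * S / q" using q by (simp add: field_simps)
    moreover have "\<delta> * T \<le> 2/3 * s * T"
      using T0 m by (intro mult_right_mono) (auto simp: \<delta>_def s_def field_simps)
    ultimately have "trace_on K R2 \<le> m"
      using R1(4) tr unfolding R2(3) T_def[symmetric] S_def[symmetric] q_def[symmetric] by linarith
    moreover have eq: "(\<lambda>i k. B j x i k - (if i = k then \<delta> else 0) + s * e i y * e k y)
        = B (Suc j) (x(j := y))"
      by (auto simp: B_def fun_eq_iff algebra_simps)
    moreover have "\<forall>t<Suc j. (x(j := y)) t \<in> space M" using x y by (auto simp: less_Suc_eq)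
    ultimately show ?case
      using R2(1,2) unfolding eq by blast
  qed
  then obtain x R where x: "\<forall>t<J. x t \<in> space M" and pd: "posdef_on K (B J x)" by blast
  have "(\<Sum>k\<in>K. (c k)\<^sup>2) \<le>
     (\<Sum>k\<in>K. a k * (c k)\<^sup>2) + s * (\<Sum>i<J. (\<Sum>k\<in>K. e k (x i) * c k)\<^sup>2)" for c
  proof -
    have "quad_form K (B J x) c = (\<Sum>i\<in>K. \<Sum>k\<in>K. (if i = k then (a i + 1 - real J * \<delta>) * (c k)\<^sup>2 else 0))
        + s * (\<Sum>i\<in>K. \<Sum>k\<in>K. \<Sum>t<J. (e i (x t) * c i) * (e k (x t) * c k))"
      unfolding quad_form_def sum_distrib_left[of s] sum.distrib[symmetric]
    proof (intro sum.cong refl)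
      fix i k
      have "(\<Sum>t<J. (e i (x t) * c i) * (e k (x t) * c k)) = (\<Sum>t<J. e i (x t) * e k (x t)) * c i * c k"
        unfolding sum_distrib_right by (simp add: mult_ac)
      then show "B J x i k * c i * c k = (if i = k then (a i + 1 - real J * \<delta>) * (c k)\<^sup>2 else 0)
          + (\<Sum>t<J. s * ((e i (x t) * c i) * (e k (x t) * c k)))"
        unfolding sum_distrib_left[symmetric] by (simp add: B_def algebra_simps power2_eq_square)
    qed
    also have "(\<Sum>i\<in>K. \<Sum>k\<in>K. \<Sum>t<J. (e i (x t) * c i) * (e k (x t) * c k))
       = (\<Sum>t<J. (\<Sum>k\<in>K. e k (x t) * c k)\<^sup>2)"
    proof -
      have "(\<Sum>i\<in>K. \<Sum>k\<in>K. \<Sum>t<J. (e i (x t) * c i) * (e k (x t) * c k))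
        = (\<Sum>i\<in>K. \<Sum>t<J. \<Sum>k\<in>K. (e i (x t) * c i) * (e k (x t) * c k))"
        by (intro sum.cong refl sum.swap)
      also have "\<dots> = (\<Sum>t<J. \<Sum>i\<in>K. \<Sum>k\<in>K. (e i (x t) * c i) * (e k (x t) * c k))"
        by (rule sum.swap)
      finally show ?thesis by (simp add: power2_eq_square sum_product)
    qed
    finally have "0 \<le> (\<Sum>k\<in>K. (a k + 1 - real J * \<delta>) * (c k)\<^sup>2)
        + s * (\<Sum>t<J. (\<Sum>k\<in>K. e k (x t) * c k)\<^sup>2)"
      using posdef_on_nonneg[OF pd, of c] fin by simp
    moreover have "(\<Sum>k\<in>K. (a k + 1 - real J * \<delta>) * (c k)\<^sup>2)
        \<le> (\<Sum>k\<in>K. a k * (c k)\<^sup>2 - (c k)\<^sup>2)"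
    proof (rule sum_mono)
      fix k
      \<comment> \<open>The barrier has travelled from -1 to at least 1, so the diagonal
        \<open>a k + 1 - real J * \<delta>\<close> is at most \<open>a k - 1\<close>; the -1 becomes
        the left-hand side of the claim.\<close>
      have "2 \<le> real J * \<delta>" using J m by (simp add: \<delta>_def field_simps)
      then have "(a k + 1 - real J * \<delta>) * (c k)\<^sup>2 \<le> (a k - 1) * (c k)\<^sup>2"
        by (intro mult_right_mono) auto
      then show "(a k + 1 - real J * \<delta>) * (c k)\<^sup>2 \<le> a k * (c k)\<^sup>2 - (c k)\<^sup>2"
        by (simp add: algebra_simps)
    qed
    ultimately show ?thesis by (simp add: sum_subtractf)
  qed
  then show ?thesis using x unfolding s_def by blast
qed

lemma bessel:
  assumes e: "\<And>k. k \<in> K \<Longrightarrow> integrable M (\<lambda>x. e k x * f x)" and f: "integrable M (\<lambda>x. (f x)\<^sup>2)"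
  shows "(\<Sum>k\<in>K. (LINT x|M. e k x * f x)\<^sup>2) \<le> (LINT x|M. (f x)\<^sup>2)"
proof -
  define c where "c = (\<lambda>k. LINT x|M. e k x * f x)"
  have eq: "(f x - (\<Sum>k\<in>K. c k * e k x))\<^sup>2
      = (f x)\<^sup>2 - 2 * (\<Sum>k\<in>K. c k * (e k x * f x)) + (\<Sum>k\<in>K. c k * e k x)\<^sup>2" for x
    by (simp add: power2_diff sum_distrib_left mult_ac)
  have i: "integrable M (\<lambda>x. \<Sum>k\<in>K. c k * (e k x * f x))"
    by (intro Bochner_Integration.integrable_sum integrable_mult_right e)
  have "0 \<le> (LINT x|M. (f x - (\<Sum>k\<in>K. c k * e k x))\<^sup>2)" by simp
  also have "\<dots> = (LINT x|M. (f x)\<^sup>2) - 2 * (LINT x|M. (\<Sum>k\<in>K. c k * (e k x * f x)))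
      + (\<Sum>k\<in>K. (c k)\<^sup>2)"
    unfolding eq using f i integrable_square_sum[of c]
    by (simp add: integral_square_sum)
  also have "(LINT x|M. (\<Sum>k\<in>K. c k * (e k x * f x))) = (\<Sum>k\<in>K. (c k)\<^sup>2)"
    using e by (simp add: Bochner_Integration.integral_sum c_def power2_eq_square)
  finally show ?thesis by (simp add: c_def)
qed

end

text \<open>
  The regularised least squares estimator, in coordinates. The estimate follows by testing the
  normal equation with the error itself.
\<close>

lemma regularised_least_squares:
  fixes e :: "nat \<Rightarrow> 'i \<Rightarrow> real"
  assumes fin: "finite K" and s: "0 \<le> s" and a: "\<And>k. k \<in> K \<Longrightarrow> 0 \<le> a k"
    and lower: "\<And>c. (\<Sum>k\<in>K. (c k)\<^sup>2) \<le> (\<Sum>k\<in>K. a k * (c k)\<^sup>2) + s * (\<Sum>i<J. (\<Sum>k\<in>K. e i k * c k)\<^sup>2)"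
  shows "\<exists>\<psi>. \<forall>c h. (\<Sum>k\<in>K. ((\<Sum>i<J. ((\<Sum>l\<in>K. e i l * c l) + h i) * \<psi> i k) - c k)\<^sup>2)
     \<le> (\<Sum>k\<in>K. a k * (c k)\<^sup>2) + s * (\<Sum>i<J. (h i)\<^sup>2)"
proof -
  define A where "A = (\<lambda>k l. (if k = l then a k else 0) + s * (\<Sum>i<J. e i k * e i l))"
  have AA: "apply_on K A c k = a k * c k + s * (\<Sum>i<J. e i k * (\<Sum>l\<in>K. e i l * c l))" if "k \<in> K" for c k
  proof -
    have "apply_on K A c k = (\<Sum>l\<in>K. if k = l then a k * c l else 0)
        + s * (\<Sum>l\<in>K. \<Sum>i<J. e i k * (e i l * c l))"
      unfolding apply_on_def A_def sum_distrib_left sum.distrib[symmetric]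
      by (intro sum.cong refl) (auto simp: algebra_simps sum_distrib_left)
    also have "(\<Sum>l\<in>K. \<Sum>i<J. e i k * (e i l * c l)) = (\<Sum>i<J. e i k * (\<Sum>l\<in>K. e i l * c l))"
      by (subst sum.swap) (simp add: sum_distrib_left)
    finally show ?thesis using fin that by simp
  qed
  have swap: "(\<Sum>k\<in>K. c k * (\<Sum>i<J. e i k * d i)) = (\<Sum>i<J. d i * (\<Sum>k\<in>K. e i k * c k))" for c d
    unfolding sum_distrib_left by (subst sum.swap) (simp add: mult_ac)
  have qA: "quad_form K A c = (\<Sum>k\<in>K. a k * (c k)\<^sup>2) + s * (\<Sum>i<J. (\<Sum>k\<in>K. e i k * c k)\<^sup>2)" for c
  proof -
    have "quad_form K A c = (\<Sum>k\<in>K. a k * (c k)\<^sup>2)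
        + s * (\<Sum>k\<in>K. c k * (\<Sum>i<J. e i k * (\<Sum>l\<in>K. e i l * c l)))"
      unfolding quad_form_apply sum_distrib_left[of s] sum.distrib[symmetric]
      by (intro sum.cong refl) (simp add: AA algebra_simps power2_eq_square)
    then show ?thesis unfolding swap by (simp add: power2_eq_square)
  qed
  have pd: "posdef_on K A"
    unfolding posdef_on_def
  proof (intro conjI ballI allI impI)
    fix c assume "\<exists>k\<in>K. c k \<noteq> (0::real)"
    then have "0 < (\<Sum>k\<in>K. (c k)\<^sup>2)" using fin by (auto intro!: sum_pos2)
    then show "0 < quad_form K A c" unfolding qA using lower[of c] by simp
  qed (auto simp: A_def mult.commute)
  obtain R where R: "inverse_on K A R" using posdef_on_inverse_exists[OF fin pd] by blast
  \<comment> \<open>For data \<open>y\<close> the vector with entries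
    \<open>\<Sum>i<J. y i * \<psi> i k\<close> solves the normal equation, that is, it minimises the
    sum of \<open>a k * (c k)\<^sup>2\<close> plus \<open>s\<close> times the squared
    residuals.\<close>
  define \<psi> where "\<psi> = (\<lambda>i. apply_on K R (\<lambda>k. s * e i k))"
  have "(\<Sum>k\<in>K. ((\<Sum>i<J. ((\<Sum>l\<in>K. e i l * c l) + h i) * \<psi> i k) - c k)\<^sup>2)
     \<le> (\<Sum>k\<in>K. a k * (c k)\<^sup>2) + s * (\<Sum>i<J. (h i)\<^sup>2)" for c h
  proof -
    define y where "y = (\<lambda>i. (\<Sum>l\<in>K. e i l * c l) + h i)"
    define w where "w = (\<lambda>k. (\<Sum>i<J. y i * \<psi> i k) - c k)"
    define E where "E = (\<lambda>i. \<Sum>k\<in>K. e i k * w k)"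
    have Aw: "apply_on K A w k = s * (\<Sum>i<J. e i k * h i) - a k * c k" if k: "k \<in> K" for k
    proof -
      have "apply_on K A w k = (\<Sum>i<J. y i * apply_on K A (\<psi> i) k) - apply_on K A c k"
      proof -
        have "apply_on K A w k = (\<Sum>l\<in>K. \<Sum>i<J. y i * (A k l * \<psi> i l)) - apply_on K A c k"
          unfolding w_def apply_on_def by (simp add: algebra_simps sum_subtractf sum_distrib_left)
        then show ?thesis
          by (subst (asm) sum.swap) (simp add: apply_on_def sum_distrib_left)
      qed
      also have "\<dots> = (\<Sum>i<J. y i * (s * e i k)) - apply_on K A c k"
        unfolding \<psi>_def by (simp add: apply_inverse[OF fin pd R k])
      also have "\<dots> = s * (\<Sum>i<J. e i k * h i) - a k * c k"
        unfolding AA[OF k] y_def by (simp add: algebra_simps sum.distrib sum_distrib_left)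
      finally show ?thesis .
    qed
    have q1: "quad_form K A w = s * (\<Sum>i<J. h i * E i) - (\<Sum>k\<in>K. a k * c k * w k)"
    proof -
      have "quad_form K A w = s * (\<Sum>k\<in>K. w k * (\<Sum>i<J. e i k * h i)) - (\<Sum>k\<in>K. a k * c k * w k)"
        unfolding quad_form_apply sum_distrib_left[of s] sum_subtractf[symmetric]
        by (intro sum.cong refl) (simp add: Aw algebra_simps)
      then show ?thesis unfolding swap by (simp add: E_def)
    qed
    have q2: "quad_form K A w = (\<Sum>k\<in>K. a k * (w k)\<^sup>2) + s * (\<Sum>i<J. (E i)\<^sup>2)"
      unfolding qA E_def ..
    have young: "2 * u * v \<le> u\<^sup>2 + v\<^sup>2" for u v :: real
      using zero_le_power2[of "u - v"] by (simp add: power2_diff)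
    \<comment> \<open>Twice \<open>q1\<close> will be bounded by the claimed right-hand side plus
      the expression in \<open>q2\<close>. The latter is \<open>quad_form K A w\<close> again, so
      one copy is absorbed on the left.\<close>
    have "2 * (\<Sum>i<J. h i * E i) \<le> (\<Sum>i<J. (h i)\<^sup>2) + (\<Sum>i<J. (E i)\<^sup>2)"
      unfolding sum_distrib_left sum.distrib[symmetric]
      using young by (intro sum_mono) (simp add: mult.assoc)
    then have "s * (2 * (\<Sum>i<J. h i * E i)) \<le> s * ((\<Sum>i<J. (h i)\<^sup>2) + (\<Sum>i<J. (E i)\<^sup>2))"
      using s by (rule mult_left_mono)
    moreover have "- 2 * (\<Sum>k\<in>K. a k * c k * w k) \<le> (\<Sum>k\<in>K. a k * (c k)\<^sup>2) + (\<Sum>k\<in>K. a k * (w k)\<^sup>2)"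
      unfolding sum_distrib_left sum.distrib[symmetric]
    proof (intro sum_mono)
      fix k assume "k \<in> K"
      then have "a k * (2 * (- c k) * w k) \<le> a k * ((- c k)\<^sup>2 + (w k)\<^sup>2)"
        using a young[of "- c k" "w k"] by (intro mult_left_mono) auto
      then show "- 2 * (a k * c k * w k) \<le> a k * (c k)\<^sup>2 + a k * (w k)\<^sup>2"
        by (simp add: algebra_simps)
    qed
    ultimately have "quad_form K A w \<le> (\<Sum>k\<in>K. a k * (c k)\<^sup>2) + s * (\<Sum>i<J. (h i)\<^sup>2)"
      using q1 q2 by (simp add: algebra_simps)
    moreover have "(\<Sum>k\<in>K. (w k)\<^sup>2) \<le> quad_form K A w" unfolding qA by (rule lower)
    ultimately show ?thesis unfolding w_def y_def by simp
  qed
  then show ?thesis by blast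
qed

section \<open>The Hartley basis of the torus\<close>

text \<open>
  A real orthonormal basis. The phase \<open>sgn k * \<theta>\<close> is chosen such that the terms for \<open>k\<close> and \<open>- k\<close>
  of \<open>\<Sum>\<^sub>k hartley \<theta> k x * hartley 0 k y\<close> add up to \<open>2 cos (2 \<pi> k (x - y) - \<theta>)\<close>, a term of the kernel.
\<close>

definition hartley :: "real \<Rightarrow> int \<Rightarrow> real \<Rightarrow> real" where
  "hartley \<theta> k t = 
     cos (2 * pi * real_of_int k * t - real_of_int (sgn k) * \<theta>) +
     sin (2 * pi * real_of_int k * t - real_of_int (sgn k) * \<theta>)"

lemma hartley_square_le: "(hartley \<theta> k t)\<^sup>2 \<le> 2"
proof -
  have "(cos u + sin u)\<^sup>2 = 2 * ((sin u)\<^sup>2 + (cos u)\<^sup>2) - (cos u - sin u)\<^sup>2" for u :: real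
    by (simp add: power2_eq_square algebra_simps)
  then have "(cos u + sin u)\<^sup>2 \<le> 2" for u :: real by simp
  then show ?thesis unfolding hartley_def .
qed

lemma continuous_on_hartley [continuous_intros]:
  fixes f :: "'a::t2_space \<Rightarrow> real"
  shows "continuous_on S f \<Longrightarrow> continuous_on S (\<lambda>x. hartley \<theta> k (f x))"
  unfolding hartley_def by (intro continuous_intros)

lemma hartley_periodic: "hartley \<theta> k (t + 1) = hartley \<theta> k t"
proof -
  have "2 * pi * real_of_int k * (t + 1) - real_of_int (sgn k) * \<theta>
      = (2 * pi * real_of_int k * t - real_of_int (sgn k) * \<theta>) + 2 * pi * real_of_int k"
    by (simp add: algebra_simps)
  then show ?thesis
    unfolding hartley_def by (simp only: sin_add cos_add cos_int_2pin sin_int_2pin mult_1_right mult_zero_right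
        diff_zero add_0_right)
qed

lemma has_integral_cos_shift:
  "((\<lambda>t. cos (2 * pi * real_of_int m * t + c)) has_integral (if m = 0 then cos c else 0)) {0..1}"
proof (cases "m = 0")
  case True
  then show ?thesis using has_integral_const_real[of "cos c" 0 1] by simp
next
  case False
  have "((\<lambda>t. cos (2 * pi * real_of_int m * t + c)) has_integral
      (sin (2 * pi * real_of_int m * 1 + c) / (2 * pi * m) - sin (2 * pi * real_of_int m * 0 + c) / (2 * pi * m))) {0..1}"
  proof (rule fundamental_theorem_of_calculus)
    fix t :: real
    show "((\<lambda>t. sin (2 * pi * real_of_int m * t + c) / (2 * pi * m)) has_vector_derivative
        cos (2 * pi * real_of_int m * t + c)) (at t within {0..1})"
      unfolding has_real_derivative_iff_has_vector_derivative[symmetric]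
      using False by (auto intro!: derivative_eq_intros)
  qed simp
  moreover have "sin (2 * pi * real_of_int m * 1 + c) = sin c"
    by (simp only: mult_1_right sin_add cos_int_2pin sin_int_2pin mult_zero_left mult_1_left add_0_left)
  ultimately show ?thesis using False by simp
qed

lemma has_integral_sin_shift:
  "((\<lambda>t. sin (2 * pi * real_of_int m * t + c)) has_integral (if m = 0 then sin c else 0)) {0..1}"
proof -
  have "cos (u - pi / 2) = sin u" for u :: real by (simp add: cos_diff)
  note s = this
  show ?thesis
    using has_integral_cos_shift[of m "c - pi / 2"] unfolding add_diff_eq s .
qed

lemma hartley_mult:
  "hartley \<theta> k t * hartley \<theta> l t =
     cos (2 * pi * real_of_int (k - l) * t + real_of_int (sgn l - sgn k) * \<theta>) +
     sin (2 * pi * real_of_int (k + l) * t + real_of_int (- sgn l - sgn k) * \<theta>)"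
proof -
  have "(cos u + sin u) * (cos v + sin v) = cos (u - v) + sin (u + v)" for u v :: real
    by (simp add: cos_diff sin_add algebra_simps)
  then show ?thesis unfolding hartley_def by (simp add: algebra_simps)
qed

text \<open>Only \<open>l = k\<close> and \<open>l = - k\<close> produce a term of frequency zero.
  In the second case the phases cancel because \<open>sgn\<close> is odd, and the constant sine is
  zero; so orthonormality survives the phase shift.\<close>

lemma integral_hartley_mult:
  "integral {0..1} (\<lambda>t. hartley \<theta> k t * hartley \<theta> l t) = (if k = l then 1 else 0)"
proof -
  have "((\<lambda>t. hartley \<theta> k t * hartley \<theta> l t) has_integral
     ((if k - l = 0 then cos (real_of_int (sgn l - sgn k) * \<theta>) else 0) +
      (if k + l = 0 then sin (real_of_int (- sgn l - sgn k) * \<theta>) else 0))) {0..1}"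
    unfolding hartley_mult
    by (intro has_integral_add has_integral_cos_shift has_integral_sin_shift)
  moreover have "sin (real_of_int (- sgn l - sgn k) * \<theta>) = 0" if "k + l = 0"
  proof -
    have "l = - k" using that by simp
    then show ?thesis by (simp add: sgn_minus)
  qed
  then have "(if k + l = 0 then sin (real_of_int (- sgn l - sgn k) * \<theta>) else 0) = 0"
    by (simp only: if_cancel cong: if_cong)
  moreover have "(if k - l = 0 then cos (real_of_int (sgn l - sgn k) * \<theta>) else 0) = (if k = l then 1 else 0)"
    by simp
  ultimately show ?thesis by (simp only: add_0_right integral_unique)
qed

section \<open>Product integrals and the tensor product basis on the torus\<close>

lemma prod_Basis_vec: "(\<Prod>b\<in>(Basis :: (real ^ 'd) set). g b) = (\<Prod>j\<in>UNIV. g (axis j 1))"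
proof -
  have B: "(Basis :: (real ^ 'd) set) = range (\<lambda>j. axis j 1)" by (auto simp: Basis_vec_def)
  have "inj (\<lambda>j. axis j 1 :: real ^ 'd)" by (auto simp: inj_on_def axis_eq_axis)
  then show ?thesis unfolding B by (simp add: prod.reindex)
qed

lemma lborel_integral_prod:
  fixes f :: "'a::euclidean_space \<Rightarrow> real \<Rightarrow> real"
  assumes f: "\<And>b. b \<in> Basis \<Longrightarrow> integrable lborel (f b)"
  shows "(LINT x|lborel. (\<Prod>b\<in>Basis. f b (x \<bullet> b))) = (\<Prod>b\<in>Basis. integral\<^sup>L lborel (f b))"
proof -
  interpret product_sigma_finite "\<lambda>_::'a. lborel :: real measure" by standard
  have [measurable]: "f b \<in> borel_measurable borel" if "b \<in> Basis" for b
    using f[OF that] borel_measurable_integrable by fastforce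
  have "(LINT x|(lborel :: 'a measure). (\<Prod>b\<in>Basis. f b (x \<bullet> b)))
     = (LINT u|(\<Pi>\<^sub>M b\<in>Basis. lborel). (\<Prod>b\<in>Basis. f b ((\<Sum>c\<in>Basis. u c *\<^sub>R c) \<bullet> b)))"
    unfolding lborel_eq[where 'a = 'a] by (rule integral_distr) measurable
  also have "\<dots> = (LINT u|(\<Pi>\<^sub>M b\<in>Basis. lborel). (\<Prod>b\<in>Basis. f b (u b)))"
    by (intro Bochner_Integration.integral_cong prod.cong refl) simp
  also have "\<dots> = (\<Prod>b\<in>Basis. integral\<^sup>L lborel (f b))"
    by (intro product_integral_prod f) auto
  finally show ?thesis .
qed

lemma measurable_lebesgue_on_borel:
  "f \<in> borel_measurable borel \<Longrightarrow> f \<in> borel_measurable (lebesgue_on S)"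
  by (simp add: measurable_completion measurable_restrict_space1)

lemma torus_sets [simp]: "torus \<in> sets lebesgue"
  unfolding torus_def by simp

lemma mem_torus: "x \<in> torus \<longleftrightarrow> (\<forall>j. x $ j \<in> {0..1})"
  by (auto simp: torus_def mem_box_cart)

lemma integrable_torus_continuous:
  fixes f :: "real ^ 'd \<Rightarrow> 'b::euclidean_space"
  shows "continuous_on UNIV f \<Longrightarrow> integrable torus_measure f"
  unfolding torus_def by (rule continuous_imp_integrable) (rule continuous_on_subset, auto)

text \<open>The indicator of the cube is a product as well, so restricting to the torus can be moved
  into the one-dimensional factors before Fubini is applied.\<close>

lemma torus_integral_prod:
  fixes g :: "'d::finite \<Rightarrow> real \<Rightarrow> real"
  assumes g: "\<And>j. continuous_on UNIV (g j)"
  shows "(LINT x|torus_measure. (\<Prod>j\<in>UNIV. g j (x $ j))) = (\<Prod>j\<in>UNIV. integral {0..1} (g j))"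
proof -
  have gi: "g j absolutely_integrable_on {0..1}" for j
    by (intro absolutely_integrable_continuous_real continuous_on_subset[OF g]) simp
  have gm [measurable]: "g j \<in> borel_measurable borel" for j
    by (rule borel_measurable_continuous_onI[OF g])
  have gl: "integrable lborel (\<lambda>t. indicator {0..1} t * g j t)" for j
    using gi[of j] by (simp add: set_integrable_def integrable_completion)
  have gv: "(LINT t|lborel. indicator {0..1} t * g j t) = integral {0..1} (g j)" for j
    using set_lebesgue_integral_eq_integral(2)[OF gi[of j]]
    by (simp add: set_lebesgue_integral_def integral_completion)
  define f where "f = (\<lambda>b::real ^ 'd. \<lambda>t. indicator {0..1} t * g (axis_index b) t)"
  have fa: "f (axis j 1) t = indicator {0..1} t * g j t" for j t
    by (simp add: f_def axis_index_axis)
  have "(LINT x|torus_measure. (\<Prod>j\<in>UNIV. g j (x $ j)))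
      = (LINT x|lebesgue. indicator torus x *\<^sub>R (\<Prod>j\<in>UNIV. g j (x $ j)))"
    by (rule integral_restrict_space) simp
  also have "(\<lambda>x::real ^ 'd. indicator torus x *\<^sub>R (\<Prod>j\<in>UNIV. g j (x $ j)))
      = (\<lambda>x. \<Prod>b\<in>Basis. f b (x \<bullet> b))"
  proof
    fix x :: "real ^ 'd"
    have "indicator torus x = (\<Prod>j\<in>UNIV. indicator {0..1} (x $ j) :: real)"
    proof (cases "x \<in> torus")
      case True
      then have "indicator {0..1} (x $ j) = (1::real)" for j
        using mem_torus[of x] by (simp only: indicator_eq_1_iff)
      with True show ?thesis by simp
    next
      case False
      then obtain j where "x $ j \<notin> {0..1}" unfolding mem_torus by blast
      then have "\<exists>j\<in>UNIV. indicator {0..1} (x $ j) = (0::real)" by (metis UNIV_I indicator_eq_0_iff)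
      then have "(\<Prod>j\<in>UNIV. indicator {0..1} (x $ j) :: real) = 0" by (intro prod_zero) auto
      with False show ?thesis by simp
    qed
    then show "indicator torus x *\<^sub>R (\<Prod>j\<in>UNIV. g j (x $ j)) = (\<Prod>b\<in>Basis. f b (x \<bullet> b))"
      unfolding prod_Basis_vec fa cart_eq_inner_axis[symmetric]
      by (simp only: prod.distrib real_scaleR_def)
  qed
  also have "(LINT x|lebesgue. (\<Prod>b\<in>Basis. f b (x \<bullet> b))) = (LINT x|lborel. (\<Prod>b\<in>Basis. f b (x \<bullet> b)))"
  proof (rule integral_completion)
    have [measurable]: "f b \<in> borel_measurable borel" for b
      unfolding f_def by measurable
    show "(\<lambda>x. \<Prod>b\<in>Basis. f b (x \<bullet> b)) \<in> borel_measurable lborel" by measurable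
  qed
  also have "\<dots> = (\<Prod>b\<in>Basis. integral\<^sup>L lborel (f b))"
  proof (rule lborel_integral_prod)
    fix b :: "real ^ 'd" assume "b \<in> Basis"
    then obtain j where b: "b = axis j 1" by (auto simp: Basis_vec_def)
    show "integrable lborel (f b)" using gl[of j] unfolding b fa[abs_def] .
  qed
  also have "\<dots> = (\<Prod>j\<in>UNIV. integral {0..1} (g j))"
    unfolding prod_Basis_vec fa gv ..
  finally show ?thesis .
qed

definition trig :: "real \<Rightarrow> ('d::finite \<Rightarrow> int) \<Rightarrow> real ^ 'd \<Rightarrow> real" where
  "trig \<theta> k x = (\<Prod>j\<in>UNIV. hartley \<theta> (k j) (x $ j))"

lemma continuous_on_trig [continuous_intros]:
  fixes f :: "'a::t2_space \<Rightarrow> real ^ 'd"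
  shows "continuous_on S f \<Longrightarrow> continuous_on S (\<lambda>x. trig \<theta> k (f x))"
  unfolding trig_def by (intro continuous_intros)

lemma trig_square_le: "(trig \<theta> k (x :: real ^ 'd))\<^sup>2 \<le> 2 ^ CARD('d)"
proof -
  have "(trig \<theta> k x)\<^sup>2 = (\<Prod>j\<in>UNIV. (hartley \<theta> (k j) (x $ j))\<^sup>2)"
    unfolding trig_def by (rule prod_power_distrib)
  also have "\<dots> \<le> (\<Prod>j\<in>(UNIV :: 'd set). 2)"
    by (intro prod_mono) (auto simp: hartley_square_le)
  finally show ?thesis by simp
qed

lemma trig_periodic: "trig \<theta> k (x + axis i 1) = trig \<theta> k x"
  unfolding trig_def by (intro prod.cong refl) (auto simp: axis_def hartley_periodic)

lemma prob_space_torus: "prob_space (torus_measure :: (real ^ 'd) measure)"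
proof
  have "emeasure lborel (cbox 0 (1 :: real ^ 'd)) = 1"
    unfolding emeasure_lborel_cbox_eq prod_Basis_vec by (auto simp: Basis_vec_def inner_axis)
  then show "emeasure torus_measure (space (torus_measure :: (real ^ 'd) measure)) = 1"
    by (simp add: emeasure_restrict_space torus_def)
qed

lemma measure_torus [simp]: "measure torus_measure (torus :: (real ^ 'd) set) = 1"
  using prob_space.prob_space[OF prob_space_torus] by simp

lemma orthonormal_trig:
  fixes K :: "('d::finite \<Rightarrow> int) set"
  assumes "finite K"
  shows "orthonormal_system torus_measure K (trig \<theta>)"
proof -
  interpret prob_space "torus_measure :: (real ^ 'd) measure" by (rule prob_space_torus)
  show ?thesis
  proof
    show "finite K" by fact
    fix k l :: "'d \<Rightarrow> int"
    show "integrable torus_measure (\<lambda>x. trig \<theta> k x * trig \<theta> l x)"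
      by (intro integrable_torus_continuous continuous_intros)
    have "(LINT x|torus_measure. trig \<theta> k x * trig \<theta> l x)
      = (LINT x|torus_measure. (\<Prod>j\<in>UNIV. hartley \<theta> (k j) (x $ j) * hartley \<theta> (l j) (x $ j)))"
      by (simp add: trig_def prod.distrib)
    also have "\<dots> = (\<Prod>j\<in>UNIV. integral {0..1} (\<lambda>t. hartley \<theta> (k j) t * hartley \<theta> (l j) t))"
      by (rule torus_integral_prod) (intro continuous_intros)
    also have "\<dots> = (if k = l then 1 else 0)"
      unfolding integral_hartley_mult by (auto simp: fun_eq_iff)
    finally show "(LINT x|torus_measure. trig \<theta> k x * trig \<theta> l x) = (if k = l then 1 else 0)" .
  qed
qed

section \<open>The kernel of mixed smoothness\<close>

abbreviation axis_size :: "int \<Rightarrow> real" where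
  "axis_size t \<equiv> max 1 \<bar>real_of_int t\<bar>"

text \<open>Truncation is to a box and not to a hyperbolic cross: sums over a box factor into
  one-dimensional sums, in particular the truncated kernel is a product of partial sums of the
  series that defines \<open>bernoulli_kernel\<close>.\<close>

definition freq_box :: "nat \<Rightarrow> ('d::finite \<Rightarrow> int) set" where
  "freq_box N = {k. \<forall>j. \<bar>k j\<bar> \<le> int N}"

definition freq_size :: "('d::finite \<Rightarrow> int) \<Rightarrow> real" where
  "freq_size k = (\<Prod>j\<in>UNIV. axis_size (k j))"

text \<open>The whole phase is put on the variable \<open>x\<close>. Densities are therefore
  expanded in \<open>trig 0\<close> and the functions themselves in
  \<open>trig (r * pi / 2)\<close>; both systems are orthonormal.\<close>

definition trunc_kernel :: "real \<Rightarrow> nat \<Rightarrow> real ^ 'd \<Rightarrow> real ^ 'd \<Rightarrow> real" where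
  "trunc_kernel r N x y =
     (\<Sum>k\<in>freq_box N. freq_size k powr - r * trig (r * pi / 2) k x * trig 0 k y)"

lemma freq_box_PiE: "freq_box N = PiE UNIV (\<lambda>_. {- int N..int N})"
  by (auto simp: freq_box_def PiE_def Pi_def abs_le_iff minus_le_iff)

lemma finite_freq_box [simp]: "finite (freq_box N)"
  unfolding freq_box_PiE by (intro finite_PiE) auto

lemma freq_box_mono: "N \<le> M \<Longrightarrow> freq_box N \<subseteq> freq_box M"
  by (auto simp: freq_box_def intro: order_trans)

lemma freq_size_ge_1: "1 \<le> freq_size k"
  unfolding freq_size_def by (intro prod_ge_1) auto

lemma freq_size_powr: "freq_size k powr s = (\<Prod>j\<in>UNIV. axis_size (k j) powr s)"
  unfolding freq_size_def by (rule prod_powr_distrib)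

lemma freq_size_powr_square: "(freq_size k powr - r)\<^sup>2 = freq_size k powr (- 2 * r)"
  using freq_size_ge_1[of k] by (simp add: power2_eq_square flip: powr_add)

lemma sum_freq_box_prod:
  fixes f :: "'d::finite \<Rightarrow> int \<Rightarrow> real"
  shows "(\<Sum>k\<in>freq_box N. \<Prod>j\<in>UNIV. f j (k j)) = (\<Prod>j\<in>UNIV. \<Sum>t\<in>{- int N..int N}. f j t)"
  unfolding freq_box_PiE by (rule prod_sum_PiE[symmetric]) auto

lemma sum_symmetric_interval_Suc:
  fixes f :: "int \<Rightarrow> real"
  shows "(\<Sum>t\<in>{- int (Suc N)..int (Suc N)}. f t)
    = (\<Sum>t\<in>{- int N..int N}. f t) + (f (int (Suc N)) + f (- int (Suc N)))"
proof -
  have "{- int (Suc N)..int (Suc N)} = insert (int (Suc N)) (insert (- int (Suc N)) {- int N..int N})"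
    by auto
  then show ?thesis by (simp add: algebra_simps)
qed

lemma axis_size_Suc:
  "axis_size (int (Suc N)) = real (Suc N)" "axis_size (- int (Suc N)) = real (Suc N)"
  by auto

lemma hartley_pair:
  assumes "m > 0"
  shows "hartley \<theta> m x * hartley 0 m y + hartley \<theta> (- m) x * hartley 0 (- m) y
    = 2 * cos (2 * pi * real_of_int m * (x - y) - \<theta>)"
proof -
  define u v where "u = 2 * pi * real_of_int m * x - \<theta>" and "v = 2 * pi * real_of_int m * y"
  have n: "2 * pi * real_of_int (- m) * x - real_of_int (sgn (- m)) * \<theta> = - u"
    using assms by (simp add: u_def sgn_if)
  have p: "2 * pi * real_of_int m * x - real_of_int (sgn m) * \<theta> = u"
    using assms by (simp add: u_def)
  have n': "2 * pi * real_of_int (- m) * y - real_of_int (sgn (- m)) * 0 = - v"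
    and p': "2 * pi * real_of_int m * y - real_of_int (sgn m) * 0 = v"
    by (simp_all add: v_def)
  have "2 * pi * real_of_int m * (x - y) - \<theta> = u - v" by (simp add: u_def v_def algebra_simps)
  then have "2 * cos (2 * pi * real_of_int m * (x - y) - \<theta>) = 2 * (cos u * cos v + sin u * sin v)"
    by (simp only: cos_diff)
  then show ?thesis unfolding hartley_def n p n' p' by (simp add: algebra_simps)
qed

lemma partial_kernel:
  "1 + 2 * (\<Sum>k<N. real (Suc k) powr - r * cos (2 * pi * real (Suc k) * (x - y) - r * pi / 2))
    = (\<Sum>t\<in>{- int N..int N}. axis_size t powr - r * (hartley (r * pi / 2) t x * hartley 0 t y))"
proof (induction N)
  case 0
  then show ?case by (simp add: hartley_def)
next
  case (Suc N)
  show ?case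
    unfolding sum_symmetric_interval_Suc Suc.IH[symmetric] axis_size_Suc
    using hartley_pair[of "int (Suc N)" "r * pi / 2" x y]
    by (simp only: sum.lessThan_Suc distrib_left[symmetric] of_int_of_nat_eq) (simp add: algebra_simps)
qed

lemma trunc_kernel_eq_prod:
  "trunc_kernel r N x y = (\<Prod>j\<in>UNIV. 1 + 2 * (\<Sum>k<N. real (Suc k) powr - r *
      cos (2 * pi * real (Suc k) * (x $ j - y $ j) - r * pi / 2)))"
  unfolding partial_kernel sum_freq_box_prod[symmetric] trunc_kernel_def freq_size_powr trig_def
    prod.distrib by (simp add: mult.assoc)

text \<open>The coefficients need not be summable, so this is Dirichlet's test. For the terms
  \<open>a k * z ^ k\<close> with \<open>z\<close> on the unit circle, multiplying by
  \<open>1 - z\<close> leaves a telescoping series minus one that is dominated by the increments of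
  \<open>a\<close>. The factor can be divided out because \<open>z = 1\<close> only for integer
  \<open>t\<close>.\<close>

lemma summable_decreasing_cos:
  fixes a :: "nat \<Rightarrow> real"
  assumes a: "decseq a" "a \<longlonglongrightarrow> 0" and t: "t \<notin> \<int>"
  shows "summable (\<lambda>k. a k * cos (2 * pi * real (Suc k) * t - c))"
proof -
  define z where "z = cis (2 * pi * t)"
  have z1: "z \<noteq> 1"
  proof
    assume "z = 1"
    then have "cos (2 * pi * t) = 1" by (simp add: z_def complex_eq_iff)
    then obtain n :: int where "2 * pi * t = real_of_int n * 2 * pi"
      unfolding cos_one_2pi_int by blast
    then show False using t by simp
  qed
  have nz: "norm (z ^ k) = 1" for k by (simp add: z_def norm_power)
  have zero: "(\<lambda>k. of_real (a k) * z ^ k) \<longlonglongrightarrow> 0"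
    using a(2) by (subst tendsto_norm_zero_iff[symmetric]) (simp add: norm_mult nz tendsto_rabs_zero)
  have s1: "summable (\<lambda>k. of_real (a k) * z ^ k - of_real (a (Suc k)) * z ^ Suc k)"
    by (rule telescope_summable'[OF zero])
  have "summable (\<lambda>k. a k - a (Suc k))" by (rule telescope_summable'[OF a(2)])
  then have s2: "summable (\<lambda>k. of_real (a k - a (Suc k)) * z ^ Suc k)"
    by (rule summable_comparison_test'[where N = 0])
      (use decseq_SucD[OF a(1)] in \<open>simp add: norm_mult nz del: power_Suc of_real_diff\<close>)
  have "summable (\<lambda>k. (of_real (a k) * z ^ k - of_real (a (Suc k)) * z ^ Suc k)
      - of_real (a k - a (Suc k)) * z ^ Suc k)"
    by (rule summable_diff[OF s1 s2])
  also have "(\<lambda>k. (of_real (a k) * z ^ k - of_real (a (Suc k)) * z ^ Suc k)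
      - of_real (a k - a (Suc k)) * z ^ Suc k) = (\<lambda>k. (1 - z) * (of_real (a k) * z ^ k))"
    by (simp add: fun_eq_iff algebra_simps)
  finally have "summable (\<lambda>k. of_real (a k) * z ^ k)"
    using z1 by (subst (asm) summable_cmult_iff) auto
  then have "summable (\<lambda>k. cis (2 * pi * t - c) * (of_real (a k) * z ^ k))"
    by (rule summable_mult)
  then have "summable (\<lambda>k. Re (cis (2 * pi * t - c) * (of_real (a k) * z ^ k)))"
    by (rule summable_Re)
  moreover have "cis (2 * pi * t - c) * (of_real (a k) * z ^ k)
      = of_real (a k) * cis (2 * pi * real (Suc k) * t - c)" for k
    unfolding z_def Complex.DeMoivre by (simp add: cis_mult algebra_simps)
  ultimately show ?thesis by simp
qed

lemma trunc_kernel_tendsto: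
  assumes r: "r > 0" and xy: "\<And>j. x $ j - y $ j \<notin> \<int>"
  shows "(\<lambda>N. trunc_kernel r N x y) \<longlonglongrightarrow> mixed_kernel r (x - y)"
proof -
  have dec: "decseq (\<lambda>k. real (Suc k) powr - r)"
    using r by (intro decseq_SucI powr_mono2') auto
  have lim: "(\<lambda>k. real (Suc k) powr - r) \<longlonglongrightarrow> 0"
    using r by (intro tendsto_neg_powr filterlim_compose[OF filterlim_real_sequentially filterlim_Suc]) auto
  show ?thesis
    unfolding trunc_kernel_eq_prod mixed_kernel_def bernoulli_kernel_def vector_minus_component
    by (intro tendsto_prod tendsto_add tendsto_mult tendsto_const summable_LIMSEQ
        summable_decreasing_cos dec lim xy)
qed

text \<open>The points at which the kernel series might diverge lie on countably many hyperplanes,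
  hence are invisible to every integral over \<open>y\<close>.\<close>

lemma AE_not_int:
  fixes x :: "real ^ 'd"
  shows "AE y in torus_measure. \<forall>j. x $ j - y $ j \<notin> \<int>"
proof -
  have "negligible (\<Union>j\<in>UNIV. \<Union>n\<in>\<int>. {y :: real ^ 'd. y $ j = x $ j - n})"
  proof -
    have "negligible {y :: real ^ 'd. y $ j = c}" for j c
    proof -
      have "{y :: real ^ 'd. y $ j = c} = {y. axis j 1 \<bullet> y = c}" by (simp add: inner_axis')
      then show ?thesis
        using negligible_hyperplane[of "axis j 1 :: real ^ 'd" c] by (simp add: axis_eq_0_iff)
    qed
    then show ?thesis by (auto intro!: negligible_countable_Union countable_image countable_int)
  qed
  then have "AE y in lebesgue. y \<notin> (\<Union>j\<in>UNIV. \<Union>n\<in>\<int>. {y :: real ^ 'd. y $ j = x $ j - n})"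
    unfolding negligible_iff_null_sets by (rule AE_not_in)
  then have "AE y in lebesgue. y \<in> torus \<longrightarrow> (\<forall>j. x $ j - y $ j \<notin> \<int>)"
  proof eventually_elim
    case (elim y)
    show ?case
    proof (intro impI allI notI)
      fix j assume n: "x $ j - y $ j \<in> \<int>"
      have "y \<in> {y. y $ j = x $ j - (x $ j - y $ j)}" by simp
      with n elim show False by blast
    qed
  qed
  then show ?thesis by (subst AE_restrict_space_iff) auto
qed

section \<open>L2 tails of the kernel and uniform approximation of convolutions\<close>

definition axis_sum :: "real \<Rightarrow> nat \<Rightarrow> real" where
  "axis_sum s N = (\<Sum>t\<in>{- int N..int N}. axis_size t powr s)"

lemma axis_sum_eq: "axis_sum s N = 1 + 2 * (\<Sum>k<N. real (Suc k) powr s)"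
proof (induction N)
  case (Suc N)
  show ?case
    using Suc unfolding axis_sum_def sum_symmetric_interval_Suc axis_size_Suc
    by (simp only: sum.lessThan_Suc) (simp add: algebra_simps)
qed (simp add: axis_sum_def)

lemma sum_freq_size: "(\<Sum>k\<in>freq_box N. freq_size (k :: 'd::finite \<Rightarrow> int) powr s) = axis_sum s N ^ CARD('d)"
  using sum_freq_box_prod[of "\<lambda>_ t. axis_size t powr s" N]
  unfolding freq_size_powr axis_sum_def by simp

lemma axis_sum_convergent:
  assumes "s < - 1"
  obtains Z where "axis_sum s \<longlonglongrightarrow> Z" "\<And>N. axis_sum s N \<le> Z"
proof -
  have sm: "summable (\<lambda>k. real (Suc k) powr s)"
    using assms summable_real_powr_iff[of s] summable_Suc_iff[of "\<lambda>k. real k powr s"] by simp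
  have "axis_sum s \<longlonglongrightarrow> 1 + 2 * (\<Sum>k. real (Suc k) powr s)"
    unfolding axis_sum_eq[abs_def] by (intro tendsto_intros summable_LIMSEQ sm)
  moreover have "axis_sum s N \<le> 1 + 2 * (\<Sum>k. real (Suc k) powr s)" for N
    unfolding axis_sum_eq using sm by (auto intro!: sum_le_suminf)
  ultimately show ?thesis by (rule that)
qed

lemma
  fixes f g :: "'a \<Rightarrow> real"
  assumes m: "f \<in> borel_measurable M" "g \<in> borel_measurable M"
    and f: "integrable M (\<lambda>x. (f x)\<^sup>2)" and g: "integrable M (\<lambda>x. (g x)\<^sup>2)"
  shows integrable_mult_L2: "integrable M (\<lambda>x. f x * g x)"
    and integral_Cauchy_Schwarz:
      "(LINT x|M. f x * g x)\<^sup>2 \<le> (LINT x|M. (f x)\<^sup>2) * (LINT x|M. (g x)\<^sup>2)"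
proof -
  have "norm (f x * g x) \<le> norm ((f x)\<^sup>2 + (g x)\<^sup>2)" for x
  proof -
    have "2 * (\<bar>f x\<bar> * \<bar>g x\<bar>) \<le> (f x)\<^sup>2 + (g x)\<^sup>2"
      using zero_le_power2[of "\<bar>f x\<bar> - \<bar>g x\<bar>"] by (simp add: power2_diff)
    moreover have "0 \<le> \<bar>f x\<bar> * \<bar>g x\<bar>" by simp
    ultimately show ?thesis unfolding real_norm_def abs_mult by linarith
  qed
  then show i: "integrable M (\<lambda>x. f x * g x)"
    using m f g by (intro Bochner_Integration.integrable_bound[OF Bochner_Integration.integrable_add[OF f g]]) auto
  define A B C where "A = (LINT x|M. (f x)\<^sup>2)" and "B = (LINT x|M. (g x)\<^sup>2)" and "C = (LINT x|M. f x * g x)"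
  have q: "0 \<le> t\<^sup>2 * A - 2 * t * C + B" for t
  proof -
    have "0 \<le> (LINT x|M. (t * f x - g x)\<^sup>2)" by simp
    also have "\<dots> = (LINT x|M. t\<^sup>2 * (f x)\<^sup>2 - 2 * t * (f x * g x) + (g x)\<^sup>2)"
      by (intro Bochner_Integration.integral_cong) (auto simp: power2_eq_square algebra_simps)
    also have "\<dots> = t\<^sup>2 * A - 2 * t * C + B"
      using f g i by (simp add: A_def B_def C_def)
    finally show ?thesis .
  qed
  have "C\<^sup>2 \<le> A * B"
  proof (cases "A = 0")
    case True
    have "C = 0"
    proof (rule ccontr)
      assume "C \<noteq> 0"
      then show False using q[of "(B + 1) / (2 * C)"] True by simp
    qed
    then show ?thesis using True by simp
  next
    case False
    moreover have "0 \<le> A" by (simp add: A_def)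
    ultimately have A: "A > 0" by simp
    have "0 \<le> A * ((C / A)\<^sup>2 * A - 2 * (C / A) * C + B)"
      by (rule mult_nonneg_nonneg[OF less_imp_le[OF A] q])
    also have "\<dots> = A * B - C\<^sup>2" using A by (simp add: power2_eq_square field_simps)
    finally show ?thesis by simp
  qed
  then show "(LINT x|M. f x * g x)\<^sup>2 \<le> (LINT x|M. (f x)\<^sup>2) * (LINT x|M. (g x)\<^sup>2)"
    by (simp add: A_def B_def C_def)
qed

lemma borel_measurable_mixed_kernel [measurable]:
  "(mixed_kernel r :: real ^ 'd \<Rightarrow> real) \<in> borel_measurable borel"
proof -
  have [measurable]: "bernoulli_kernel r \<in> borel_measurable borel"
    unfolding bernoulli_kernel_def[abs_def] by measurable
  have [measurable]: "(\<lambda>x :: real ^ 'd. x $ j) \<in> borel_measurable borel" for j :: 'd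
    by (intro borel_measurable_continuous_onI continuous_intros)
  show "(mixed_kernel r :: real ^ 'd \<Rightarrow> real) \<in> borel_measurable borel"
    unfolding mixed_kernel_def[abs_def] by measurable
qed

lemma continuous_on_trunc_kernel [continuous_intros]:
  fixes f g :: "'a::t2_space \<Rightarrow> real ^ 'd"
  shows "continuous_on S f \<Longrightarrow> continuous_on S g \<Longrightarrow> continuous_on S (\<lambda>x. trunc_kernel r N (f x) (g x))"
  unfolding trunc_kernel_def by (intro continuous_intros)

abbreviation kernel_tail :: "real \<Rightarrow> nat \<Rightarrow> real ^ 'd \<Rightarrow> real ^ 'd \<Rightarrow> real" where
  "kernel_tail r N x y \<equiv> mixed_kernel r (x - y) - trunc_kernel r N x y"

text \<open>Parseval in \<open>y\<close> with \<open>x\<close> fixed. Uniformity in \<open>x\<close>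
  comes from the bound on \<open>trig\<close>, and the remaining sum over the difference of two
  boxes is a difference of powers of one-dimensional sums.\<close>

lemma integral_trunc_kernel_diff_le:
  fixes x :: "real ^ 'd"
  assumes "N \<le> M"
  shows "(LINT y|torus_measure. (trunc_kernel r M x y - trunc_kernel r N x y)\<^sup>2)
    \<le> 2 ^ CARD('d) * (axis_sum (- 2 * r) M ^ CARD('d) - axis_sum (- 2 * r) N ^ CARD('d))"
proof -
  define K where "K = freq_box M - (freq_box N :: ('d \<Rightarrow> int) set)"
  interpret orthonormal_system "torus_measure :: (real ^ 'd) measure" K "trig 0"
    by (rule orthonormal_trig) (simp add: K_def)
  have sub: "freq_box N \<subseteq> (freq_box M :: ('d \<Rightarrow> int) set)" by (rule freq_box_mono[OF assms])
  have "trunc_kernel r M x y - trunc_kernel r N x y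
      = (\<Sum>k\<in>K. freq_size k powr - r * trig (r * pi / 2) k x * trig 0 k y)" for y
    unfolding trunc_kernel_def K_def by (rule sum_diff[OF finite_freq_box sub, symmetric])
  then have "(LINT y|torus_measure. (trunc_kernel r M x y - trunc_kernel r N x y)\<^sup>2)
      = (\<Sum>k\<in>K. (freq_size k powr - r * trig (r * pi / 2) k x)\<^sup>2)"
    by (simp add: integral_square_sum)
  also have "\<dots> \<le> (\<Sum>k\<in>K. 2 ^ CARD('d) * freq_size k powr (- 2 * r))"
  proof (rule sum_mono)
    fix k :: "'d \<Rightarrow> int"
    show "(freq_size k powr - r * trig (r * pi / 2) k x)\<^sup>2 \<le> 2 ^ CARD('d) * freq_size k powr (- 2 * r)"
      unfolding power_mult_distrib freq_size_powr_square
      using mult_right_mono[OF trig_square_le[of "r * pi / 2" k x], of "freq_size k powr (- 2 * r)"]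
      by (simp only: mult.commute[of _ "(trig _ _ _)\<^sup>2"]) simp
  qed
  also have "\<dots> = 2 ^ CARD('d) * ((\<Sum>k\<in>freq_box M. freq_size (k :: 'd \<Rightarrow> int) powr (- 2 * r))
      - (\<Sum>k\<in>freq_box N. freq_size (k :: 'd \<Rightarrow> int) powr (- 2 * r)))"
    unfolding K_def sum_distrib_left[symmetric] sum_diff[OF finite_freq_box sub] ..
  finally show ?thesis unfolding sum_freq_size .
qed

text \<open>The kernel is given by a pointwise series and not as an L2 limit. Fatou's lemma
  transfers the bound for differences of truncations to the almost everywhere limit; for 2 r > 1 the
  one-dimensional sums converge, so the bound tends to zero, independently of
  \<open>x\<close>.\<close>

lemma mixed_kernel_tail:
  assumes r: "r > 1 / 2"
  obtains \<eta> :: "nat \<Rightarrow> real" where "\<eta> \<longlonglongrightarrow> 0" "\<And>N. 0 \<le> \<eta> N"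
    "\<And>N (x :: real ^ 'd). integrable torus_measure (\<lambda>y. (kernel_tail r N x y)\<^sup>2)"
    "\<And>N (x :: real ^ 'd). (LINT y|torus_measure. (kernel_tail r N x y)\<^sup>2) \<le> \<eta> N"
proof -
  obtain Z where Z: "axis_sum (- 2 * r) \<longlonglongrightarrow> Z" "\<And>N. axis_sum (- 2 * r) N \<le> Z"
    using axis_sum_convergent[of "- 2 * r"] r by auto
  have nn: "0 \<le> axis_sum (- 2 * r) N" for N unfolding axis_sum_def by (intro sum_nonneg) auto
  define \<eta> where "\<eta> = (\<lambda>N. 2 ^ CARD('d) * (Z ^ CARD('d) - axis_sum (- 2 * r) N ^ CARD('d)))"
  have "\<eta> \<longlonglongrightarrow> 2 ^ CARD('d) * (Z ^ CARD('d) - Z ^ CARD('d))"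
    unfolding \<eta>_def by (intro tendsto_intros Z)
  then have lim: "\<eta> \<longlonglongrightarrow> 0" by simp
  have \<eta>0: "0 \<le> \<eta> N" for N unfolding \<eta>_def using Z(2) nn by (simp add: power_mono)
  have bound: "integrable torus_measure (\<lambda>y. (kernel_tail r N x y)\<^sup>2) \<and>
      (LINT y|torus_measure. (kernel_tail r N x y)\<^sup>2) \<le> \<eta> N" for N and x :: "real ^ 'd"
  proof -
    define G where "G = (\<lambda>M y. (trunc_kernel r M x y - trunc_kernel r N x y)\<^sup>2)"
    define F where "F = (\<lambda>y. (kernel_tail r N x y)\<^sup>2)"
    have Gc: "continuous_on UNIV (G M)" for M unfolding G_def by (intro continuous_intros)
    have Gi: "integrable torus_measure (G M)" for M by (rule integrable_torus_continuous[OF Gc])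
    have [measurable]: "(\<lambda>y. trunc_kernel r N x y) \<in> borel_measurable borel"
      by (intro borel_measurable_continuous_onI continuous_intros)
    have "F \<in> borel_measurable borel" unfolding F_def by measurable
    then have Fm: "F \<in> borel_measurable torus_measure" by (rule measurable_lebesgue_on_borel)
    have Gm: "(\<lambda>y. ennreal (G M y)) \<in> borel_measurable torus_measure" for M
      using borel_measurable_integrable[OF Gi[of M]] by simp
    have "AE y in torus_measure. ennreal (F y) = liminf (\<lambda>M. ennreal (G M y))"
      using AE_not_int[of x]
    proof eventually_elim
      case (elim y)
      have "(\<lambda>M. trunc_kernel r M x y) \<longlonglongrightarrow> mixed_kernel r (x - y)"
        using r elim by (intro trunc_kernel_tendsto) auto
      then have "(\<lambda>M. ennreal (G M y)) \<longlonglongrightarrow> ennreal (F y)"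
        unfolding G_def F_def by (intro tendsto_ennrealI tendsto_intros)
      then show ?case by (rule lim_imp_Liminf[symmetric, rotated]) simp
    qed
    then have "(\<integral>\<^sup>+y. F y \<partial>torus_measure) = (\<integral>\<^sup>+y. liminf (\<lambda>M. ennreal (G M y)) \<partial>torus_measure)"
      by (rule nn_integral_cong_AE)
    also have "\<dots> \<le> liminf (\<lambda>M. \<integral>\<^sup>+y. G M y \<partial>torus_measure)"
      by (rule nn_integral_liminf) (rule Gm)
    also have "\<dots> \<le> ennreal (\<eta> N)"
    proof -
      have "(\<integral>\<^sup>+y. G M y \<partial>torus_measure) \<le> ennreal (\<eta> N)" if "M \<ge> N" for M
      proof -
        have "(\<integral>\<^sup>+y. G M y \<partial>torus_measure) = ennreal (LINT y|torus_measure. G M y)"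
          using Gi by (intro nn_integral_eq_integral) (auto simp: G_def)
        also have "(LINT y|torus_measure. G M y)
            \<le> 2 ^ CARD('d) * (axis_sum (- 2 * r) M ^ CARD('d) - axis_sum (- 2 * r) N ^ CARD('d))"
          unfolding G_def by (rule integral_trunc_kernel_diff_le[OF that])
        also have "\<dots> \<le> \<eta> N" unfolding \<eta>_def using Z(2)[of M] nn[of M] by (simp add: power_mono)
        finally show ?thesis by (simp add: ennreal_leI)
      qed
      then have "eventually (\<lambda>M. (\<integral>\<^sup>+y. G M y \<partial>torus_measure) \<le> ennreal (\<eta> N)) sequentially"
        unfolding eventually_sequentially by blast
      then have "limsup (\<lambda>M. \<integral>\<^sup>+y. G M y \<partial>torus_measure) \<le> ennreal (\<eta> N)"
        by (rule Limsup_bounded)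
      then show ?thesis by (rule order_trans[OF Liminf_le_Limsup, rotated]) simp
    qed
    finally have nn: "(\<integral>\<^sup>+y. F y \<partial>torus_measure) \<le> ennreal (\<eta> N)" .
    then have Fi: "integrable torus_measure F"
      by (intro integrableI_nonneg Fm) (auto simp: F_def intro: le_less_trans)
    moreover have "integral\<^sup>L torus_measure F \<le> \<eta> N"
    proof -
      have "ennreal (integral\<^sup>L torus_measure F) = (\<integral>\<^sup>+y. F y \<partial>torus_measure)"
        by (rule nn_integral_eq_integral[OF Fi, symmetric]) (simp add: F_def)
      then have "ennreal (integral\<^sup>L torus_measure F) \<le> ennreal (\<eta> N)" using nn by simp
      then show ?thesis by (simp only: ennreal_le_iff[OF \<eta>0])
    qed
    ultimately show ?thesis unfolding F_def by blast
  qed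
  show ?thesis using that[OF lim \<eta>0] bound by blast
qed

text \<open>An open set that meets the closed cube also meets its interior, so it cannot be null
  there. This passes from densities, which determine f almost everywhere only, to actual point
  values.\<close>

lemma AE_torus_le_imp_le:
  fixes h :: "real ^ 'd \<Rightarrow> real"
  assumes h: "continuous_on UNIV h" and ae: "AE x in torus_measure. h x \<le> c" and x: "x \<in> torus"
  shows "h x \<le> c"
proof (rule ccontr)
  assume "\<not> h x \<le> c"
  define S where "S = {x. c < h x}"
  have S: "open S" unfolding S_def using h by (intro open_Collect_less continuous_intros)
  have xS: "x \<in> S" using \<open>\<not> h x \<le> c\<close> by (simp add: S_def)
  have ne: "box 0 (1 :: real ^ 'd) \<noteq> {}"
    by (auto simp: box_ne_empty Basis_vec_def inner_axis)
  then have "x \<in> closure (box 0 1)" using x by (simp add: torus_def)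
  then have "S \<inter> box 0 1 \<noteq> {}" using xS open_Int_closure_eq_empty[OF S, of "box 0 1"] by blast
  then have "\<not> negligible (S \<inter> box 0 1)" using S by (intro open_not_negligible open_Int open_box) auto
  moreover have "negligible (S \<inter> box 0 1)"
  proof -
    have "AE x in lebesgue. x \<in> torus \<longrightarrow> h x \<le> c"
      using ae by (subst (asm) AE_restrict_space_iff) auto
    then have "AE x in lebesgue. x \<notin> S \<inter> box 0 1"
      by eventually_elim (use box_subset_cbox[of 0 1] in \<open>auto simp: S_def torus_def\<close>)
    moreover have "S \<inter> box 0 1 \<in> sets lebesgue" using S by simp
    ultimately have "S \<inter> box 0 1 \<in> null_sets lebesgue" by (subst AE_iff_null_sets) auto
    then show ?thesis by (simp add: negligible_iff_null_sets)
  qed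
  ultimately show False by contradiction
qed

abbreviation mixed_conv :: "real \<Rightarrow> (real ^ 'd \<Rightarrow> real) \<Rightarrow> real ^ 'd \<Rightarrow> real" where
  "mixed_conv r \<psi> x \<equiv> (LINT y|torus_measure. mixed_kernel r (x - y) * \<psi> y)"

abbreviation partial_conv :: "real \<Rightarrow> nat \<Rightarrow> (real ^ 'd \<Rightarrow> real) \<Rightarrow> real ^ 'd \<Rightarrow> real" where
  "partial_conv r N \<psi> x \<equiv> (\<Sum>k\<in>freq_box N.
     freq_size k powr - r * trig (r * pi / 2) k x * (LINT y|torus_measure. trig 0 k y * \<psi> y))"

text \<open>Cauchy-Schwarz against the kernel tail gives an error bound in the supremum norm from
  the L2 norm of \<psi> alone. As \<eta> depends neither on \<psi> nor on \<open>x\<close>, one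
  truncation serves the whole ball.\<close>

lemma mixed_convolution:
  assumes r: "r > 1 / 2"
  obtains \<eta> :: "nat \<Rightarrow> real" where "\<eta> \<longlonglongrightarrow> 0" "\<And>N. 0 \<le> \<eta> N"
    "\<And>\<psi> (x :: real ^ 'd). \<psi> \<in> borel_measurable torus_measure \<Longrightarrow> integrable torus_measure (\<lambda>y. (\<psi> y)\<^sup>2) \<Longrightarrow>
       integrable torus_measure (\<lambda>y. mixed_kernel r (x - y) * \<psi> y)"
    "\<And>\<psi> N (x :: real ^ 'd). \<psi> \<in> borel_measurable torus_measure \<Longrightarrow> integrable torus_measure (\<lambda>y. (\<psi> y)\<^sup>2) \<Longrightarrow>
       (mixed_conv r \<psi> x -
        partial_conv r N \<psi> x)\<^sup>2
       \<le> \<eta> N * (LINT y|torus_measure. (\<psi> y)\<^sup>2)"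
proof -
  obtain \<eta> where \<eta>: "\<eta> \<longlonglongrightarrow> 0" "\<And>N. 0 \<le> \<eta> N"
    and i: "\<And>N (x :: real ^ 'd). integrable torus_measure (\<lambda>y. (kernel_tail r N x y)\<^sup>2)"
    and le: "\<And>N (x :: real ^ 'd). (LINT y|torus_measure. (kernel_tail r N x y)\<^sup>2) \<le> \<eta> N"
    by (rule mixed_kernel_tail[where 'd = 'd, OF r]) blast
  have *: "integrable torus_measure (\<lambda>y. mixed_kernel r (x - y) * \<psi> y) \<and>
      (mixed_conv r \<psi> x -
        partial_conv r N \<psi> x)\<^sup>2
       \<le> \<eta> N * (LINT y|torus_measure. (\<psi> y)\<^sup>2)"
    if \<psi>: "\<psi> \<in> borel_measurable torus_measure" "integrable torus_measure (\<lambda>y. (\<psi> y)\<^sup>2)"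
    for \<psi> N and x :: "real ^ 'd"
  proof -
    define D where "D = (\<lambda>y. kernel_tail r N x y)"
    have [measurable]: "(\<lambda>y. trunc_kernel r N x y) \<in> borel_measurable borel"
      by (intro borel_measurable_continuous_onI continuous_intros)
    have "D \<in> borel_measurable borel" unfolding D_def by measurable
    then have Dm: "D \<in> borel_measurable torus_measure" by (rule measurable_lebesgue_on_borel)
    have Di: "integrable torus_measure (\<lambda>y. (D y)\<^sup>2)" unfolding D_def by (rule i)
    have Dp: "integrable torus_measure (\<lambda>y. D y * \<psi> y)"
      by (rule integrable_mult_L2[OF Dm \<psi>(1) Di \<psi>(2)])
    have tp: "integrable torus_measure (\<lambda>y. trig 0 k y * \<psi> y)" for k :: "'d \<Rightarrow> int"
    proof (rule integrable_mult_L2[OF _ \<psi>(1) _ \<psi>(2)])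
      have "(trig 0 k :: real ^ 'd \<Rightarrow> real) \<in> borel_measurable borel"
        by (intro borel_measurable_continuous_onI continuous_intros)
      then show "trig 0 k \<in> borel_measurable torus_measure" by (rule measurable_lebesgue_on_borel)
      show "integrable torus_measure (\<lambda>y. (trig 0 k y)\<^sup>2)"
        by (intro integrable_torus_continuous continuous_intros)
    qed
    have eq: "trunc_kernel r N x y * \<psi> y
        = (\<Sum>k\<in>freq_box N. freq_size k powr - r * trig (r * pi / 2) k x * (trig 0 k y * \<psi> y))" for y
      unfolding trunc_kernel_def sum_distrib_right by (simp add: mult.assoc)
    have Tp: "integrable torus_measure (\<lambda>y. trunc_kernel r N x y * \<psi> y)"
      unfolding eq by (intro Bochner_Integration.integrable_sum integrable_mult_right tp)
    have Tv: "(LINT y|torus_measure. trunc_kernel r N x y * \<psi> y)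
        = partial_conv r N \<psi> x"
      unfolding eq
      by (subst Bochner_Integration.integral_sum) (intro integrable_mult_right tp, simp)
    have split: "mixed_kernel r (x - y) * \<psi> y = D y * \<psi> y + trunc_kernel r N x y * \<psi> y" for y
      by (simp add: D_def algebra_simps)
    have "integrable torus_measure (\<lambda>y. mixed_kernel r (x - y) * \<psi> y)"
      unfolding split by (intro Bochner_Integration.integrable_add Dp Tp)
    moreover have "mixed_conv r \<psi> x -
        partial_conv r N \<psi> x
        = (LINT y|torus_measure. D y * \<psi> y)"
      unfolding split Tv[symmetric] by (subst Bochner_Integration.integral_add[OF Dp Tp]) simp
    moreover have "(LINT y|torus_measure. D y * \<psi> y)\<^sup>2 \<le> \<eta> N * (LINT y|torus_measure. (\<psi> y)\<^sup>2)"
    proof (rule order_trans[OF integral_Cauchy_Schwarz[OF Dm \<psi>(1) Di \<psi>(2)] mult_right_mono])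
      show "(LINT y|torus_measure. (D y)\<^sup>2) \<le> \<eta> N" unfolding D_def by (rule le)
      show "0 \<le> (LINT y|torus_measure. (\<psi> y)\<^sup>2)" by simp
    qed
    ultimately show ?thesis by simp
  qed
  show ?thesis
  proof (rule that[OF \<eta>])
    fix \<psi> :: "real ^ 'd \<Rightarrow> real" and N and x :: "real ^ 'd"
    assume \<psi>: "\<psi> \<in> borel_measurable torus_measure" "integrable torus_measure (\<lambda>y. (\<psi> y)\<^sup>2)"
    show "integrable torus_measure (\<lambda>y. mixed_kernel r (x - y) * \<psi> y)"
      by (rule *[OF \<psi>, THEN conjunct1])
    show "(mixed_conv r \<psi> x -
        partial_conv r N \<psi> x)\<^sup>2
       \<le> \<eta> N * (LINT y|torus_measure. (\<psi> y)\<^sup>2)"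
      by (rule *[OF \<psi>, THEN conjunct2])
  qed
qed

section \<open>Counting frequencies in hyperbolic crosses\<close>

text \<open>Used to single out coordinate \<open>i\<close>: every frequency is uniquely
  \<open>k(i := t)\<close> with \<open>k\<close> in a slice, the value 0 at \<open>i\<close> being a
  placeholder.\<close>

definition slice :: "'d::finite \<Rightarrow> int set \<Rightarrow> ('d \<Rightarrow> int) set" where
  "slice i B = PiE UNIV (\<lambda>j. if j = i then {0} else B)"

definition cofactor :: "'d::finite \<Rightarrow> ('d \<Rightarrow> int) \<Rightarrow> real" where
  "cofactor i k = (\<Prod>j\<in>UNIV - {i}. axis_size (k j))"

lemma mem_slice: "k \<in> slice i B \<longleftrightarrow> k i = 0 \<and> (\<forall>j. j \<noteq> i \<longrightarrow> k j \<in> B)"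
  by (auto simp: slice_def PiE_def Pi_def)

lemma finite_slice [simp]: "finite B \<Longrightarrow> finite (slice i B)"
  unfolding slice_def by (intro finite_PiE) auto

lemma cofactor_ge_1: "1 \<le> cofactor i k"
  unfolding cofactor_def by (intro prod_ge_1) auto

lemma freq_size_upd: "freq_size (k(i := t)) = axis_size t * cofactor i k"
proof -
  have "freq_size (k(i := t)) = max 1 \<bar>real_of_int ((k(i := t)) i)\<bar> *
      (\<Prod>j\<in>UNIV - {i}. max 1 \<bar>real_of_int ((k(i := t)) j)\<bar>)"
    unfolding freq_size_def by (rule prod.remove) auto
  also have "(\<Prod>j\<in>UNIV - {i}. max 1 \<bar>real_of_int ((k(i := t)) j)\<bar>) = cofactor i k"
    unfolding cofactor_def by (intro prod.cong) auto
  finally show ?thesis unfolding fun_upd_same .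
qed

lemma sum_freq_box_split:
  fixes f :: "('d::finite \<Rightarrow> int) \<Rightarrow> real"
  shows "(\<Sum>k\<in>freq_box N. f k) =
    (\<Sum>k\<in>slice i {- int N..int N}. \<Sum>t\<in>{- int N..int N}. f (k(i := t)))"
proof -
  have "(\<Sum>k\<in>slice i {- int N..int N}. \<Sum>t\<in>{- int N..int N}. f (k(i := t)))
      = (\<Sum>(k, t)\<in>Sigma (slice i {- int N..int N}) (\<lambda>_. {- int N..int N}). f (k(i := t)))"
    by (rule sum.Sigma) auto
  also have "\<dots> = (\<Sum>k\<in>freq_box N. f k)"
    by (rule sum.reindex_bij_witness[where i = "\<lambda>k. (k(i := 0), k i)" and j = "\<lambda>(k, t). k(i := t)"])
      (auto simp: mem_slice freq_box_def abs_le_iff minus_le_iff fun_upd_idem)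
  finally show ?thesis ..
qed

lemma sum_slice_prod:
  fixes g :: "int \<Rightarrow> real"
  assumes "finite B"
  shows "(\<Sum>k\<in>slice (i :: 'd::finite) B. \<Prod>j\<in>UNIV - {i}. g (k j)) = (\<Sum>t\<in>B. g t) ^ (CARD('d) - 1)"
proof -
  have "(\<Prod>j\<in>UNIV - {i}. g (k j)) = (\<Prod>j\<in>UNIV. if j = i then 1 else g (k j))" for k
  proof -
    have "(\<Prod>j\<in>UNIV. if j = i then 1 else g (k j)) = (\<Prod>j\<in>UNIV - {i}. if j = i then 1 else g (k j))"
      by (subst prod.remove[of UNIV i]) auto
    also have "\<dots> = (\<Prod>j\<in>UNIV - {i}. g (k j))" by (intro prod.cong) auto
    finally show ?thesis ..
  qed
  then have "(\<Sum>k\<in>slice i B. \<Prod>j\<in>UNIV - {i}. g (k j))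
      = (\<Prod>j\<in>UNIV. \<Sum>t\<in>(if j = i then {0} else B). if j = i then 1 else g t)"
    unfolding slice_def using assms by (subst prod_sum_PiE) auto
  also have "\<dots> = (\<Prod>j\<in>UNIV - {i}. \<Sum>t\<in>(if j = i then {0} else B). if j = i then 1 else g t)"
    by (subst prod.remove[of UNIV i]) auto
  also have "\<dots> = (\<Prod>j\<in>UNIV - {i}. \<Sum>t\<in>B. g t)" by (intro prod.cong) auto
  also have "\<dots> = (\<Sum>t\<in>B. g t) ^ (CARD('d) - 1)" by (simp add: card_Diff_singleton)
  finally show ?thesis .
qed

section \<open>One-dimensional sums and the effective dimension\<close>

lemma powr_telescope:
  fixes a t :: real
  assumes "a > 1" "t > 0"
  shows "(a - 1) * (t + 1) powr - a \<le> t powr (1 - a) - (t + 1) powr (1 - a)"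
proof -
  have "\<exists>z. t < z \<and> z < t + 1 \<and>
      (t + 1) powr (1 - a) - t powr (1 - a) = (t + 1 - t) * ((1 - a) * z powr (1 - a - 1))"
    using assms by (intro MVT2) (auto intro!: derivative_eq_intros)
  then obtain z where z: "t < z" "z < t + 1"
    "(t + 1) powr (1 - a) - t powr (1 - a) = (1 - a) * z powr - a" by auto
  have "(t + 1) powr - a \<le> z powr - a" using assms z by (intro powr_mono2') auto
  then have "(a - 1) * (t + 1) powr - a \<le> (a - 1) * z powr - a"
    using assms by (intro mult_left_mono) auto
  also have "\<dots> = t powr (1 - a) - (t + 1) powr (1 - a)" using z(3) by (simp add: algebra_simps)
  finally show ?thesis .
qed

text \<open>The first \<open>\<lceil>X\<rceil>\<close> terms are at most 1 each, and
  \<open>\<lceil>X\<rceil>\<close> is at most \<open>2 * X\<close> because \<open>X \<ge> 1\<close>.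
  The remaining terms are compared with a telescoping sum, the discrete form of the tail
  integral.\<close>

lemma sum_min_powr_le:
  fixes a X :: real
  assumes a: "a > 1" and X: "X \<ge> 1"
  shows "(\<Sum>k<N. min 1 ((X / real (Suc k)) powr a)) \<le> (2 + 1 / (a - 1)) * X"
proof -
  define m where "m = nat \<lceil>X\<rceil>"
  have m: "X \<le> real m" "real m \<le> 2 * X" "m > 0"
    using X unfolding m_def by linarith+
  define S where "S = (\<lambda>N. \<Sum>k<N. min 1 ((X / real (Suc k)) powr a))"
  have small: "S N \<le> real N" for N
  proof -
    have "S N \<le> (\<Sum>k<N. 1)" unfolding S_def by (intro sum_mono) auto
    then show ?thesis by simp
  qed
  have nn: "0 \<le> X / (a - 1)" using a X by simp
  have "S N \<le> 2 * X + X / (a - 1)"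
  proof (cases "N \<le> m")
    case True
    then have "real N \<le> 2 * X" using m(2) by linarith
    then show ?thesis using small[of N] nn by linarith
  next
    case False
    have "S N \<le> real m + X powr a / (a - 1) * (real m powr (1 - a) - real N powr (1 - a))"
      if "m \<le> N" for N using that
    proof (induction N rule: dec_induct)
      case base
      then show ?case using small[of m] by simp
    next
      case (step n)
      have n: "real n > 0" using step m(3) by linarith
      have "S (Suc n) \<le> S n + X powr a * real (Suc n) powr - a"
        unfolding S_def using X by (simp add: powr_divide powr_minus_divide)
      also have "X powr a * real (Suc n) powr - a
          \<le> X powr a * ((real n powr (1 - a) - real (Suc n) powr (1 - a)) / (a - 1))"
        using powr_telescope[OF a n] a by (intro mult_left_mono) (auto simp: field_simps)
      finally show ?case using step.IH by (simp add: algebra_simps diff_divide_distrib)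
    qed
    then have "S N \<le> real m + X powr a / (a - 1) * (real m powr (1 - a) - real N powr (1 - a))"
      using False by simp
    also have "\<dots> \<le> real m + X powr a / (a - 1) * real m powr (1 - a)"
      using a by (intro add_left_mono mult_left_mono) auto
    also have "\<dots> \<le> 2 * X + X powr a / (a - 1) * X powr (1 - a)"
      using a X m by (intro add_mono mult_left_mono powr_mono2') auto
    also have "X powr a / (a - 1) * X powr (1 - a) = X / (a - 1)"
      using X by (simp flip: powr_add)
    finally show ?thesis .
  qed
  then show ?thesis unfolding S_def by (simp add: algebra_simps)
qed

lemma axis_sum_le:
  assumes "b > 1"
  shows "axis_sum (- b) N \<le> 5 + 2 / (b - 1)"
proof -
  have "(\<Sum>k<N. real (Suc k) powr - b) = (\<Sum>k<N. min 1 ((1 / real (Suc k)) powr b))"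
  proof (intro sum.cong refl)
    fix k
    have "(1 / real (Suc k)) powr b \<le> 1 powr b" using assms by (intro powr_mono2) auto
    then show "real (Suc k) powr - b = min 1 ((1 / real (Suc k)) powr b)"
      by (simp add: powr_minus_divide powr_divide)
  qed
  then show ?thesis unfolding axis_sum_eq using sum_min_powr_le[OF assms, of 1 N] by simp
qed

text \<open>The sum is of order X for large X and X^a for small X; \<open>X powr b\<close> dominates
  both. One power valid for all X > 0 is needed because \<open>X = L / cofactor i k\<close> becomes
  arbitrarily small, and \<open>b > 1\<close> will make the sum over the other coordinates
  converge.\<close>

lemma axis_resolvent_sum_le:
  fixes a :: real
  assumes a: "a > 1" and X: "X > 0" and b: "1 \<le> b" "b \<le> a"
  shows "(\<Sum>t\<in>{- int N..int N}. 1 / (1 + (axis_size t / X) powr a))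
    \<le> (5 + 2 / (a - 1)) * X powr b"
proof -
  have bnd: "1 / (1 + (u / X) powr a) \<le> (X / u) powr a" "1 / (1 + (u / X) powr a) \<le> 1" if "u \<ge> 1" for u
  proof -
    have p: "(u / X) powr a > 0" using that X by simp
    have "(X / u) powr a = 1 / (u / X) powr a" using that X by (simp add: powr_divide)
    moreover have "1 / (1 + P) \<le> 1 / P" if "P > 0" for P :: real using that by (simp add: field_simps)
    from this[OF p] have "1 / (1 + (u / X) powr a) \<le> 1 / (u / X) powr a" .
    ultimately show "1 / (1 + (u / X) powr a) \<le> (X / u) powr a" by simp
    have "1 / (1 + P) \<le> 1" if "P > 0" for P :: real using that by simp
    from this[OF p] show "1 / (1 + (u / X) powr a) \<le> 1" .
  qed
  show ?thesis
  proof (cases "X < 1")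
    case True
    have "(\<Sum>t\<in>{- int N..int N}. 1 / (1 + (axis_size t / X) powr a))
        \<le> (\<Sum>t\<in>{- int N..int N}. X powr a * axis_size t powr - a)"
    proof (intro sum_mono)
      fix t :: int
      have "(X / axis_size t) powr a = X powr a * axis_size t powr - a"
        using X by (simp add: powr_divide powr_minus_divide)
      then show "1 / (1 + (axis_size t / X) powr a) \<le> X powr a * axis_size t powr - a"
        using bnd(1)[of "axis_size t"] by simp
    qed
    also have "\<dots> = X powr a * axis_sum (- a) N" unfolding axis_sum_def sum_distrib_left ..
    also have "\<dots> \<le> X powr b * (5 + 2 / (a - 1))"
      using axis_sum_le[OF a, of N] True X b a
      by (intro mult_mono powr_mono') (auto simp: axis_sum_def sum_nonneg)
    finally show ?thesis by (simp add: mult.commute)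
  next
    case False
    then have X1: "X \<ge> 1" by simp
    define g where "g = (\<lambda>t::int. 1 / (1 + (axis_size t / X) powr a))"
    have "(\<Sum>t\<in>{- int N..int N}. g t) \<le> 1 + 2 * (\<Sum>k<N. min 1 ((X / real (Suc k)) powr a))"
    proof (induction N)
      case 0
      then show ?case using bnd(2)[of 1] by (simp add: g_def)
    next
      case (Suc N)
      have "g (int (Suc N)) + g (- int (Suc N)) \<le> 2 * min 1 ((X / real (Suc N)) powr a)"
        unfolding g_def axis_size_Suc using bnd[of "real (Suc N)"] by (simp add: min_def)
      then show ?case using Suc unfolding sum_symmetric_interval_Suc by simp
    qed
    also have "\<dots> \<le> 1 + 2 * ((2 + 1 / (a - 1)) * X)" using sum_min_powr_le[OF a X1, of N] by simp
    also have "\<dots> \<le> (5 + 2 / (a - 1)) * X" using X1 by (simp add: algebra_simps)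
    also have "\<dots> \<le> (5 + 2 / (a - 1)) * X powr b"
      using powr_mono[OF b(1) X1] X1 a by (intro mult_left_mono) auto
    finally show ?thesis unfolding g_def .
  qed
qed

text \<open>
  One coordinate is summed exactly; the others are handled by Rankin's trick with the exponent
  \<open>b = 1 + 1 / ln L\<close>, for which \<open>L powr b = e L\<close>.
\<close>

lemma effective_dimension_le:
  fixes a L :: real
  assumes a: "a > 1" and L: "L > 1" "1 / (a - 1) \<le> ln L"
  shows "(\<Sum>k\<in>freq_box N. 1 / (1 + (freq_size (k :: 'd::finite \<Rightarrow> int) / L) powr a))
    \<le> exp 1 * (5 + 2 / (a - 1)) * L * (5 + 2 * ln L) ^ (CARD('d) - 1)"
proof -
  define b where "b = 1 + 1 / ln L"
  have lnL: "ln L > 0" using L by simp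
  \<comment> \<open>The hypothesis that \<open>L\<close> is large enough is exactly
    \<open>b \<le> a\<close>.\<close>
  have b: "b > 1" "b \<le> a" using a L lnL by (auto simp: b_def field_simps)
  define i :: 'd where "i = undefined"
  define C where "C = 5 + 2 / (a - 1)"
  have C: "C > 0" using a by (simp add: C_def add_pos_nonneg)
  have "(\<Sum>k\<in>freq_box N. 1 / (1 + (freq_size (k :: 'd \<Rightarrow> int) / L) powr a))
      = (\<Sum>k\<in>slice i {- int N..int N}. \<Sum>t\<in>{- int N..int N}.
          1 / (1 + (axis_size t / (L / cofactor i k)) powr a))"
    unfolding sum_freq_box_split[of _ N i] freq_size_upd by (simp add: field_simps)
  also have "\<dots> \<le> (\<Sum>k\<in>slice i {- int N..int N}. C * (L / cofactor i k) powr b)"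
  proof (intro sum_mono)
    fix k :: "'d \<Rightarrow> int"
    show "(\<Sum>t\<in>{- int N..int N}. 1 / (1 + (axis_size t / (L / cofactor i k)) powr a))
      \<le> C * (L / cofactor i k) powr b"
      unfolding C_def using cofactor_ge_1[of i k] L b
      by (intro axis_resolvent_sum_le a divide_pos_pos) auto
  qed
  also have "\<dots> = C * L powr b * (\<Sum>k\<in>slice i {- int N..int N}. \<Prod>j\<in>UNIV - {i}. axis_size (k j) powr - b)"
    unfolding sum_distrib_left
  proof (intro sum.cong refl)
    fix k :: "'d \<Rightarrow> int"
    have "(L / cofactor i k) powr b = L powr b * cofactor i k powr - b"
      using cofactor_ge_1[of i k] L by (simp add: powr_divide powr_minus_divide)
    also have "cofactor i k powr - b = (\<Prod>j\<in>UNIV - {i}. axis_size (k j) powr - b)"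
      unfolding cofactor_def by (rule prod_powr_distrib)
    finally show "C * (L / cofactor i k) powr b
        = C * L powr b * (\<Prod>j\<in>UNIV - {i}. axis_size (k j) powr - b)"
      by simp
  qed
  also have "\<dots> = C * L powr b * axis_sum (- b) N ^ (CARD('d) - 1)"
    by (subst sum_slice_prod) (auto simp: axis_sum_def)
  \<comment> \<open>As \<open>b - 1 = 1 / ln L\<close>, each of the other coordinates contributes
    one factor of logarithmic size.\<close>
  also have "\<dots> \<le> C * L powr b * (5 + 2 * ln L) ^ (CARD('d) - 1)"
    using axis_sum_le[OF b(1), of N] C
    by (intro mult_left_mono power_mono) (auto simp: axis_sum_def sum_nonneg b_def)
  also have "L powr b = exp 1 * L"
  proof -
    have "b * ln L = 1 + ln L" using lnL by (simp add: b_def field_simps)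
    then show ?thesis using L by (simp add: powr_def exp_add)
  qed
  finally show ?thesis by (simp add: C_def mult_ac)
qed

section \<open>Many frequencies of comparable size\<close>

lemma card_ints_double:
  fixes x :: real
  assumes "x \<ge> 1"
  shows "x / 2 \<le> real (card {\<lceil>x\<rceil>..\<lfloor>2 * x\<rfloor>})"
proof -
  have "real (card {\<lceil>x\<rceil>..\<lfloor>2 * x\<rfloor>}) = real_of_int (\<lfloor>2 * x\<rfloor> - \<lceil>x\<rceil> + 1)"
    using assms by (simp add: of_nat_nat) linarith
  \<comment> \<open>The count is at least 1 and at least \<open>x - 1\<close>, and the mean of these
    two bounds is \<open>x / 2\<close>.\<close>
  moreover have "\<lfloor>2 * x\<rfloor> - \<lceil>x\<rceil> + 1 \<ge> 1" using assms by linarith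
  then have "real_of_int (\<lfloor>2 * x\<rfloor> - \<lceil>x\<rceil> + 1) \<ge> 1" by linarith
  moreover have "real_of_int (\<lfloor>2 * x\<rfloor> - \<lceil>x\<rceil> + 1) \<ge> x - 1" using assms by linarith
  ultimately show ?thesis by linarith
qed

text \<open>The other coordinates run through the integers from 1 to M^(1/d). Their product stays
  below M, so coordinate \<open>i\<close> may take every integer of an interval [X, 2 X] with X = M
  / \<open>cofactor i k\<close> at least 1, which are at least X / 2 many. Summing 1 /
  \<open>cofactor i k\<close> gives a power of a harmonic number.\<close>

lemma many_frequencies:
  fixes M :: real
  assumes M: "M \<ge> 1"
  obtains K :: "('d::finite \<Rightarrow> int) set" where "finite K"
    "\<And>k. k \<in> K \<Longrightarrow> M \<le> freq_size k \<and> freq_size k \<le> 2 * M"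
    "M / 2 * (ln M / CARD('d)) ^ (CARD('d) - 1) \<le> real (card K)"
proof -
  define i :: 'd where "i = undefined"
  define m where "m = nat \<lfloor>M powr (1 / CARD('d))\<rfloor>"
  have M1: "1 \<le> M powr (1 / CARD('d))" using M by (simp add: ge_one_powr_ge_zero)
  have m: "real m \<le> M powr (1 / CARD('d))" "M powr (1 / CARD('d)) \<le> real m + 1" "m \<ge> 1"
    unfolding m_def using M1 by linarith+
  define A where "A = slice i {1..int m}"
  define T where "T = (\<lambda>k :: 'd \<Rightarrow> int. {\<lceil>M / cofactor i k\<rceil>..\<lfloor>2 * (M / cofactor i k)\<rfloor>})"
  define K where "K = (\<lambda>(k, t). k(i := t)) ` Sigma A T"
  have A: "finite A" by (simp add: A_def)
  have cof: "1 \<le> M / cofactor i k" if "k \<in> A" for k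
  proof -
    have "cofactor i k \<le> (\<Prod>j\<in>UNIV - {i}. M powr (1 / CARD('d)))"
      unfolding cofactor_def using that m M1
      by (intro prod_mono) (fastforce simp: A_def mem_slice)
    also have "\<dots> = (M powr (1 / CARD('d))) ^ (CARD('d) - 1)" by (simp add: card_Diff_singleton)
    also have "\<dots> \<le> (M powr (1 / CARD('d))) ^ CARD('d)" using M1 by (intro power_increasing) auto
    also have "\<dots> = M" using M by (simp add: powr_realpow[symmetric] powr_powr)
    finally show ?thesis using cofactor_ge_1[of i k] by (simp add: field_simps)
  qed
  have fin: "finite K" unfolding K_def T_def using A by auto
  have mem: "M \<le> freq_size k \<and> freq_size k \<le> 2 * M" if k: "k \<in> K" for k
  proof -
    obtain k' t where k': "k = k'(i := t)" "k' \<in> A" "t \<in> T k'" using k by (auto simp: K_def)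
    have t: "M / cofactor i k' \<le> t" "t \<le> 2 * (M / cofactor i k')"
      using k'(3) unfolding T_def by (simp_all add: ceiling_le_iff le_floor_iff)
    have "axis_size t = t" using t(1) cof[OF k'(2)] by linarith
    then show ?thesis
      unfolding k'(1) freq_size_upd using t cofactor_ge_1[of i k'] by (simp add: field_simps)
  qed
  have "inj_on (\<lambda>(k, t). k(i := t)) (Sigma A T)"
  proof (rule inj_onI, clarify)
    fix k t k' t' assume *: "k \<in> A" "k' \<in> A" "k(i := t) = k'(i := t')"
    have "k = (k(i := t))(i := 0)" "k' = (k'(i := t'))(i := 0)"
      using *(1,2) by (auto simp: A_def mem_slice fun_eq_iff)
    then have "k = k'" using *(3) by metis
    moreover have "t = t'" using *(3) by (metis fun_upd_same)
    ultimately show "k = k' \<and> t = t'" by simp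
  qed
  then have "real (card K) = (\<Sum>k\<in>A. real (card (T k)))"
    unfolding K_def using A by (simp add: card_image card_SigmaI T_def)
  also have "\<dots> \<ge> (\<Sum>k\<in>A. (M / cofactor i k) / 2)"
    unfolding T_def by (intro sum_mono card_ints_double cof)
  also have "(\<Sum>k\<in>A. (M / cofactor i k) / 2) = M / 2 * (\<Sum>k\<in>A. \<Prod>j\<in>UNIV - {i}. 1 / axis_size (k j))"
    unfolding sum_distrib_left cofactor_def prod_dividef by (simp add: mult.commute)
  also have "(\<Sum>k\<in>A. \<Prod>j\<in>UNIV - {i}. 1 / axis_size (k j))
      = (\<Sum>t\<in>{1..int m}. 1 / axis_size t) ^ (CARD('d) - 1)"
    unfolding A_def by (rule sum_slice_prod) simp
  also have "(\<Sum>t\<in>{1..int m}. 1 / axis_size t) = harm m"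
    unfolding harm_def
    by (rule sum.reindex_bij_witness[where i = int and j = nat]) (auto simp: inverse_eq_divide)
  finally have card: "M / 2 * harm m ^ (CARD('d) - 1) \<le> real (card K)" .
  have "ln M / CARD('d) = ln (M powr (1 / CARD('d)))" using M by (simp add: ln_powr)
  also have "\<dots> \<le> ln (real m + 1)" using m M1 by (intro ln_mono) auto
  also have "\<dots> \<le> harm m" by (rule ln_le_harm)
  finally have "M / 2 * (ln M / CARD('d)) ^ (CARD('d) - 1) \<le> M / 2 * harm m ^ (CARD('d) - 1)"
    using M by (intro mult_left_mono power_mono) auto
  with card have "M / 2 * (ln M / CARD('d)) ^ (CARD('d) - 1) \<le> real (card K)" by simp
  then show ?thesis using that fin mem by blast
qed

section \<open>The upper bound\<close>

lemma measurable_torus_continuous: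
  fixes f :: "real ^ 'd \<Rightarrow> 'b::euclidean_space"
  shows "continuous_on UNIV f \<Longrightarrow> f \<in> borel_measurable torus_measure"
  by (intro borel_measurable_integrable integrable_torus_continuous)

text \<open>In place of Hoelder, the pointwise bound \<open>t powr q \<le> 1 + t\<^sup>2\<close> at
  \<open>t = norm (E x) / \<rho>\<close> is integrated; this costs only the factor 2.\<close>

lemma Lp_norm_le_two:
  fixes E :: "real ^ 'd \<Rightarrow> 'k :: {real_normed_field, euclidean_space}"
  assumes E: "E \<in> borel_measurable torus_measure" "integrable torus_measure (\<lambda>x. (norm (E x))\<^sup>2)"
    and le: "(LINT x|torus_measure. (norm (E x))\<^sup>2) \<le> \<rho>\<^sup>2"
    and \<rho>: "\<rho> > 0" and q: "1 \<le> q" "q \<le> 2"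
  shows "Lp_norm q E \<le> 2 * \<rho>"
proof -
  interpret prob_space "torus_measure :: (real ^ 'd) measure" by (rule prob_space_torus)
  define G where "G = (\<lambda>x. \<rho> powr q * (1 + (norm (E x))\<^sup>2 / \<rho>\<^sup>2))"
  have pt: "norm (E x) powr q \<le> G x" for x
  proof -
    define t where "t = norm (E x) / \<rho>"
    have t: "t \<ge> 0" using \<rho> by (simp add: t_def)
    have "t powr q \<le> 1 + t\<^sup>2"
    proof (cases "t \<le> 1")
      case True
      then have "t powr q \<le> 1 powr q" using t q by (intro powr_mono2) auto
      then have "t powr q \<le> 1" by simp
      then show ?thesis using zero_le_power2[of t] by linarith
    next
      case False
      then have "t powr q \<le> t powr 2" using q by (intro powr_mono) auto
      then show ?thesis using False by (simp add: powr_numeral)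
    qed
    then have "\<rho> powr q * t powr q \<le> \<rho> powr q * (1 + t\<^sup>2)" by (rule mult_left_mono) simp
    moreover have "norm (E x) = \<rho> * t" using \<rho> by (simp add: t_def)
    then have "norm (E x) powr q = \<rho> powr q * t powr q" using \<rho> t by (simp add: powr_mult)
    ultimately show ?thesis by (simp add: G_def t_def power_divide)
  qed
  have G: "integrable torus_measure G" unfolding G_def using E(2) by simp
  have iE: "integrable torus_measure (\<lambda>x. norm (E x) powr q)"
  proof (rule Bochner_Integration.integrable_bound[OF G])
    show "(\<lambda>x. norm (E x) powr q) \<in> borel_measurable torus_measure" using E(1) by measurable
    have "norm (norm (E x) powr q) \<le> norm (G x)" for x using order_trans[OF pt abs_ge_self] by simp
    then show "AE x in torus_measure. norm (norm (E x) powr q) \<le> norm (G x)" by (rule AE_I2)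
  qed
  have "(LINT x|torus_measure. norm (E x) powr q) \<le> integral\<^sup>L torus_measure G"
    by (intro integral_mono iE G pt)
  also have "\<dots> = \<rho> powr q * (1 + (LINT x|torus_measure. (norm (E x))\<^sup>2) / \<rho>\<^sup>2)"
    unfolding G_def using E(2) by simp
  also have "\<dots> \<le> \<rho> powr q * 2"
    using le \<rho> by (intro mult_left_mono) (auto simp: field_simps)
  finally have "(LINT x|torus_measure. norm (E x) powr q) powr (1 / q) \<le> (\<rho> powr q * 2) powr (1 / q)"
    using q by (intro powr_mono2) auto
  also have "\<dots> = \<rho> * 2 powr (1 / q)"
    using \<rho> q by (simp add: powr_mult powr_powr)
  also have "\<dots> \<le> \<rho> * 2 powr 1" using \<rho> q by (intro mult_left_mono powr_mono) auto
  finally show ?thesis by (simp add: Lp_norm_def)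
qed

text \<open>The threshold 2 instead of 1 leaves room for the infimum in \<open>sobolev_norm\<close>:
  a density of norm below 2 is available directly, without proving that densities are
  unique.\<close>

lemma Lp_norm_less_imp_L2:
  fixes \<phi> :: "real ^ 'd \<Rightarrow> 'k :: {real_normed_field, euclidean_space}"
  assumes \<phi>: "\<phi> \<in> Lp_space p" "Lp_norm p \<phi> < 2" and p: "p \<ge> 2"
  shows "integrable torus_measure (\<lambda>x. (norm (\<phi> x))\<^sup>2)"
    and "(LINT x|torus_measure. (norm (\<phi> x))\<^sup>2) \<le> 1 + 2 powr p"
proof -
  interpret prob_space "torus_measure :: (real ^ 'd) measure" by (rule prob_space_torus)
  have m: "\<phi> \<in> borel_measurable torus_measure" and i: "integrable torus_measure (\<lambda>x. norm (\<phi> x) powr p)"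
    using \<phi>(1) by (auto simp: Lp_space_def)
  have pt: "(norm (\<phi> x))\<^sup>2 \<le> 1 + norm (\<phi> x) powr p" for x
  proof (cases "norm (\<phi> x) \<le> 1")
    case True
    then have "(norm (\<phi> x))\<^sup>2 \<le> 1" by (simp add: power_le_one)
    then show ?thesis by (simp add: add_increasing2)
  next
    case False
    then have "norm (\<phi> x) powr 2 \<le> norm (\<phi> x) powr p" using p by (intro powr_mono) auto
    moreover have "norm (\<phi> x) powr 2 = (norm (\<phi> x))\<^sup>2" using False by (subst powr_numeral) auto
    ultimately show ?thesis by linarith
  qed
  have i1: "integrable torus_measure (\<lambda>x. 1 + norm (\<phi> x) powr p)" using i by simp
  show i2: "integrable torus_measure (\<lambda>x. (norm (\<phi> x))\<^sup>2)"
  proof (rule Bochner_Integration.integrable_bound[OF i1])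
    show "(\<lambda>x. (norm (\<phi> x))\<^sup>2) \<in> borel_measurable torus_measure" using m by measurable
    have "norm ((norm (\<phi> x))\<^sup>2) \<le> norm (1 + norm (\<phi> x) powr p)" for x
      using order_trans[OF pt abs_ge_self] by simp
    then show "AE x in torus_measure. norm ((norm (\<phi> x))\<^sup>2) \<le> norm (1 + norm (\<phi> x) powr p)"
      by (rule AE_I2)
  qed
  define I where "I = (LINT x|torus_measure. norm (\<phi> x) powr p)"
  have I0: "0 \<le> I" by (simp add: I_def)
  have "I = (I powr (1 / p)) powr p" using I0 p by (simp add: powr_powr)
  also have "\<dots> \<le> 2 powr p" using \<phi>(2) p by (intro powr_mono2) (auto simp: Lp_norm_def I_def)
  finally have "I \<le> 2 powr p" .
  moreover have "(LINT x|torus_measure. (norm (\<phi> x))\<^sup>2) \<le> (LINT x|torus_measure. 1 + norm (\<phi> x) powr p)"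
    by (intro integral_mono i1 i2 pt)
  moreover have "\<dots> = 1 + I" unfolding I_def using i by simp
  ultimately show "(LINT x|torus_measure. (norm (\<phi> x))\<^sup>2) \<le> 1 + 2 powr p" by simp
qed

text \<open>The kernel is real, so components of f are convolutions with components of the density.
  Bessel bounds the coefficients. The hypotheses \<open>int\<close> and \<open>conv\<close> are what
  \<open>mixed_convolution\<close> supplies for one fixed box; continuity of f extends the bound to
  every point, including the later sample points.\<close>

lemma sobolev_component_approx:
  fixes f :: "real ^ 'd \<Rightarrow> 'k :: {real_normed_field, euclidean_space}"
  assumes f: "f \<in> sobolev_ball r p" and p: "p \<ge> 2" and b: "b \<in> Basis"
    and int: "\<And>\<psi> (x :: real ^ 'd). \<psi> \<in> borel_measurable torus_measure \<Longrightarrow> integrable torus_measure (\<lambda>y. (\<psi> y)\<^sup>2) \<Longrightarrow>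
       integrable torus_measure (\<lambda>y. mixed_kernel r (x - y) * \<psi> y)"
    and conv: "\<And>\<psi> (x :: real ^ 'd). \<psi> \<in> borel_measurable torus_measure \<Longrightarrow> integrable torus_measure (\<lambda>y. (\<psi> y)\<^sup>2) \<Longrightarrow>
       (mixed_conv r \<psi> x -
        partial_conv r N \<psi> x)\<^sup>2
       \<le> \<eta> * (LINT y|torus_measure. (\<psi> y)\<^sup>2)"
    and \<eta>: "\<eta> \<ge> 0"
  shows "\<exists>\<beta>. (\<Sum>k\<in>freq_box N. (\<beta> k)\<^sup>2) \<le> 1 + 2 powr p \<and>
     (\<forall>x\<in>torus. (f x \<bullet> b - (\<Sum>k\<in>freq_box N. freq_size k powr - r * trig (r * pi / 2) k x * \<beta> k))\<^sup>2
        \<le> \<eta> * (1 + 2 powr p))"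
proof -
  have fc: "continuous_on UNIV f" and fs: "f \<in> sobolev_space r p" and fn: "sobolev_norm r p f \<le> 1"
    using f by (auto simp: sobolev_ball_def)
  have "Lp_norm p ` {\<phi>. sobolev_density r p f \<phi>} \<noteq> {}" using fs by (auto simp: sobolev_space_def)
  moreover have "Inf (Lp_norm p ` {\<phi>. sobolev_density r p f \<phi>}) < 2" using fn by (simp add: sobolev_norm_def)
  ultimately have "\<exists>y\<in>Lp_norm p ` {\<phi>. sobolev_density r p f \<phi>}. y < 2" by (rule cInf_lessD)
  then obtain \<phi> where \<phi>: "sobolev_density r p f \<phi>" "Lp_norm p \<phi> < 2" by blast
  have \<phi>L: "\<phi> \<in> Lp_space p"
    and fe: "AE x in torus_measure. f x = (LINT y|torus_measure. mixed_kernel r (x - y) *\<^sub>R \<phi> y)"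
    using \<phi>(1) by (auto simp: sobolev_density_def)
  have \<phi>m: "\<phi> \<in> borel_measurable torus_measure" using \<phi>L by (auto simp: Lp_space_def)
  note L2 = Lp_norm_less_imp_L2[OF \<phi>L \<phi>(2) p]
  have cm: "(\<lambda>y. \<phi> y \<bullet> c) \<in> borel_measurable torus_measure" for c
    using \<phi>m by (intro borel_measurable_inner) auto
  have cle: "(\<phi> y \<bullet> c)\<^sup>2 \<le> (norm (\<phi> y))\<^sup>2" if "c \<in> Basis" for c y
    using Basis_le_norm[OF that, of "\<phi> y"] by (simp add: abs_le_square_iff[symmetric])
  have ci: "integrable torus_measure (\<lambda>y. (\<phi> y \<bullet> c)\<^sup>2)" if "c \<in> Basis" for c
  proof (rule Bochner_Integration.integrable_bound[OF L2(1)])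
    show "(\<lambda>y. (\<phi> y \<bullet> c)\<^sup>2) \<in> borel_measurable torus_measure" using cm[of c] by measurable
    show "AE y in torus_measure. norm ((\<phi> y \<bullet> c)\<^sup>2) \<le> norm ((norm (\<phi> y))\<^sup>2)"
      by (rule AE_I2) (simp add: cle[OF that])
  qed
  define \<psi> where "\<psi> = (\<lambda>y. \<phi> y \<bullet> b)"
  have \<psi>: "\<psi> \<in> borel_measurable torus_measure" "integrable torus_measure (\<lambda>y. (\<psi> y)\<^sup>2)"
    unfolding \<psi>_def by (rule cm, rule ci[OF b])
  have \<psi>2: "(LINT y|torus_measure. (\<psi> y)\<^sup>2) \<le> 1 + 2 powr p"
    by (rule order_trans[OF integral_mono[OF \<psi>(2) L2(1)] L2(2)]) (simp add: \<psi>_def cle[OF b])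
  have ker: "(LINT y|torus_measure. mixed_kernel r (x - y) *\<^sub>R \<phi> y) \<bullet> b
      = mixed_conv r \<psi> x" for x
  proof -
    have "mixed_kernel r (x - y) *\<^sub>R \<phi> y = (\<Sum>c\<in>Basis. (mixed_kernel r (x - y) * (\<phi> y \<bullet> c)) *\<^sub>R c)" for y
      unfolding scaleR_scaleR[symmetric] scaleR_sum_right[symmetric] euclidean_representation ..
    moreover have "integrable torus_measure (\<lambda>y. \<Sum>c\<in>Basis. (mixed_kernel r (x - y) * (\<phi> y \<bullet> c)) *\<^sub>R c)"
      by (intro Bochner_Integration.integrable_sum integrable_scaleR_left int cm ci)
    ultimately have i: "integrable torus_measure (\<lambda>y. mixed_kernel r (x - y) *\<^sub>R \<phi> y)"
      by (simp only:)
    have "(LINT y|torus_measure. mixed_kernel r (x - y) *\<^sub>R \<phi> y) \<bullet> b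
        = (LINT y|torus_measure. (mixed_kernel r (x - y) *\<^sub>R \<phi> y) \<bullet> b)"
      by (rule integral_inner_left[symmetric]) (rule i)
    then show ?thesis by (simp only: inner_scaleR_left \<psi>_def)
  qed
  define \<beta> where "\<beta> = (\<lambda>k. LINT y|torus_measure. trig 0 k y * \<psi> y)"
  define g where "g = (\<lambda>x. \<Sum>k\<in>freq_box N. freq_size k powr - r * trig (r * pi / 2) k x * \<beta> k)"
  interpret orthonormal_system "torus_measure :: (real ^ 'd) measure" "freq_box N" "trig 0"
    by (rule orthonormal_trig) simp
  have "(\<Sum>k\<in>freq_box N. (\<beta> k)\<^sup>2) \<le> (LINT y|torus_measure. (\<psi> y)\<^sup>2)"
    unfolding \<beta>_def
  proof (rule bessel)
    fix k :: "'d \<Rightarrow> int"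
    show "integrable torus_measure (\<lambda>x. trig 0 k x * \<psi> x)"
      by (rule integrable_mult_L2[OF measurable_torus_continuous \<psi>(1) integrable_torus_continuous \<psi>(2)])
        (intro continuous_intros)+
  qed (rule \<psi>)
  then have 1: "(\<Sum>k\<in>freq_box N. (\<beta> k)\<^sup>2) \<le> 1 + 2 powr p" using \<psi>2 by simp
  have hc: "continuous_on UNIV (\<lambda>x. (f x \<bullet> b - g x)\<^sup>2)"
    unfolding g_def by (intro continuous_intros fc)
  have "AE x in torus_measure. (f x \<bullet> b - g x)\<^sup>2 \<le> \<eta> * (1 + 2 powr p)"
    using fe
  proof eventually_elim
    case (elim x)
    have "(f x \<bullet> b - g x)\<^sup>2 \<le> \<eta> * (LINT y|torus_measure. (\<psi> y)\<^sup>2)"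
      unfolding elim ker g_def \<beta>_def by (rule conv[OF \<psi>])
    also have "\<dots> \<le> \<eta> * (1 + 2 powr p)" by (rule mult_left_mono[OF \<psi>2 \<eta>])
    finally show ?case .
  qed
  then have "\<forall>x\<in>torus. (f x \<bullet> b - g x)\<^sup>2 \<le> \<eta> * (1 + 2 powr p)"
    using AE_torus_le_imp_le[OF hc] by blast
  with 1 show ?thesis unfolding g_def by blast
qed

lemma norm_square_euclidean: "(norm (x :: 'a :: euclidean_space))\<^sup>2 = (\<Sum>b\<in>Basis. (x \<bullet> b)\<^sup>2)"
  unfolding power2_norm_eq_inner by (subst euclidean_inner) (simp add: power2_eq_square)

text \<open>With g the part of f in the span, the samples of f are those of g plus the noise
  \<open>h\<close>, of size at most \<open>L powr - r\<close>. The weights are matched to the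
  coefficients: \<open>(freq_size k / L) powr (2 * r) * (c k)\<^sup>2\<close> is
  \<open>L powr (- 2 * r) * (\<beta> k)\<^sup>2\<close>. The constant is 2 + 2 (B + 5), from the
  tail, the regularisation and \<open>s * real J \<le> 5\<close>.\<close>

lemma recovery_error_real:
  fixes x :: "nat \<Rightarrow> real ^ 'd" and K :: "('d \<Rightarrow> int) set"
  assumes fin: "finite K" and L: "L > 0" and s: "s \<ge> 0" "s * real J \<le> 5" and x: "\<And>i. i < J \<Longrightarrow> x i \<in> torus"
    and \<psi>: "\<And>c h. (\<Sum>k\<in>K. ((\<Sum>i<J. ((\<Sum>l\<in>K. trig \<theta> l (x i) * c l) + h i) * \<psi> i k) - c k)\<^sup>2)
     \<le> (\<Sum>k\<in>K. (freq_size k / L) powr (2 * r) * (c k)\<^sup>2) + s * (\<Sum>i<J. (h i)\<^sup>2)"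
    and f: "continuous_on UNIV f"
    and \<beta>: "(\<Sum>k\<in>K. (\<beta> k)\<^sup>2) \<le> B"
    and approx: "\<And>t. t \<in> torus \<Longrightarrow> (f t - (\<Sum>k\<in>K. freq_size k powr - r * trig \<theta> k t * \<beta> k))\<^sup>2 \<le> L powr (- 2 * r)"
  shows "(LINT t|torus_measure. (f t - (\<Sum>i<J. f (x i) * (\<Sum>k\<in>K. \<psi> i k * trig \<theta> k t)))\<^sup>2)
     \<le> (12 + 2 * B) * L powr (- 2 * r)"
proof -
  interpret orthonormal_system "torus_measure :: (real ^ 'd) measure" K "trig \<theta>"
    by (rule orthonormal_trig[OF fin])
  define \<epsilon> where "\<epsilon> = L powr (- 2 * r)"
  define c where "c = (\<lambda>k. freq_size k powr - r * \<beta> k)"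
  define g where "g = (\<lambda>t. \<Sum>k\<in>K. trig \<theta> k t * c k)"
  define h where "h = (\<lambda>i. f (x i) - g (x i))"
  define w where "w = (\<lambda>k. (\<Sum>i<J. (g (x i) + h i) * \<psi> i k) - c k)"
  have fg: "(f t - g t)\<^sup>2 \<le> \<epsilon>" if "t \<in> torus" for t
    using approx[OF that] by (simp add: g_def c_def \<epsilon>_def mult_ac)
  have gc: "continuous_on UNIV g" unfolding g_def by (intro continuous_intros)
  have "(\<Sum>k\<in>K. (w k)\<^sup>2) \<le> (\<Sum>k\<in>K. (freq_size k / L) powr (2 * r) * (c k)\<^sup>2) + s * (\<Sum>i<J. (h i)\<^sup>2)"
    unfolding w_def g_def by (rule \<psi>)
  also have "(\<Sum>k\<in>K. (freq_size k / L) powr (2 * r) * (c k)\<^sup>2) = \<epsilon> * (\<Sum>k\<in>K. (\<beta> k)\<^sup>2)"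
    unfolding sum_distrib_left
  proof (intro sum.cong refl)
    fix k :: "'d \<Rightarrow> int"
    have "(freq_size k / L) powr (2 * r) * (c k)\<^sup>2
        = (freq_size k / L) powr (2 * r) * freq_size k powr (- 2 * r) * (\<beta> k)\<^sup>2"
      by (simp add: c_def power_mult_distrib freq_size_powr_square)
    also have "(freq_size k / L) powr (2 * r) * freq_size k powr (- 2 * r) = \<epsilon>"
      using freq_size_ge_1[of k] L by (simp add: \<epsilon>_def powr_divide powr_minus_divide)
    finally show "(freq_size k / L) powr (2 * r) * (c k)\<^sup>2 = \<epsilon> * (\<beta> k)\<^sup>2" .
  qed
  also have "\<epsilon> * (\<Sum>k\<in>K. (\<beta> k)\<^sup>2) \<le> \<epsilon> * B" using \<beta> by (intro mult_left_mono) (auto simp: \<epsilon>_def)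
  also have "s * (\<Sum>i<J. (h i)\<^sup>2) \<le> s * (\<Sum>i<J. \<epsilon>)"
    using s(1) x fg by (intro mult_left_mono sum_mono) (auto simp: h_def)
  also have "\<dots> = (s * real J) * \<epsilon>" by simp
  also have "\<dots> \<le> 5 * \<epsilon>" using s(2) by (intro mult_right_mono) (auto simp: \<epsilon>_def)
  finally have w: "(\<Sum>k\<in>K. (w k)\<^sup>2) \<le> \<epsilon> * B + 5 * \<epsilon>" by simp
  have err: "f t - (\<Sum>i<J. f (x i) * (\<Sum>k\<in>K. \<psi> i k * trig \<theta> k t))
      = (f t - g t) - (\<Sum>k\<in>K. w k * trig \<theta> k t)" for t
  proof -
    have "(\<Sum>i<J. f (x i) * (\<Sum>k\<in>K. \<psi> i k * trig \<theta> k t))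
        = (\<Sum>k\<in>K. (\<Sum>i<J. f (x i) * \<psi> i k) * trig \<theta> k t)"
      unfolding sum_distrib_left sum_distrib_right by (subst sum.swap) (simp add: mult_ac)
    also have "\<dots> = (\<Sum>k\<in>K. (w k + c k) * trig \<theta> k t)"
      by (simp add: w_def h_def)
    also have "\<dots> = (\<Sum>k\<in>K. w k * trig \<theta> k t) + g t"
      by (simp add: g_def sum.distrib algebra_simps)
    finally show ?thesis by simp
  qed
  let ?e = "\<lambda>t. f t - (\<Sum>i<J. f (x i) * (\<Sum>k\<in>K. \<psi> i k * trig \<theta> k t))"
  have two: "(u - v)\<^sup>2 \<le> 2 * u\<^sup>2 + 2 * v\<^sup>2" for u v :: real
    using zero_le_power2[of "u + v"] by (simp add: power2_eq_square algebra_simps)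
  have "(LINT t|torus_measure. (?e t)\<^sup>2)
      \<le> (LINT t|torus_measure. 2 * \<epsilon> + 2 * (\<Sum>k\<in>K. w k * trig \<theta> k t)\<^sup>2)"
  proof (rule integral_mono)
    show "integrable torus_measure (\<lambda>t. (?e t)\<^sup>2)"
      by (intro integrable_torus_continuous continuous_intros f)
    show "integrable torus_measure (\<lambda>t. 2 * \<epsilon> + 2 * (\<Sum>k\<in>K. w k * trig \<theta> k t)\<^sup>2)"
      by (intro integrable_torus_continuous continuous_intros)
    fix t :: "real ^ 'd" assume "t \<in> space torus_measure"
    then have "(f t - g t)\<^sup>2 \<le> \<epsilon>" by (intro fg) simp
    then show "(?e t)\<^sup>2
        \<le> 2 * \<epsilon> + 2 * (\<Sum>k\<in>K. w k * trig \<theta> k t)\<^sup>2"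
      unfolding err using two[of "f t - g t" "\<Sum>k\<in>K. w k * trig \<theta> k t"] by linarith
  qed
  also have "\<dots> = 2 * \<epsilon> + 2 * (\<Sum>k\<in>K. (w k)\<^sup>2)"
    using integrable_square_sum[of w] by (simp add: integral_square_sum)
  also have "\<dots> \<le> (12 + 2 * B) * \<epsilon>" using w by (simp add: algebra_simps)
  finally show ?thesis by (simp add: \<epsilon>_def)
qed

lemma sampling_width_le:
  assumes J: "J \<le> n" and x: "\<And>i. i < J \<Longrightarrow> x i \<in> \<Omega>" and \<phi>: "\<And>i. i < J \<Longrightarrow> \<phi> i \<in> X"
    and le: "\<And>f. f \<in> W \<Longrightarrow> N (\<lambda>t. f t - (\<Sum>i<J. f (x i) * \<phi> i t)) \<le> E"
  shows "sampling_width n \<Omega> W X N \<le> ennreal E"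
proof -
  have "(J, x, \<phi>) \<in> {(k, x, \<phi>). k \<le> n \<and> (\<forall>i<k. x i \<in> \<Omega>) \<and> (\<forall>i<k. \<phi> i \<in> X)}"
    using J x \<phi> by auto
  moreover have "(SUP f\<in>W. ennreal (N (\<lambda>t. f t - (\<Sum>i<J. f (x i) * \<phi> i t)))) \<le> ennreal E"
    by (intro SUP_least ennreal_leI le)
  ultimately show ?thesis unfolding sampling_width_def by (intro INF_lower2) auto
qed

lemma width_le_of_lower_frame:
  fixes x :: "nat \<Rightarrow> real ^ 'd"
  assumes r: "r > 1 / 2" and p: "2 \<le> p" and q: "1 \<le> q" "q \<le> 2"
    and conv1: "\<And>\<psi> (x :: real ^ 'd). \<psi> \<in> borel_measurable torus_measure \<Longrightarrow> integrable torus_measure (\<lambda>y. (\<psi> y)\<^sup>2) \<Longrightarrow>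
       integrable torus_measure (\<lambda>y. mixed_kernel r (x - y) * \<psi> y)"
    and conv2: "\<And>\<psi> (x :: real ^ 'd). \<psi> \<in> borel_measurable torus_measure \<Longrightarrow> integrable torus_measure (\<lambda>y. (\<psi> y)\<^sup>2) \<Longrightarrow>
       (mixed_conv r \<psi> x -
        partial_conv r N \<psi> x)\<^sup>2
       \<le> \<eta> * (LINT y|torus_measure. (\<psi> y)\<^sup>2)"
    and \<eta>: "0 \<le> \<eta>" "\<eta> * (1 + 2 powr p) \<le> L powr (- 2 * r)" and L: "L > 0"
    and s: "0 \<le> s" "s * real J \<le> 5" and J: "J \<le> n" and x: "\<And>i. i < J \<Longrightarrow> x i \<in> torus"
    and lower: "\<And>c. (\<Sum>k\<in>freq_box N. (c k)\<^sup>2) \<le> (\<Sum>k\<in>freq_box N. (freq_size k / L) powr (2 * r) * (c k)\<^sup>2)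
       + s * (\<Sum>i<J. (\<Sum>k\<in>freq_box N. trig (r * pi / 2) k (x i) * c k)\<^sup>2)"
  shows "sampling_width n torus
          (sobolev_ball r p :: (real ^ 'd \<Rightarrow> 'k :: {real_normed_field, euclidean_space}) set)
          (Lp_space q) (Lp_norm q)
     \<le> ennreal (2 * sqrt (DIM('k) * (14 + 2 * 2 powr p)) * L powr - r)"
proof -
  define \<theta> where "\<theta> = r * pi / 2"
  define K where "K = (freq_box N :: ('d \<Rightarrow> int) set)"
  have finK: "finite K" by (simp add: K_def)
  obtain \<psi> where \<psi>: "\<And>c h. (\<Sum>k\<in>K. ((\<Sum>i<J. ((\<Sum>l\<in>K. trig \<theta> l (x i) * c l) + h i) * \<psi> i k) - c k)\<^sup>2)
     \<le> (\<Sum>k\<in>K. (freq_size k / L) powr (2 * r) * (c k)\<^sup>2) + s * (\<Sum>i<J. (h i)\<^sup>2)"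
    using regularised_least_squares[OF finK s(1) _ lower[folded K_def \<theta>_def]] by auto
  define \<phi> where "\<phi> = (\<lambda>i t. \<Sum>k\<in>K. \<psi> i k * trig \<theta> k t)"
  have \<phi>c: "continuous_on UNIV (\<phi> i)" for i unfolding \<phi>_def by (intro continuous_intros)
  define \<Phi> where "\<Phi> = (\<lambda>i t. of_real (\<phi> i t) :: 'k)"
  have \<Phi>c: "continuous_on UNIV (\<Phi> i)" for i unfolding \<Phi>_def by (intro continuous_intros \<phi>c)
  have \<Phi>L: "\<Phi> i \<in> Lp_space q" for i
  proof -
    have "periodic (\<Phi> i)" by (simp add: periodic_def \<Phi>_def \<phi>_def trig_periodic)
    moreover have "integrable torus_measure (\<lambda>t. norm (\<Phi> i t) powr q)"
      by (intro integrable_torus_continuous continuous_on_powr' continuous_intros \<Phi>c) (use q in auto)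
    ultimately show ?thesis by (simp add: Lp_space_def measurable_torus_continuous[OF \<Phi>c])
  qed
  define \<rho> where "\<rho> = sqrt (DIM('k) * (14 + 2 * 2 powr p)) * L powr - r"
  have "0 < 14 + 2 * 2 powr p" by (intro add_pos_nonneg) auto
  then have \<rho>: "\<rho> > 0" unfolding \<rho>_def using L by simp
  have \<rho>2: "\<rho>\<^sup>2 = DIM('k) * ((12 + 2 * (1 + 2 powr p)) * L powr (- 2 * r))"
  proof -
    have "(L powr - r)\<^sup>2 = L powr (- 2 * r)"
      using L by (simp add: power2_eq_square flip: powr_add)
    moreover have "0 \<le> DIM('k) * (14 + 2 * 2 powr p)" by simp
    ultimately show ?thesis unfolding \<rho>_def power_mult_distrib by (simp add: algebra_simps)
  qed
  have "sampling_width n torus (sobolev_ball r p :: (real ^ 'd \<Rightarrow> 'k) set) (Lp_space q) (Lp_norm q)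
     \<le> ennreal (2 * \<rho>)"
  proof (rule sampling_width_le[OF J x \<Phi>L])
    fix f :: "real ^ 'd \<Rightarrow> 'k" assume f: "f \<in> sobolev_ball r p"
    then have fc: "continuous_on UNIV f" by (simp add: sobolev_ball_def)
    define E where "E = (\<lambda>t. f t - (\<Sum>i<J. f (x i) * \<Phi> i t))"
    have Ec: "continuous_on UNIV E" unfolding E_def by (intro continuous_intros fc \<Phi>c)
    \<comment> \<open>The weights \<phi> are real, so the algorithm acts on every real component
      separately with the same points and weights.\<close>
    have comp: "E t \<bullet> b = f t \<bullet> b - (\<Sum>i<J. (f (x i) \<bullet> b) * \<phi> i t)" for t b
    proof -
      have "f (x i) * \<Phi> i t = \<phi> i t *\<^sub>R f (x i)" for i
        by (simp add: \<Phi>_def scaleR_conv_of_real mult.commute)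
      then show ?thesis
        unfolding E_def by (simp add: inner_diff_left inner_sum_left mult.commute)
    qed
    have cb: "(LINT t|torus_measure. (E t \<bullet> b)\<^sup>2) \<le> (12 + 2 * (1 + 2 powr p)) * L powr (- 2 * r)"
      if b: "b \<in> Basis" for b
    proof -
      obtain \<beta> where \<beta>: "(\<Sum>k\<in>freq_box N. (\<beta> k)\<^sup>2) \<le> 1 + 2 powr p"
        "\<forall>x\<in>torus. (f x \<bullet> b - (\<Sum>k\<in>freq_box N. freq_size k powr - r * trig (r * pi / 2) k x * \<beta> k))\<^sup>2
          \<le> \<eta> * (1 + 2 powr p)"
        using sobolev_component_approx[OF f p b conv1 conv2 \<eta>(1)] by blast
      show ?thesis
        unfolding comp \<phi>_def
      proof (rule recovery_error_real[OF finK L s x \<psi>])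
        show "continuous_on UNIV (\<lambda>t. f t \<bullet> b)" by (intro continuous_intros fc)
        show "(\<Sum>k\<in>K. (\<beta> k)\<^sup>2) \<le> 1 + 2 powr p" unfolding K_def by (rule \<beta>(1))
        fix t :: "real ^ 'd" assume "t \<in> torus"
        then show "(f t \<bullet> b - (\<Sum>k\<in>K. freq_size k powr - r * trig \<theta> k t * \<beta> k))\<^sup>2 \<le> L powr (- 2 * r)"
          using \<beta>(2) \<eta>(2) unfolding K_def \<theta>_def by (blast intro: order_trans)
      qed
    qed
    have "(LINT t|torus_measure. (norm (E t))\<^sup>2) = (\<Sum>b\<in>Basis. LINT t|torus_measure. (E t \<bullet> b)\<^sup>2)"
      unfolding norm_square_euclidean
      by (rule Bochner_Integration.integral_sum) (intro integrable_torus_continuous continuous_intros Ec)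
    also have "\<dots> \<le> (\<Sum>b\<in>(Basis :: 'k set). (12 + 2 * (1 + 2 powr p)) * L powr (- 2 * r))"
      by (intro sum_mono cb)
    also have "\<dots> = \<rho>\<^sup>2" by (simp add: \<rho>2)
    finally have "(LINT t|torus_measure. (norm (E t))\<^sup>2) \<le> \<rho>\<^sup>2" .
    then have "Lp_norm q E \<le> 2 * \<rho>"
      by (intro Lp_norm_le_two measurable_torus_continuous[OF Ec] \<rho> q)
        (intro integrable_torus_continuous continuous_intros Ec)
    then show "Lp_norm q (\<lambda>t. f t - (\<Sum>i<J. f (x i) * \<Phi> i t)) \<le> 2 * \<rho>" unfolding E_def .
  qed
  then show ?thesis by (simp add: \<rho>_def mult.assoc)
qed

text \<open>Order of the choices: \<open>L\<close> fixes the accuracy, then \<open>N\<close> makes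
  the tail outside the box that small, and only then points are selected for the box. The condition
  on \<open>n\<close> does not mention \<open>N\<close>, thanks to the uniform bound of the
  effective dimension.\<close>

lemma sampling_width_upper:
  assumes r: "r > 1 / 2" and p: "2 \<le> p" and q: "1 \<le> q" "q \<le> 2" and L: "L > 0"
    and cases: "L \<le> 1 \<or> 1 < L \<and> 1 / (2 * r - 1) \<le> ln L \<and>
      16 * (exp 1 * (5 + 2 / (2 * r - 1)) * L * (5 + 2 * ln L) ^ (CARD('d) - 1)) + 1 \<le> real n"
  shows "sampling_width n torus
          (sobolev_ball r p :: (real ^ 'd \<Rightarrow> 'k :: {real_normed_field, euclidean_space}) set)
          (Lp_space q) (Lp_norm q)
     \<le> ennreal (2 * sqrt (DIM('k) * (14 + 2 * 2 powr p)) * L powr - r)"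
proof -
  obtain \<eta> where \<eta>: "\<eta> \<longlonglongrightarrow> 0" "\<And>N. 0 \<le> \<eta> N"
    and conv1: "\<And>\<psi> (x :: real ^ 'd). \<psi> \<in> borel_measurable torus_measure \<Longrightarrow> integrable torus_measure (\<lambda>y. (\<psi> y)\<^sup>2) \<Longrightarrow>
       integrable torus_measure (\<lambda>y. mixed_kernel r (x - y) * \<psi> y)"
    and conv2: "\<And>\<psi> N (x :: real ^ 'd). \<psi> \<in> borel_measurable torus_measure \<Longrightarrow> integrable torus_measure (\<lambda>y. (\<psi> y)\<^sup>2) \<Longrightarrow>
       (mixed_conv r \<psi> x -
        partial_conv r N \<psi> x)\<^sup>2
       \<le> \<eta> N * (LINT y|torus_measure. (\<psi> y)\<^sup>2)"
    by (rule mixed_convolution[where 'd = 'd, OF r]) blast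
  have "(\<lambda>N. \<eta> N * (1 + 2 powr p)) \<longlonglongrightarrow> 0 * (1 + 2 powr p)" by (intro tendsto_intros \<eta>)
  then have "eventually (\<lambda>N. \<eta> N * (1 + 2 powr p) < L powr (- 2 * r)) sequentially"
    using L by (intro order_tendstoD(2)) auto
  then obtain N where N: "\<eta> N * (1 + 2 powr p) \<le> L powr (- 2 * r)"
    by (auto simp: eventually_sequentially intro: less_imp_le)
  define K where "K = (freq_box N :: ('d \<Rightarrow> int) set)"
  define a where "a = (\<lambda>k :: 'd \<Rightarrow> int. (freq_size k / L) powr (2 * r))"
  have "\<exists>J s x. 0 \<le> s \<and> s * real J \<le> 5 \<and> J \<le> n \<and> (\<forall>i<J. x i \<in> (torus :: (real ^ 'd) set)) \<and>
     (\<forall>c. (\<Sum>k\<in>K. (c k)\<^sup>2) \<le> (\<Sum>k\<in>K. a k * (c k)\<^sup>2)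
       + s * (\<Sum>i<J. (\<Sum>k\<in>K. trig (r * pi / 2) k (x i) * c k)\<^sup>2))"
  proof (cases "L \<le> 1")
    case True
    have "1 \<le> a k" for k
    proof -
      have "1 \<le> freq_size k / L" using freq_size_ge_1[of k] True L by (simp add: field_simps)
      then show ?thesis unfolding a_def using r by (intro ge_one_powr_ge_zero) auto
    qed
    then have "1 * (c k)\<^sup>2 \<le> a k * (c k)\<^sup>2" for c k by (intro mult_right_mono) auto
    then have "(\<Sum>k\<in>K. (c k)\<^sup>2) \<le> (\<Sum>k\<in>K. a k * (c k)\<^sup>2)" for c by (intro sum_mono) simp
    \<comment> \<open>For \<open>L \<le> 1\<close> all weights are at least 1 and the lower frame
      bound holds without samples: the zero algorithm.\<close>
    then show ?thesis by (intro exI[of _ 0] exI[of _ "0::real"] exI[of _ "\<lambda>_. 0"]) simp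
  next
    case False
    define m where "m = exp 1 * (5 + 2 / (2 * r - 1)) * L * (5 + 2 * ln L) ^ (CARD('d) - 1)"
    have L1: "L > 1" "1 / (2 * r - 1) \<le> ln L" and mn: "16 * m + 1 \<le> real n"
      using cases False unfolding m_def by auto
    have lnL: "ln L > 0" using L1 by simp
    have m1: "m \<ge> 1"
    proof -
      have "1 * 1 * 1 * 1 \<le> m"
        unfolding m_def using L1 lnL r
        by (intro mult_mono one_le_power) (auto simp: add_increasing2)
      then show ?thesis by simp
    qed
    \<comment> \<open>The \<open>+ 1\<close> in the condition on \<open>n\<close> pays for this
      rounding; as \<open>m \<ge> 1\<close>, it also keeps \<open>real J / (4 * m)\<close> at most
      5.\<close>
    define J where "J = nat \<lceil>16 * m\<rceil>"
    have J: "16 * m \<le> real J" "real J \<le> 16 * m + 1" using m1 unfolding J_def by linarith+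
    interpret orthonormal_system "torus_measure :: (real ^ 'd) measure" K "trig (r * pi / 2)"
      by (rule orthonormal_trig) (simp add: K_def)
    have "\<exists>x. (\<forall>i<J. x i \<in> space torus_measure) \<and> (\<forall>c. (\<Sum>k\<in>K. (c k)\<^sup>2) \<le> (\<Sum>k\<in>K. a k * (c k)\<^sup>2)
       + 1 / (4 * m) * (\<Sum>i<J. (\<Sum>k\<in>K. trig (r * pi / 2) k (x i) * c k)\<^sup>2))"
    proof (rule barrier_sampling[OF _ _ _ J(1)])
      show "(\<Sum>k\<in>K. 1 / (1 + a k)) \<le> m"
        unfolding K_def a_def m_def by (rule effective_dimension_le) (use r L1 in auto)
    qed (use m1 in \<open>auto simp: a_def\<close>)
    moreover have "1 / (4 * m) * real J \<le> 5" using J(2) m1 by (simp add: field_simps)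
    moreover have "J \<le> n" using J(2) mn by linarith
    ultimately show ?thesis using m1
      by (intro exI[of _ J] exI[of _ "1 / (4 * m)"]) auto
  qed
  then obtain J s x where *: "0 \<le> s" "s * real J \<le> 5" "J \<le> n" "\<And>i. i < J \<Longrightarrow> x i \<in> (torus :: (real ^ 'd) set)"
    "\<And>c. (\<Sum>k\<in>K. (c k)\<^sup>2) \<le> (\<Sum>k\<in>K. a k * (c k)\<^sup>2)
       + s * (\<Sum>i<J. (\<Sum>k\<in>K. trig (r * pi / 2) k (x i) * c k)\<^sup>2)" by blast
  show ?thesis
    by (rule width_le_of_lower_frame[OF r p q conv1 conv2 \<eta>(2) N L *(1-4) *(5)[unfolded K_def a_def]])
qed

section \<open>The lower bound\<close>

text \<open>Orthogonality to the vectors already found is treated as further linear equations, so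
  the next vector comes from the same dimension count and only has to be normalised.\<close>

lemma orthonormal_in_null_space:
  fixes a :: "'e \<Rightarrow> 'i \<Rightarrow> real"
  assumes fin: "finite E" "finite K" and D: "card E + D \<le> card K"
  shows "\<exists>u :: nat \<Rightarrow> 'i \<Rightarrow> real. (\<forall>i<D. \<forall>j<D. (\<Sum>k\<in>K. u i k * u j k) = (if i = j then 1 else 0)) \<and>
     (\<forall>i<D. \<forall>e\<in>E. (\<Sum>k\<in>K. a e k * u i k) = 0)"
  using D
proof (induction D)
  case 0
  then show ?case by simp
next
  case (Suc D)
  then obtain u :: "nat \<Rightarrow> 'i \<Rightarrow> real" where
    u': "\<forall>i<D. \<forall>j<D. (\<Sum>k\<in>K. u i k * u j k) = (if i = j then 1 else 0)"
      "\<forall>i<D. \<forall>e\<in>E. (\<Sum>k\<in>K. a e k * u i k) = 0" by (metis add_Suc_right Suc_leD)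
  note u = u'(1)[rule_format] u'(2)[rule_format]
  have "card (E <+> {..<D}) < card K" using Suc.prems fin by (simp add: card_Plus)
  from homogeneous_system_nontrivial[OF _ fin(2) this, of "case_sum a u"] fin(1)
  obtain c where c: "\<exists>k\<in>K. c k \<noteq> 0"
    "\<And>e. e \<in> E <+> {..<D} \<Longrightarrow> (\<Sum>k\<in>K. case_sum a u e k * c k) = 0" by auto
  have cE: "(\<Sum>k\<in>K. a e k * c k) = 0" if "e \<in> E" for e using c(2)[OF InlI[OF that]] by simp
  have cu: "(\<Sum>k\<in>K. u i k * c k) = 0" if "i < D" for i using c(2)[OF InrI, of i] that by simp
  define s where "s = sqrt (\<Sum>k\<in>K. (c k)\<^sup>2)"
  have S: "(\<Sum>k\<in>K. (c k)\<^sup>2) > 0" using c(1) fin(2) by (auto intro!: sum_pos2)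
  then have s: "s > 0" "s\<^sup>2 = (\<Sum>k\<in>K. (c k)\<^sup>2)" by (auto simp: s_def)
  define v where "v = u(D := (\<lambda>k. c k / s))"
  have v1: "(\<Sum>k\<in>K. v D k * v D k) = 1"
  proof -
    have "(\<Sum>k\<in>K. v D k * v D k) = (\<Sum>k\<in>K. (c k)\<^sup>2) / s\<^sup>2"
      unfolding sum_divide_distrib by (simp add: v_def power2_eq_square)
    then show ?thesis using s S by simp
  qed
  have v2: "(\<Sum>k\<in>K. v i k * v D k) = 0" if "i < D" for i
  proof -
    have "(\<Sum>k\<in>K. v i k * v D k) = (\<Sum>k\<in>K. u i k * c k) / s"
      unfolding sum_divide_distrib using that by (simp add: v_def)
    then show ?thesis using cu[OF that] by simp
  qed
  have v2': "(\<Sum>k\<in>K. v D k * v i k) = 0" if "i < D" for i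
    using v2[OF that] by (simp add: mult.commute)
  have v3: "(\<Sum>k\<in>K. a e k * v D k) = 0" if "e \<in> E" for e
  proof -
    have "(\<Sum>k\<in>K. a e k * v D k) = (\<Sum>k\<in>K. a e k * c k) / s"
      unfolding sum_divide_distrib by (simp add: v_def)
    then show ?thesis using cE[OF that] by simp
  qed
  have vu: "v i = u i" if "i < D" for i using that by (simp add: v_def)
  show ?case
  proof (intro exI[of _ v] conjI allI impI ballI)
    fix i j assume "i < Suc D" "j < Suc D"
    then consider "i < D" "j < D" | "i < D" "j = D" | "i = D" "j < D" | "i = D" "j = D" by linarith
    then show "(\<Sum>k\<in>K. v i k * v j k) = (if i = j then 1 else 0)"
    proof cases
      case 2
      then show ?thesis using v2[of i] by simp
    next
      case 3
      then show ?thesis using v2'[of j] by simp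
    qed (simp_all add: v1 vu u(1))
  next
    fix i e assume "i < Suc D" "e \<in> E"
    then show "(\<Sum>k\<in>K. a e k * v i k) = 0"
      by (cases "i = D") (simp_all add: v3 vu u(2))
  qed
qed

lemma sum_square_orthonormal_combination:
  fixes u :: "nat \<Rightarrow> 'i \<Rightarrow> real"
  assumes u: "\<And>i j. i < D \<Longrightarrow> j < D \<Longrightarrow> (\<Sum>k\<in>K. u i k * u j k) = (if i = j then 1 else 0)"
  shows "(\<Sum>k\<in>K. (\<Sum>i<D. c i * u i k)\<^sup>2) = (\<Sum>i<D. (c i)\<^sup>2)"
proof -
  have "(\<Sum>k\<in>K. (\<Sum>i<D. c i * u i k)\<^sup>2) = (\<Sum>k\<in>K. \<Sum>i<D. \<Sum>j<D. c i * c j * (u i k * u j k))"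
    unfolding power2_eq_square sum_product by (simp add: mult_ac)
  also have "\<dots> = (\<Sum>i<D. \<Sum>j<D. \<Sum>k\<in>K. c i * c j * (u i k * u j k))"
    by (subst sum.swap) (intro sum.cong refl sum.swap)
  also have "\<dots> = (\<Sum>i<D. \<Sum>j<D. c i * c j * (if i = j then 1 else 0))"
    unfolding sum_distrib_left[symmetric] by (intro sum.cong refl) (simp add: u)
  also have "\<dots> = (\<Sum>i<D. (c i)\<^sup>2)"
    by (simp add: power2_eq_square if_distrib[of "\<lambda>x. _ * x"] cong: if_cong)
  finally show ?thesis .
qed

lemma finite_bessel:
  fixes u :: "nat \<Rightarrow> 'i \<Rightarrow> real"
  assumes u: "\<And>i j. i < D \<Longrightarrow> j < D \<Longrightarrow> (\<Sum>k\<in>K. u i k * u j k) = (if i = j then 1 else 0)"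
  shows "(\<Sum>i<D. (\<Sum>k\<in>K. u i k * v k)\<^sup>2) \<le> (\<Sum>k\<in>K. (v k)\<^sup>2)"
proof -
  define c where "c = (\<lambda>i. \<Sum>k\<in>K. u i k * v k)"
  define w where "w = (\<lambda>k. \<Sum>i<D. c i * u i k)"
  have vw: "(\<Sum>k\<in>K. v k * w k) = (\<Sum>i<D. (c i)\<^sup>2)"
  proof -
    have "(\<Sum>k\<in>K. v k * w k) = (\<Sum>i<D. c i * (\<Sum>k\<in>K. u i k * v k))"
      unfolding w_def sum_distrib_left by (subst sum.swap) (simp add: mult_ac)
    then show ?thesis by (simp add: c_def power2_eq_square)
  qed
  have ww: "(\<Sum>k\<in>K. (w k)\<^sup>2) = (\<Sum>i<D. (c i)\<^sup>2)"
    unfolding w_def by (rule sum_square_orthonormal_combination[OF u])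
  have "0 \<le> (\<Sum>k\<in>K. (v k - w k)\<^sup>2)" by (intro sum_nonneg) auto
  also have "\<dots> = (\<Sum>k\<in>K. (v k)\<^sup>2) - 2 * (\<Sum>k\<in>K. v k * w k) + (\<Sum>k\<in>K. (w k)\<^sup>2)"
    unfolding sum_distrib_left sum_subtractf[symmetric] sum.distrib[symmetric]
    by (intro sum.cong refl) (simp add: power2_eq_square algebra_simps)
  finally show ?thesis unfolding vw ww c_def by simp
qed

section \<open>Signed sums and their exponential moments\<close>

lemma exp_plus_exp_minus_le:
  fixes u :: real
  shows "exp u + exp (- u) \<le> 2 * exp (u\<^sup>2)"
proof -
  have nonneg: "exp u + exp (- u) \<le> 2 * exp (u\<^sup>2)" if u: "u \<ge> 0" for u :: real
  proof (cases "u \<le> 1")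
    case True
    have "exp u \<le> 1 + u + u\<^sup>2" by (rule exp_bound[OF u True])
    moreover have "exp (- u) \<le> 1 - u + u\<^sup>2"
    proof -
      have "1 \<le> (1 + u) * (1 - u + u\<^sup>2)"
        using u by (simp add: algebra_simps power2_eq_square)
      also have "\<dots> \<le> exp u * (1 - u + u\<^sup>2)"
      proof (rule mult_right_mono)
        show "1 + u \<le> exp u" by (rule exp_ge_add_one_self)
        show "0 \<le> 1 - u + u\<^sup>2" using True by (simp add: add_nonneg_nonneg)
      qed
      finally show ?thesis by (simp add: exp_minus field_simps)
    qed
    moreover have "1 + u\<^sup>2 \<le> exp (u\<^sup>2)" by (rule exp_ge_add_one_self)
    ultimately show ?thesis by linarith
  next
    case False
    then have "u * 1 \<le> u * u" by (intro mult_left_mono) auto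
    then have "exp u \<le> exp (u\<^sup>2)" by (simp add: power2_eq_square)
    moreover have "exp (- u) \<le> exp (u\<^sup>2)" using u by (simp add: order_trans[OF _ zero_le_power2])
    ultimately show ?thesis by linarith
  qed
  show ?thesis
  proof (cases "u \<ge> 0")
    case False
    then show ?thesis using nonneg[of "- u"] by (simp add: add.commute)
  qed (rule nonneg)
qed

text \<open>
  The signs are chosen one at a time; averaging over the next sign does not increase the
  potential because \<open>cosh u \<le> exp (u\<^sup>2)\<close>.
\<close>

lemma choose_signs:
  fixes U :: "'a \<Rightarrow> nat \<Rightarrow> real ^ 'd \<Rightarrow> real"
  assumes A: "finite A" and U: "\<And>\<alpha> i. \<alpha> \<in> A \<Longrightarrow> continuous_on UNIV (U \<alpha> i)"
  shows "\<exists>s. (\<forall>i. s i = 1 \<or> s i = (-1 :: real)) \<and>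
    (LINT x|torus_measure. (\<Sum>\<alpha>\<in>A. exp ((\<Sum>i<D. s i * U \<alpha> i x) - (\<Sum>i<D. (U \<alpha> i x)\<^sup>2)))) \<le> card A"
proof (induction D)
  case 0
  show ?case by (intro exI[of _ "\<lambda>_. 1"]) simp
next
  case (Suc D)
  then obtain s where s: "\<And>i. s i = 1 \<or> s i = (-1 :: real)"
    "(LINT x|torus_measure. (\<Sum>\<alpha>\<in>A. exp ((\<Sum>i<D. s i * U \<alpha> i x) - (\<Sum>i<D. (U \<alpha> i x)\<^sup>2)))) \<le> card A"
    by blast
  define P where "P = (\<lambda>\<alpha> x. (\<Sum>i<D. s i * U \<alpha> i x) - (\<Sum>i<D. (U \<alpha> i x)\<^sup>2))"
  define H where "H = (\<lambda>\<epsilon> x. \<Sum>\<alpha>\<in>A. exp (P \<alpha> x + \<epsilon> * U \<alpha> D x - (U \<alpha> D x)\<^sup>2))"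
  have Pc: "continuous_on UNIV (P \<alpha>)" if "\<alpha> \<in> A" for \<alpha>
    unfolding P_def by (intro continuous_intros U that)
  have Hi: "integrable torus_measure (H \<epsilon>)" for \<epsilon>
    unfolding H_def by (intro integrable_torus_continuous continuous_intros Pc U)
  have "(LINT x|torus_measure. H 1 x) + (LINT x|torus_measure. H (-1) x)
      = (LINT x|torus_measure. H 1 x + H (-1) x)"
    by (rule Bochner_Integration.integral_add[symmetric]) (rule Hi)+
  also have "\<dots> \<le> (LINT x|torus_measure. 2 * (\<Sum>\<alpha>\<in>A. exp (P \<alpha> x)))"
  proof (rule integral_mono)
    show "integrable torus_measure (\<lambda>x. H 1 x + H (-1) x)"
      by (intro Bochner_Integration.integrable_add Hi)
    show "integrable torus_measure (\<lambda>x. 2 * (\<Sum>\<alpha>\<in>A. exp (P \<alpha> x)))"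
      by (intro integrable_torus_continuous continuous_intros Pc)
    fix x :: "real ^ 'd"
    have "exp (P \<alpha> x + 1 * U \<alpha> D x - (U \<alpha> D x)\<^sup>2) + exp (P \<alpha> x + -1 * U \<alpha> D x - (U \<alpha> D x)\<^sup>2)
        \<le> 2 * exp (P \<alpha> x)" for \<alpha>
    proof -
      define v where "v = U \<alpha> D x"
      have "exp (P \<alpha> x + 1 * v - v\<^sup>2) + exp (P \<alpha> x + -1 * v - v\<^sup>2)
          = exp (P \<alpha> x) * exp (- v\<^sup>2) * (exp v + exp (- v))"
        by (simp add: exp_add exp_diff exp_minus field_simps)
      also have "\<dots> \<le> exp (P \<alpha> x) * exp (- v\<^sup>2) * (2 * exp (v\<^sup>2))"
        by (intro mult_left_mono exp_plus_exp_minus_le) auto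
      also have "\<dots> = 2 * exp (P \<alpha> x)" by (simp add: exp_minus)
      finally show ?thesis unfolding v_def .
    qed
    then show "H 1 x + H (-1) x \<le> 2 * (\<Sum>\<alpha>\<in>A. exp (P \<alpha> x))"
      unfolding H_def sum.distrib[symmetric] sum_distrib_left by (intro sum_mono)
  qed
  also have "\<dots> \<le> 2 * card A" using s(2) unfolding P_def by simp
  finally have "(LINT x|torus_measure. H 1 x) \<le> card A \<or> (LINT x|torus_measure. H (-1) x) \<le> card A"
    by linarith
  then obtain \<epsilon> :: real where \<epsilon>: "\<epsilon> = 1 \<or> \<epsilon> = -1" "(LINT x|torus_measure. H \<epsilon> x) \<le> card A" by blast
  have "(\<Sum>i<Suc D. (s(D := \<epsilon>)) i * U \<alpha> i x) - (\<Sum>i<Suc D. (U \<alpha> i x)\<^sup>2)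
      = P \<alpha> x + \<epsilon> * U \<alpha> D x - (U \<alpha> D x)\<^sup>2" for \<alpha> x
    by (simp add: P_def)
  then have "(LINT x|torus_measure. (\<Sum>\<alpha>\<in>A. exp ((\<Sum>i<Suc D. (s(D := \<epsilon>)) i * U \<alpha> i x)
      - (\<Sum>i<Suc D. (U \<alpha> i x)\<^sup>2)))) \<le> card A"
    using \<epsilon>(2) unfolding H_def by (simp only:)
  moreover have "\<forall>i. (s(D := \<epsilon>)) i = 1 \<or> (s(D := \<epsilon>)) i = -1" using s(1) \<epsilon>(1) by auto
  ultimately show ?case by blast
qed

text \<open>The inequality \<open>x \<le> exp x\<close> at \<open>\<bar>y\<bar> / p\<close>, raised
  to the power \<open>p\<close>.\<close>

lemma abs_powr_le_exp:
  fixes p y :: real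
  assumes "p > 0"
  shows "\<bar>y\<bar> powr p \<le> p powr p * (exp y + exp (- y))"
proof -
  have "\<bar>y\<bar> / p \<le> exp (\<bar>y\<bar> / p)" using exp_ge_add_one_self[of "\<bar>y\<bar> / p"] by linarith
  then have "\<bar>y\<bar> \<le> p * exp (\<bar>y\<bar> / p)" using assms by (simp add: field_simps)
  then have "\<bar>y\<bar> powr p \<le> (p * exp (\<bar>y\<bar> / p)) powr p" using assms by (intro powr_mono2) auto
  also have "\<dots> = p powr p * exp \<bar>y\<bar>"
  proof -
    have "exp (\<bar>y\<bar> / p) powr p = exp \<bar>y\<bar>" using assms by (simp add: powr_def)
    then show ?thesis using assms by (simp add: powr_mult)
  qed
  also have "\<dots> \<le> p powr p * (exp y + exp (- y))" by (intro mult_left_mono) (auto simp: abs_if)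
  finally show ?thesis .
qed

text \<open>A function vanishing at all nodes is mapped to zero by every algorithm that uses these
  nodes, whatever the weights, so its norm is its error.\<close>

lemma sampling_width_ge:
  assumes "\<And>k x. k \<le> n \<Longrightarrow> (\<And>i. i < k \<Longrightarrow> x i \<in> \<Omega>) \<Longrightarrow> \<exists>f\<in>W. (\<forall>i<k. f (x i) = 0) \<and> c \<le> N f"
  shows "ennreal c \<le> sampling_width n \<Omega> W X N"
  unfolding sampling_width_def
proof (rule INF_greatest, clarify)
  fix k :: nat and x :: "nat \<Rightarrow> 'a" and \<phi> :: "nat \<Rightarrow> 'a \<Rightarrow> 'b"
  assume "k \<le> n" "\<forall>i<k. x i \<in> \<Omega>"
  with assms[of k x] obtain f where f: "f \<in> W" "\<forall>i<k. f (x i) = 0" "c \<le> N f" by blast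
  have "(\<lambda>t. f t - (\<Sum>i<k. f (x i) * \<phi> i t)) = f" using f(2) by simp
  then have "ennreal c \<le> ennreal (N (\<lambda>t. f t - (\<Sum>i<k. f (x i) * \<phi> i t)))"
    using f(3) by (simp add: ennreal_leI)
  also have "\<dots> \<le> (SUP f\<in>W. ennreal (N (\<lambda>t. f t - (\<Sum>i<k. f (x i) * \<phi> i t))))"
    using f(1) by (rule SUP_upper)
  finally show "ennreal c \<le> (SUP f\<in>W. ennreal (N (\<lambda>t. f t - (\<Sum>i<k. f (x i) * \<phi> i t))))" .
qed

text \<open>Summation and integration are never interchanged for the possibly only conditionally
  convergent kernel series: as soon as the box contains \<open>K\<close>, the partial convolution is
  constant in \<open>N\<close>, while its distance to the convolution tends to zero. The identity
  holds at every \<open>x\<close>.\<close>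

lemma convolution_trig_sum:
  fixes K :: "('d::finite \<Rightarrow> int) set" and x :: "real ^ 'd"
  assumes r: "r > 1 / 2" and K: "finite K"
  shows "integrable torus_measure (\<lambda>y. mixed_kernel r (x - y) * (\<Sum>k\<in>K. c k * trig 0 k y))"
    and "(LINT y|torus_measure. mixed_kernel r (x - y) * (\<Sum>k\<in>K. c k * trig 0 k y))
      = (\<Sum>k\<in>K. freq_size k powr - r * c k * trig (r * pi / 2) k x)"
proof -
  obtain \<eta> where \<eta>: "\<eta> \<longlonglongrightarrow> 0"
    and conv1: "\<And>\<psi> (x :: real ^ 'd). \<psi> \<in> borel_measurable torus_measure \<Longrightarrow> integrable torus_measure (\<lambda>y. (\<psi> y)\<^sup>2) \<Longrightarrow>
       integrable torus_measure (\<lambda>y. mixed_kernel r (x - y) * \<psi> y)"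
    and conv2: "\<And>\<psi> N (x :: real ^ 'd). \<psi> \<in> borel_measurable torus_measure \<Longrightarrow> integrable torus_measure (\<lambda>y. (\<psi> y)\<^sup>2) \<Longrightarrow>
       (mixed_conv r \<psi> x -
        partial_conv r N \<psi> x)\<^sup>2
       \<le> \<eta> N * (LINT y|torus_measure. (\<psi> y)\<^sup>2)"
    by (rule mixed_convolution[where 'd = 'd, OF r]) blast
  define \<psi> where "\<psi> = (\<lambda>y :: real ^ 'd. \<Sum>k\<in>K. c k * trig 0 k y)"
  have \<psi>c: "continuous_on UNIV \<psi>" unfolding \<psi>_def by (intro continuous_intros)
  have \<psi>: "\<psi> \<in> borel_measurable torus_measure" "integrable torus_measure (\<lambda>y. (\<psi> y)\<^sup>2)"
    by (rule measurable_torus_continuous[OF \<psi>c], intro integrable_torus_continuous continuous_intros \<psi>c)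
  show "integrable torus_measure (\<lambda>y. mixed_kernel r (x - y) * (\<Sum>k\<in>K. c k * trig 0 k y))"
    using conv1[OF \<psi>] unfolding \<psi>_def .
  obtain N0 where N0: "K \<subseteq> freq_box N0"
  proof
    \<comment> \<open>Any common bound of all \<open>\<bar>k j\<bar>\<close> would do.\<close>
    define m where "m = (\<Sum>k\<in>K. \<Sum>j\<in>UNIV. nat \<bar>k j\<bar>)"
    show "K \<subseteq> freq_box m"
    proof
      fix k assume k: "k \<in> K"
      have "nat \<bar>k j\<bar> \<le> m" for j
      proof -
        have "nat \<bar>k j\<bar> \<le> (\<Sum>j\<in>UNIV. nat \<bar>k j\<bar>)" by (rule member_le_sum) auto
        also have "\<dots> \<le> m" unfolding m_def
          by (rule member_le_sum[of k K "\<lambda>k. \<Sum>j\<in>UNIV. nat \<bar>k j\<bar>"]) (use k K in auto)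
        finally show ?thesis .
      qed
      then show "k \<in> freq_box m" unfolding freq_box_def by (simp add: nat_le_iff)
    qed
  qed
  define g where "g = (\<Sum>k\<in>K. freq_size k powr - r * c k * trig (r * pi / 2) k x)"
  define F where "F = mixed_conv r \<psi> x"
  have bound: "(F - g)\<^sup>2 \<le> \<eta> N * (LINT y|torus_measure. (\<psi> y)\<^sup>2)" if N: "N \<ge> N0" for N
  proof -
    have sub: "K \<subseteq> freq_box N" using N0 freq_box_mono[OF N, where 'a = 'd] by blast
    interpret orthonormal_system "torus_measure :: (real ^ 'd) measure" "freq_box N" "trig 0"
      by (rule orthonormal_trig) simp
    have coef: "(LINT y|torus_measure. trig 0 k y * \<psi> y) = (if k \<in> K then c k else 0)"
      if k: "k \<in> freq_box N" for k
    proof -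
      have "(LINT y|torus_measure. trig 0 k y * \<psi> y)
          = (LINT y|torus_measure. (\<Sum>l\<in>K. c l * (trig 0 k y * trig 0 l y)))"
        unfolding \<psi>_def sum_distrib_left by (simp add: mult_ac)
      also have "\<dots> = (\<Sum>l\<in>K. (LINT y|torus_measure. c l * (trig 0 k y * trig 0 l y)))"
        by (rule Bochner_Integration.integral_sum) (intro integrable_torus_continuous continuous_intros)
      also have "\<dots> = (\<Sum>l\<in>K. c l * (if k = l then 1 else 0))"
      proof (intro sum.cong refl)
        fix l assume "l \<in> K"
        then have "l \<in> freq_box N" using sub by blast
        then show "(LINT y|torus_measure. c l * (trig 0 k y * trig 0 l y)) = c l * (if k = l then 1 else 0)"
          using integral_mult[OF k] by simp
      qed
      also have "\<dots> = (if k \<in> K then c k else 0)"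
        using K by (simp add: if_distrib[of "\<lambda>x. _ * x"] cong: if_cong)
      finally show ?thesis .
    qed
    have "partial_conv r N \<psi> x
        = (\<Sum>k\<in>freq_box N. freq_size k powr - r * trig (r * pi / 2) k x * (if k \<in> K then c k else 0))"
      by (intro sum.cong refl) (simp add: coef)
    also have "\<dots> = (\<Sum>k\<in>K. freq_size k powr - r * trig (r * pi / 2) k x * (if k \<in> K then c k else 0))"
      by (rule sum.mono_neutral_right[OF finite_freq_box sub]) simp
    also have "\<dots> = g" unfolding g_def by (intro sum.cong refl) (simp add: mult_ac)
    finally show ?thesis using conv2[OF \<psi>, of x N] unfolding F_def by simp
  qed
  have "(\<lambda>N. \<eta> N * (LINT y|torus_measure. (\<psi> y)\<^sup>2)) \<longlonglongrightarrow> 0 * (LINT y|torus_measure. (\<psi> y)\<^sup>2)"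
    by (intro tendsto_intros \<eta>)
  then have "(F - g)\<^sup>2 \<le> 0 * (LINT y|torus_measure. (\<psi> y)\<^sup>2)"
    by (rule LIMSEQ_le_const) (use bound in blast)
  then show "(LINT y|torus_measure. mixed_kernel r (x - y) * (\<Sum>k\<in>K. c k * trig 0 k y))
      = (\<Sum>k\<in>K. freq_size k powr - r * c k * trig (r * pi / 2) k x)"
    by (simp add: F_def g_def \<psi>_def)
qed

lemma of_real_mem_sobolev_ball:
  fixes \<phi> f :: "real ^ 'd \<Rightarrow> real"
  assumes fc: "continuous_on UNIV f" and \<phi>c: "continuous_on UNIV \<phi>" and p: "p > 0"
    and per: "\<And>x i. f (x + axis i 1) = f x" "\<And>x i. \<phi> (x + axis i 1) = \<phi> x"
    and int: "\<And>x. integrable torus_measure (\<lambda>y. mixed_kernel r (x - y) * \<phi> y)"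
    and conv: "\<And>x. (LINT y|torus_measure. mixed_kernel r (x - y) * \<phi> y) = f x"
    and norm: "(LINT y|torus_measure. \<bar>\<phi> y\<bar> powr p) \<le> 1"
  shows "(\<lambda>x. of_real (f x)) \<in>
    (sobolev_ball r p :: (real ^ 'd \<Rightarrow> 'k :: {real_normed_field, euclidean_space}) set)"
proof -
  define f' where "f' = (\<lambda>x. of_real (f x) :: 'k)"
  define \<phi>' where "\<phi>' = (\<lambda>x. of_real (\<phi> x) :: 'k)"
  have Lp: "(\<lambda>x. of_real (g x) :: 'k) \<in> Lp_space p"
    if "continuous_on UNIV g" "\<And>x i. g (x + axis i 1) = g x" for g :: "real ^ 'd \<Rightarrow> real"
  proof -
    have "integrable torus_measure (\<lambda>x. norm (of_real (g x) :: 'k) powr p)"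
      using p that(1) by (intro integrable_torus_continuous continuous_on_powr' continuous_intros) auto
    moreover have "continuous_on UNIV (\<lambda>x. of_real (g x) :: 'k)" by (intro continuous_intros that(1))
    ultimately show ?thesis
      using that(2) by (simp add: Lp_space_def periodic_def measurable_torus_continuous)
  qed
  have f'L: "f' \<in> Lp_space p" unfolding f'_def by (rule Lp[OF fc per(1)])
  have \<phi>'L: "\<phi>' \<in> Lp_space p" unfolding \<phi>'_def by (rule Lp[OF \<phi>c per(2)])
  have "f' x = (LINT y|torus_measure. mixed_kernel r (x - y) *\<^sub>R \<phi>' y)" for x
  proof -
    have "(LINT y|torus_measure. of_real (mixed_kernel r (x - y) * \<phi> y) :: 'k)
        = of_real (LINT y|torus_measure. mixed_kernel r (x - y) * \<phi> y)"
      by (rule integral_bounded_linear[OF bounded_linear_of_real int])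
    then show ?thesis unfolding conv f'_def \<phi>'_def scaleR_conv_of_real of_real_mult by simp
  qed
  then have dens: "sobolev_density r p f' \<phi>'" using \<phi>'L by (simp add: sobolev_density_def)
  have "sobolev_norm r p f' \<le> Lp_norm p \<phi>'"
    unfolding sobolev_norm_def
  proof (rule cINF_lower)
    show "bdd_below (Lp_norm p ` {\<phi>. sobolev_density r p f' \<phi>})"
      by (intro bdd_belowI2[of _ 0]) (simp add: Lp_norm_def)
    show "\<phi>' \<in> {\<phi>. sobolev_density r p f' \<phi>}" using dens by simp
  qed
  also have "Lp_norm p \<phi>' \<le> 1 powr (1 / p)"
    unfolding Lp_norm_def \<phi>'_def using norm p by (intro powr_mono2) auto
  finally have n: "sobolev_norm r p f' \<le> 1" by simp
  have "continuous_on UNIV f'" unfolding f'_def by (intro continuous_intros fc)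
  moreover have "f' \<in> sobolev_space r p" using f'L dens by (auto simp: sobolev_space_def)
  ultimately show ?thesis using n unfolding sobolev_ball_def f'_def by simp
qed

text \<open>For \<open>0 < q \<le> 2\<close> and \<open>t \<ge> 0\<close> one has
  \<open>t\<^sup>2 - t ^ 4 \<le> t powr q\<close>, so a second moment from below and a fourth moment
  from above bound the q-th moment from below. The scale \<open>\<rho>\<^sup>2 = 2 * B / A\<close>
  maximises \<open>A / \<rho>\<^sup>2 - B / (\<rho>\<^sup>2)\<^sup>2\<close>.\<close>

lemma powr_integral_lower:
  fixes g :: "real ^ 'd \<Rightarrow> real"
  assumes g: "continuous_on UNIV g" and q: "0 < q" "q \<le> 2" and A: "0 < A" "A \<le> (LINT x|torus_measure. (g x)\<^sup>2)"
    and B: "0 < B" "(LINT x|torus_measure. (g x) ^ 4) \<le> B"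
  shows "(2 * B / A) powr (q / 2) * (A\<^sup>2 / (4 * B)) \<le> (LINT x|torus_measure. \<bar>g x\<bar> powr q)"
proof -
  define \<rho> where "\<rho> = sqrt (2 * B / A)"
  have \<rho>: "\<rho> > 0" "\<rho>\<^sup>2 = 2 * B / A" using A(1) B(1) by (auto simp: \<rho>_def)
  have pt: "\<rho> powr q * ((g x)\<^sup>2 / \<rho>\<^sup>2 - (g x) ^ 4 / (\<rho>\<^sup>2)\<^sup>2) \<le> \<bar>g x\<bar> powr q" for x
  proof -
    define t where "t = \<bar>g x\<bar> / \<rho>"
    have t0: "t \<ge> 0" using \<rho> by (simp add: t_def)
    have "t\<^sup>2 - t ^ 4 \<le> t powr q"
    proof (cases "t = 0")
      case True
      then show ?thesis by simp
    next
      case False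
      then have tp: "t > 0" using t0 by simp
      have e: "t ^ 4 = t\<^sup>2 * t\<^sup>2" by (simp add: power_add[symmetric])
      show ?thesis
      proof (cases "t \<le> 1")
        case True
        have "t powr 2 \<le> t powr q" using tp True q by (intro powr_mono') auto
        moreover have "t powr 2 = t\<^sup>2" using tp by (simp add: powr_numeral)
        moreover have "0 \<le> t ^ 4" by simp
        ultimately show ?thesis by linarith
      next
        case False
        then have "1 \<le> t\<^sup>2" by (simp add: one_le_power)
        then have "t\<^sup>2 * 1 \<le> t\<^sup>2 * t\<^sup>2" by (intro mult_left_mono) auto
        then have "t\<^sup>2 - t ^ 4 \<le> 0" unfolding e by simp
        then show ?thesis by (rule order_trans) simp
      qed
    qed
    then have "\<rho> powr q * (t\<^sup>2 - t ^ 4) \<le> \<rho> powr q * t powr q" by (intro mult_left_mono) auto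
    moreover have "\<bar>g x\<bar> = \<rho> * t" using \<rho> by (simp add: t_def)
    then have "\<bar>g x\<bar> powr q = \<rho> powr q * t powr q" using \<rho> t0 by (simp add: powr_mult)
    moreover have "t\<^sup>2 = (g x)\<^sup>2 / \<rho>\<^sup>2" by (simp add: t_def power_divide)
    moreover have "t ^ 4 = (g x) ^ 4 / (\<rho>\<^sup>2)\<^sup>2"
      by (simp add: t_def power_divide power_mult[symmetric])
    ultimately show ?thesis by simp
  qed
  have i2: "integrable torus_measure (\<lambda>x. (g x)\<^sup>2)" and i4: "integrable torus_measure (\<lambda>x. (g x) ^ 4)"
    by (intro integrable_torus_continuous continuous_intros g)+
  have "(LINT x|torus_measure. \<rho> powr q * ((g x)\<^sup>2 / \<rho>\<^sup>2 - (g x) ^ 4 / (\<rho>\<^sup>2)\<^sup>2))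
      \<le> (LINT x|torus_measure. \<bar>g x\<bar> powr q)"
  proof (rule integral_mono[OF _ _ pt])
    show "integrable torus_measure (\<lambda>x. \<rho> powr q * ((g x)\<^sup>2 / \<rho>\<^sup>2 - (g x) ^ 4 / (\<rho>\<^sup>2)\<^sup>2))"
      using i2 i4 by simp
    show "integrable torus_measure (\<lambda>x. \<bar>g x\<bar> powr q)"
      using q by (intro integrable_torus_continuous continuous_on_powr' continuous_intros g) auto
  qed
  also have "(LINT x|torus_measure. \<rho> powr q * ((g x)\<^sup>2 / \<rho>\<^sup>2 - (g x) ^ 4 / (\<rho>\<^sup>2)\<^sup>2))
      = \<rho> powr q * ((LINT x|torus_measure. (g x)\<^sup>2) / \<rho>\<^sup>2 - (LINT x|torus_measure. (g x) ^ 4) / (\<rho>\<^sup>2)\<^sup>2)"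
    using i2 i4 by simp
  finally have "\<rho> powr q * ((LINT x|torus_measure. (g x)\<^sup>2) / \<rho>\<^sup>2 - (LINT x|torus_measure. (g x) ^ 4) / (\<rho>\<^sup>2)\<^sup>2)
    \<le> (LINT x|torus_measure. \<bar>g x\<bar> powr q)" .
  moreover have "\<rho> powr q * (A / \<rho>\<^sup>2 - B / (\<rho>\<^sup>2)\<^sup>2)
      \<le> \<rho> powr q * ((LINT x|torus_measure. (g x)\<^sup>2) / \<rho>\<^sup>2 - (LINT x|torus_measure. (g x) ^ 4) / (\<rho>\<^sup>2)\<^sup>2)"
    using A B by (intro mult_left_mono diff_mono divide_right_mono) auto
  moreover have "A / \<rho>\<^sup>2 - B / (\<rho>\<^sup>2)\<^sup>2 = A\<^sup>2 / (4 * B)"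
    unfolding \<rho>(2) using A(1) B(1) by (simp add: power2_eq_square field_simps)
  moreover have "\<rho> powr q = (2 * B / A) powr (q / 2)"
    using A(1) B(1) unfolding \<rho>_def by (simp add: powr_half_sqrt[symmetric] powr_powr)
  ultimately show ?thesis by simp
qed

lemma integral_abs_powr_le_exp:
  fixes g :: "real ^ 'd \<Rightarrow> real"
  assumes g: "continuous_on UNIV g" and p: "p > 0"
    and E: "(LINT x|torus_measure. exp (g x)) \<le> E" "(LINT x|torus_measure. exp (- g x)) \<le> E"
  shows "(LINT x|torus_measure. \<bar>g x\<bar> powr p) \<le> p powr p * (2 * E)"
proof -
  have i: "integrable torus_measure (\<lambda>x. exp (g x))" "integrable torus_measure (\<lambda>x. exp (- g x))"
    by (intro integrable_torus_continuous continuous_intros g)+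
  have "(LINT x|torus_measure. \<bar>g x\<bar> powr p) \<le> (LINT x|torus_measure. p powr p * (exp (g x) + exp (- g x)))"
  proof (rule integral_mono)
    show "integrable torus_measure (\<lambda>x. \<bar>g x\<bar> powr p)"
      using p by (intro integrable_torus_continuous continuous_on_powr' continuous_intros g) auto
    show "integrable torus_measure (\<lambda>x. p powr p * (exp (g x) + exp (- g x)))" using i by simp
  qed (rule abs_powr_le_exp[OF p])
  also have "\<dots> = p powr p * ((LINT x|torus_measure. exp (g x)) + (LINT x|torus_measure. exp (- g x)))"
    using i by simp
  also have "\<dots> \<le> p powr p * (2 * E)" using E by (intro mult_left_mono) auto
  finally show ?thesis .
qed

text \<open>The coefficients form a signed sum over an orthonormal basis of the null space. Since
  \<open>trig\<close> squared is at most 2^d, \<open>V\<close> makes the vector of normalised basis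
  functions have norm at most 1 at every point; by Bessel the same holds for its coordinates in the
  null space basis, whatever the nodes are. Thus both sums have pointwise variance at most
  1.\<close>

lemma exists_extremal_coefficients:
  fixes K :: "('d::finite \<Rightarrow> int) set" and x :: "nat \<Rightarrow> real ^ 'd"
  assumes r: "r > 0" and K: "finite K" and M: "M \<ge> 1" and n: "1 \<le> card K" "2 * n \<le> card K"
    and size: "\<And>k. k \<in> K \<Longrightarrow> M \<le> freq_size k \<and> freq_size k \<le> 2 * M"
  defines "V \<equiv> sqrt (2 ^ CARD('d) * card K)"
  shows "\<exists>c. (\<forall>i<n. (\<Sum>k\<in>K. freq_size k powr - r * c k * trig \<theta> k (x i)) = 0) \<and>
     real (card K) / 2 \<le> (\<Sum>k\<in>K. (c k)\<^sup>2) \<and>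
     (\<forall>\<epsilon>\<in>{1, -1}. (LINT y|torus_measure. exp (\<epsilon> * ((\<Sum>k\<in>K. c k * trig 0 k y) / V))) \<le> 4 * exp 1) \<and>
     (\<forall>\<epsilon>\<in>{1, -1}. (LINT y|torus_measure.
        exp (\<epsilon> * ((\<Sum>k\<in>K. freq_size k powr - r * c k * trig \<theta> k y) / (V * M powr - r)))) \<le> 4 * exp 1)"
proof -
  define D where "D = card K - n"
  define a where "a = (\<lambda>i k. freq_size k powr - r * trig \<theta> k (x i))"
  have "card {..<n} + D \<le> card K" using n by (simp add: D_def)
  from orthonormal_in_null_space[OF finite_lessThan K this, of a] obtain u :: "nat \<Rightarrow> ('d \<Rightarrow> int) \<Rightarrow> real"
    where u': "\<forall>i<D. \<forall>j<D. (\<Sum>k\<in>K. u i k * u j k) = (if i = j then 1 else 0)"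
      "\<forall>i<D. \<forall>e\<in>{..<n}. (\<Sum>k\<in>K. a e k * u i k) = 0" by blast
  note u = u'(1)[rule_format] u'(2)[rule_format]
  have V: "V > 0" "V\<^sup>2 = 2 ^ CARD('d) * card K" using n by (auto simp: V_def)
  define W where "W = V * M powr - r"
  have W: "W > 0" using V M by (simp add: W_def)
  define v where "v = (\<lambda>b (y :: real ^ 'd) (k :: 'd \<Rightarrow> int). if b then trig 0 k y / V else freq_size k powr - r * trig \<theta> k y / W)"
  \<comment> \<open>The first Boolean is the sign in the exponent, the second selects the density or
    the function. Adding the four potentials lets one choice of signs serve all of them; their
    number and the variance bound 1 yield \<open>4 * exp 1\<close>.\<close>
  define U where "U = (\<lambda>\<alpha> :: bool \<times> bool. \<lambda>i y. (if fst \<alpha> then 1 else -1) * (\<Sum>k\<in>K. u i k * v (snd \<alpha>) y k))"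
  have vc: "continuous_on UNIV (\<lambda>y. v b y k)" for b k
    unfolding v_def using V W by (cases b) (auto intro!: continuous_intros)
  have Uc: "continuous_on UNIV (U \<alpha> i)" for \<alpha> i
    unfolding U_def by (intro continuous_intros vc)
  have vle: "(\<Sum>k\<in>K. (v b y k)\<^sup>2) \<le> 1" for b y
  proof -
    have "(v b y k)\<^sup>2 \<le> 1 / card K" if k: "k \<in> K" for k
    proof -
      have t: "(trig \<theta>' k y)\<^sup>2 / V\<^sup>2 \<le> 1 / card K" for \<theta>'
        using trig_square_le[of \<theta>' k y] n(1) unfolding V(2) by (simp add: field_simps)
      show ?thesis
      proof (cases b)
        case True
        then show ?thesis using t[of 0] by (simp add: v_def power_divide)
      next
        case False
        have "freq_size k powr - r \<le> M powr - r"
          using size[OF k] M r by (intro powr_mono2') auto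
        then have "freq_size k powr - r / M powr - r \<le> 1" using M by simp
        then have "(freq_size k powr - r / M powr - r)\<^sup>2 \<le> 1" by (intro power_le_one) auto
        then have "(freq_size k powr - r / M powr - r)\<^sup>2 * ((trig \<theta> k y)\<^sup>2 / V\<^sup>2)
            \<le> 1 * ((trig \<theta> k y)\<^sup>2 / V\<^sup>2)" by (intro mult_right_mono) auto
        moreover have "(v b y k)\<^sup>2 = (freq_size k powr - r / M powr - r)\<^sup>2 * ((trig \<theta> k y)\<^sup>2 / V\<^sup>2)"
          using False by (simp add: v_def W_def power_divide power_mult_distrib)
        ultimately show ?thesis using t[of \<theta>] by linarith
      qed
    qed
    then have "(\<Sum>k\<in>K. (v b y k)\<^sup>2) \<le> (\<Sum>k\<in>K. 1 / card K)" by (intro sum_mono)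
    also have "\<dots> = 1" using n(1) by simp
    finally show ?thesis .
  qed
  have Ule: "(\<Sum>i<D. (U \<alpha> i y)\<^sup>2) \<le> 1" for \<alpha> y
  proof -
    have "(\<Sum>i<D. (U \<alpha> i y)\<^sup>2) = (\<Sum>i<D. (\<Sum>k\<in>K. u i k * v (snd \<alpha>) y k)\<^sup>2)"
      unfolding U_def power_mult_distrib by (intro sum.cong) auto
    also have "\<dots> \<le> (\<Sum>k\<in>K. (v (snd \<alpha>) y k)\<^sup>2)" by (rule finite_bessel[OF u(1)])
    finally show ?thesis using vle[where b = "snd \<alpha>"] by (rule order_trans)
  qed
  obtain s where s: "\<And>i. s i = 1 \<or> s i = (-1 :: real)"
    and sI: "(LINT y|torus_measure. (\<Sum>\<alpha>\<in>UNIV. exp ((\<Sum>i<D. s i * U \<alpha> i y) - (\<Sum>i<D. (U \<alpha> i y)\<^sup>2))))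
       \<le> card (UNIV :: (bool \<times> bool) set)"
    using choose_signs[of "UNIV :: (bool \<times> bool) set" U D] Uc by auto
  let ?Q = "\<lambda>y. \<Sum>\<alpha>\<in>UNIV. exp ((\<Sum>i<D. s i * U \<alpha> i y) - (\<Sum>i<D. (U \<alpha> i y)\<^sup>2))"
  have I: "(LINT y|torus_measure. exp (\<Sum>i<D. s i * U \<alpha> i y)) \<le> 4 * exp 1" for \<alpha>
  proof -
    have "(LINT y|torus_measure. exp (\<Sum>i<D. s i * U \<alpha> i y))
        \<le> (LINT y|torus_measure. exp 1 * ?Q y)"
    proof (rule integral_mono)
      show "integrable torus_measure (\<lambda>y. exp (\<Sum>i<D. s i * U \<alpha> i y))"
        by (intro integrable_torus_continuous continuous_intros Uc)
      show "integrable torus_measure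
          (\<lambda>y. exp 1 * ?Q y)"
        by (intro integrable_torus_continuous continuous_intros Uc)
      fix y :: "real ^ 'd"
      have "exp (\<Sum>i<D. s i * U \<alpha> i y) \<le> exp (1 + ((\<Sum>i<D. s i * U \<alpha> i y) - (\<Sum>i<D. (U \<alpha> i y)\<^sup>2)))"
        using Ule[of \<alpha> y] by simp
      also have "\<dots> = exp 1 * exp ((\<Sum>i<D. s i * U \<alpha> i y) - (\<Sum>i<D. (U \<alpha> i y)\<^sup>2))"
        by (rule exp_add)
      also have "\<dots> \<le> exp 1 * ?Q y"
        by (intro mult_left_mono member_le_sum) auto
      finally show "exp (\<Sum>i<D. s i * U \<alpha> i y)
          \<le> exp 1 * ?Q y" .
    qed
    also have "\<dots> = exp 1 * (LINT y|torus_measure. ?Q y)"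
      by simp
    also have "\<dots> \<le> exp 1 * 4" using sI by (intro mult_left_mono) (auto simp: card_UNIV_bool)
    finally show ?thesis by simp
  qed
  define c where "c = (\<lambda>k. \<Sum>i<D. s i * u i k)"
  have sU: "(\<Sum>i<D. s i * U (e, b) i y) = (if e then 1 else -1) * (\<Sum>k\<in>K. c k * v b y k)" for e b y
  proof -
    have "(\<Sum>i<D. s i * U (e, b) i y) = (if e then 1 else -1) * (\<Sum>i<D. \<Sum>k\<in>K. s i * u i k * v b y k)"
      unfolding U_def by (simp add: sum_distrib_left mult_ac sum_negf)
    also have "(\<Sum>i<D. \<Sum>k\<in>K. s i * u i k * v b y k) = (\<Sum>k\<in>K. c k * v b y k)"
      unfolding c_def sum_distrib_right by (rule sum.swap)
    finally show ?thesis .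
  qed
  have v1: "(\<Sum>k\<in>K. c k * v True y k) = (\<Sum>k\<in>K. c k * trig 0 k y) / V" for y
    unfolding sum_divide_distrib by (simp add: v_def)
  have v2: "(\<Sum>k\<in>K. c k * v False y k) = (\<Sum>k\<in>K. freq_size k powr - r * c k * trig \<theta> k y) / W" for y
    unfolding sum_divide_distrib by (simp add: v_def mult_ac)
  have "(\<Sum>k\<in>K. freq_size k powr - r * c k * trig \<theta> k (x i)) = 0" if i: "i < n" for i
  proof -
    have "(\<Sum>k\<in>K. freq_size k powr - r * c k * trig \<theta> k (x i)) = (\<Sum>k\<in>K. \<Sum>j<D. s j * (a i k * u j k))"
      unfolding c_def a_def sum_distrib_left sum_distrib_right by (simp add: mult_ac)
    also have "\<dots> = (\<Sum>j<D. s j * (\<Sum>k\<in>K. a i k * u j k))"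
      unfolding sum_distrib_left by (rule sum.swap)
    also have "\<dots> = 0" using u(2) i by simp
    finally show ?thesis .
  qed
  moreover have "real (card K) / 2 \<le> (\<Sum>k\<in>K. (c k)\<^sup>2)"
  proof -
    have "(s i)\<^sup>2 = 1" for i using s[of i] by auto
    then have "(\<Sum>k\<in>K. (c k)\<^sup>2) = real D"
      unfolding c_def by (subst sum_square_orthonormal_combination[OF u(1)]) auto
    then show ?thesis using n by (simp add: D_def of_nat_diff)
  qed
  moreover have "(LINT y|torus_measure. exp (\<epsilon> * ((\<Sum>k\<in>K. c k * trig 0 k y) / V))) \<le> 4 * exp 1"
    if "\<epsilon> \<in> {1, -1}" for \<epsilon>
    using I[of "(\<epsilon> = 1, True)"] that unfolding sU v1 by auto
  moreover have "(LINT y|torus_measure.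
      exp (\<epsilon> * ((\<Sum>k\<in>K. freq_size k powr - r * c k * trig \<theta> k y) / (V * M powr - r)))) \<le> 4 * exp 1"
    if "\<epsilon> \<in> {1, -1}" for \<epsilon>
    using I[of "(\<epsilon> = 1, False)"] that unfolding sU v2 W_def by auto
  ultimately show ?thesis by blast
qed

lemma sampling_width_lower:
  fixes r p q :: real
  assumes r: "r > 1 / 2" and p: "2 \<le> p" and q: "1 \<le> q" "q \<le> 2"
  obtains c where "c > 0"
    "\<And>M n. 1 \<le> M \<Longrightarrow> 1 \<le> n \<Longrightarrow> 2 * real n \<le> M / 2 * (ln M / CARD('d)) ^ (CARD('d) - 1) \<Longrightarrow>
      ennreal (c * M powr - r) \<le> sampling_width n torus
          (sobolev_ball r p :: (real ^ 'd \<Rightarrow> 'k :: {real_normed_field, euclidean_space}) set)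
          (Lp_space q) (Lp_norm q)"
proof -
  define \<theta> where "\<theta> = r * pi / 2"
  \<comment> \<open>In turn: bounds for the p-th moment of the normalised density \<open>P\<close>,
    the fourth and second moment of the normalised function \<open>R\<close>, and the q-th moment of
    \<open>R\<close>. None depends on \<open>M\<close> or \<open>n\<close>: in the second moment
    \<open>card K\<close> cancels between \<open>V\<^sup>2\<close> and the sum of the
    \<open>(c k)\<^sup>2\<close>, and \<open>2 powr (- 2 * r)\<close> stems from
    \<open>freq_size k \<le> 2 * M\<close>.\<close>
  define Cp where "Cp = p powr p * (2 * (4 * exp 1))"
  define B where "B = 4 powr 4 * (2 * (4 * exp (1::real)))"
  define A where "A = 2 powr (- 2 * r) / (2 * 2 ^ CARD('d))"
  define G where "G = (2 * B / A) powr (q / 2) * (A\<^sup>2 / (4 * B))"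
  define c0 where "c0 = G powr (1 / q) / Cp powr (1 / p)"
  have pos: "Cp > 0" "B > 0" "A > 0" using p by (auto simp: Cp_def B_def A_def)
  then have Gpos: "G > 0" by (simp add: G_def)
  have c0: "c0 > 0" using pos Gpos by (simp add: c0_def)
  have main: "\<exists>f\<in>(sobolev_ball r p :: (real ^ 'd \<Rightarrow> 'k) set). (\<forall>i<n'. f (x i) = 0) \<and> c0 * M powr - r \<le> Lp_norm q f"
    if M: "1 \<le> M" and n: "1 \<le> n" and nM: "2 * real n \<le> M / 2 * (ln M / CARD('d)) ^ (CARD('d) - 1)"
      and n': "n' \<le> n" for M n n' and x :: "nat \<Rightarrow> real ^ 'd"
  proof -
    obtain K :: "('d \<Rightarrow> int) set" where K: "finite K"
      "\<And>k. k \<in> K \<Longrightarrow> M \<le> freq_size k \<and> freq_size k \<le> 2 * M"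
      "M / 2 * (ln M / CARD('d)) ^ (CARD('d) - 1) \<le> real (card K)"
      using many_frequencies[OF M] by metis
    have "real (2 * n') \<le> real (card K)" "1 \<le> real (card K)" using nM K(3) n n' by linarith+
    then have cK: "1 \<le> card K" "2 * n' \<le> card K" by linarith+
    define V where "V = sqrt (2 ^ CARD('d) * card K)"
    have V: "V > 0" "V\<^sup>2 = 2 ^ CARD('d) * card K" using cK by (auto simp: V_def)
    obtain c where c0': "\<forall>i<n'. (\<Sum>k\<in>K. freq_size k powr - r * c k * trig \<theta> k (x i)) = 0"
      and c2: "real (card K) / 2 \<le> (\<Sum>k\<in>K. (c k)\<^sup>2)"
      and cP: "\<forall>\<epsilon>\<in>{1, -1}. (LINT y|torus_measure. exp (\<epsilon> * ((\<Sum>k\<in>K. c k * trig 0 k y) / V))) \<le> 4 * exp 1"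
      and cR: "\<forall>\<epsilon>\<in>{1, -1}. (LINT y|torus_measure.
        exp (\<epsilon> * ((\<Sum>k\<in>K. freq_size k powr - r * c k * trig \<theta> k y) / (V * M powr - r)))) \<le> 4 * exp 1"
      using exists_extremal_coefficients[OF _ K(1) M cK K(2), of r \<theta> x] r unfolding V_def by auto
    define P where "P = (\<lambda>y :: real ^ 'd. (\<Sum>k\<in>K. c k * trig 0 k y) / V)"
    define R where "R = (\<lambda>y :: real ^ 'd. (\<Sum>k\<in>K. freq_size k powr - r * c k * trig \<theta> k y) / (V * M powr - r))"
    have Pc: "continuous_on UNIV P" unfolding P_def using V by (intro continuous_intros) auto
    have Rc: "continuous_on UNIV R" unfolding R_def using V M by (intro continuous_intros) auto
    have IP: "(LINT y|torus_measure. \<bar>P y\<bar> powr p) \<le> Cp"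
      unfolding Cp_def using p cP by (intro integral_abs_powr_le_exp Pc) (auto simp: P_def)
    have IR: "(LINT y|torus_measure. \<bar>R y\<bar> powr 4) \<le> B"
      unfolding B_def using cR by (intro integral_abs_powr_le_exp Rc) (auto simp: R_def)
    have "\<bar>R y\<bar> powr 4 = R y ^ 4" for y
      by (cases "R y = 0") (simp_all add: powr_numeral)
    then have R4: "(LINT y|torus_measure. R y ^ 4) \<le> B" using IR by simp
    have R2: "A \<le> (LINT y|torus_measure. (R y)\<^sup>2)"
    proof -
      interpret orthonormal_system "torus_measure :: (real ^ 'd) measure" K "trig \<theta>"
        by (rule orthonormal_trig[OF K(1)])
      have e: "R y = (\<Sum>k\<in>K. (freq_size k powr - r * c k / (V * M powr - r)) * trig \<theta> k y)" for y
        unfolding R_def sum_divide_distrib by simp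
      have "(LINT y|torus_measure. (R y)\<^sup>2) = (\<Sum>k\<in>K. (freq_size k powr - r * c k / (V * M powr - r))\<^sup>2)"
        unfolding e by (rule integral_square_sum)
      also have "\<dots> \<ge> (\<Sum>k\<in>K. 2 powr (- 2 * r) / V\<^sup>2 * (c k)\<^sup>2)"
      proof (rule sum_mono)
        fix k assume k: "k \<in> K"
        have "(2 * M) powr - r \<le> freq_size k powr - r"
          using K(2)[OF k] M r by (intro powr_mono2') auto
        then have "2 powr - r \<le> freq_size k powr - r / M powr - r"
          using M by (simp add: powr_mult field_simps)
        then have "(2 powr - r)\<^sup>2 \<le> (freq_size k powr - r / M powr - r)\<^sup>2" by (intro power_mono) auto
        moreover have "(2 powr - r)\<^sup>2 = (2::real) powr (- 2 * r)"
          by (simp add: power2_eq_square flip: powr_add)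
        ultimately have "2 powr (- 2 * r) * ((c k)\<^sup>2 / V\<^sup>2) \<le> (freq_size k powr - r / M powr - r)\<^sup>2 * ((c k)\<^sup>2 / V\<^sup>2)"
          by (intro mult_right_mono) auto
        then show "2 powr (- 2 * r) / V\<^sup>2 * (c k)\<^sup>2 \<le> (freq_size k powr - r * c k / (V * M powr - r))\<^sup>2"
          by (simp add: power_divide power_mult_distrib mult_ac)
      qed
      also have "(\<Sum>k\<in>K. 2 powr (- 2 * r) / V\<^sup>2 * (c k)\<^sup>2) = 2 powr (- 2 * r) / V\<^sup>2 * (\<Sum>k\<in>K. (c k)\<^sup>2)"
        by (rule sum_distrib_left[symmetric])
      also have "\<dots> \<ge> 2 powr (- 2 * r) / V\<^sup>2 * (real (card K) / 2)"
        using c2 by (intro mult_left_mono) auto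
      also have "2 powr (- 2 * r) / V\<^sup>2 * (real (card K) / 2) = A"
        unfolding A_def V(2) using cK(1) by simp
      finally show ?thesis .
    qed
    have Rq: "G \<le> (LINT y|torus_measure. \<bar>R y\<bar> powr q)"
      unfolding G_def using q pos R2 R4 by (intro powr_integral_lower Rc) auto
    \<comment> \<open>Division by \<tau> gives the density an L_p norm of at most 1 and makes the
      function a multiple of \<open>R\<close> of size \<open>M powr - r\<close>.\<close>
    define \<tau> where "\<tau> = V * Cp powr (1 / p)"
    have \<tau>: "\<tau> > 0" using V pos by (simp add: \<tau>_def)
    define \<phi> where "\<phi> = (\<lambda>y :: real ^ 'd. \<Sum>k\<in>K. c k / \<tau> * trig 0 k y)"
    define f where "f = (\<lambda>y :: real ^ 'd. \<Sum>k\<in>K. freq_size k powr - r * (c k / \<tau>) * trig \<theta> k y)"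
    have \<phi>P: "\<phi> y = P y / Cp powr (1 / p)" for y
    proof -
      have "\<phi> y = (\<Sum>k\<in>K. c k * trig 0 k y) / \<tau>" unfolding \<phi>_def sum_divide_distrib by simp
      then show ?thesis by (simp add: P_def \<tau>_def)
    qed
    have fs: "f y = (\<Sum>k\<in>K. freq_size k powr - r * c k * trig \<theta> k y) / \<tau>" for y
      unfolding f_def sum_divide_distrib by simp
    have fR: "f y = M powr - r / Cp powr (1 / p) * R y" for y
      unfolding fs R_def \<tau>_def using V M by simp
    have mem: "(\<lambda>y. of_real (f y)) \<in> (sobolev_ball r p :: (real ^ 'd \<Rightarrow> 'k) set)"
    proof (rule of_real_mem_sobolev_ball[where \<phi> = \<phi>])
      show "continuous_on UNIV f" "continuous_on UNIV \<phi>"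
        unfolding f_def \<phi>_def by (intro continuous_intros)+
      show "f (y + axis i 1) = f y" "\<phi> (y + axis i 1) = \<phi> y" for y i
        by (simp_all add: f_def \<phi>_def trig_periodic)
      show "integrable torus_measure (\<lambda>y. mixed_kernel r (z - y) * \<phi> y)" for z
        unfolding \<phi>_def by (rule convolution_trig_sum(1)[OF r K(1)])
      show "(LINT y|torus_measure. mixed_kernel r (z - y) * \<phi> y) = f z" for z
        unfolding \<phi>_def f_def \<theta>_def by (rule convolution_trig_sum(2)[OF r K(1)])
      have "\<bar>\<phi> y\<bar> powr p = \<bar>P y\<bar> powr p / Cp" for y
        unfolding \<phi>P using pos p by (simp add: powr_divide powr_powr)
      then have "(LINT y|torus_measure. \<bar>\<phi> y\<bar> powr p) = (LINT y|torus_measure. \<bar>P y\<bar> powr p) / Cp"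
        by simp
      also have "\<dots> \<le> 1" using IP pos by simp
      finally show "(LINT y|torus_measure. \<bar>\<phi> y\<bar> powr p) \<le> 1" .
    qed (use p in simp)
    define m where "m = M powr - r / Cp powr (1 / p)"
    have m: "m > 0" using M pos by (simp add: m_def)
    have "c0 * M powr - r = m * G powr (1 / q)" by (simp add: c0_def m_def)
    also have "\<dots> \<le> m * (LINT y|torus_measure. \<bar>R y\<bar> powr q) powr (1 / q)"
      using m Rq Gpos q by (intro mult_left_mono powr_mono2) auto
    also have "\<dots> = (m powr q * (LINT y|torus_measure. \<bar>R y\<bar> powr q)) powr (1 / q)"
      using m q by (simp add: powr_mult powr_powr)
    also have "m powr q * (LINT y|torus_measure. \<bar>R y\<bar> powr q) = (LINT y|torus_measure. \<bar>f y\<bar> powr q)"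
    proof -
      have "\<bar>f y\<bar> powr q = m powr q * \<bar>R y\<bar> powr q" for y
        unfolding fR m_def[symmetric] using m by (simp add: abs_mult powr_mult)
      then show ?thesis by simp
    qed
    also have "(LINT y|torus_measure. \<bar>f y\<bar> powr q) powr (1 / q) = Lp_norm q (\<lambda>y. of_real (f y) :: 'k)"
      by (simp add: Lp_norm_def)
    finally have "c0 * M powr - r \<le> Lp_norm q (\<lambda>y. of_real (f y) :: 'k)" .
    moreover have "of_real (f (x i)) = (0 :: 'k)" if "i < n'" for i using c0' that by (simp add: fs)
    ultimately show ?thesis using mem by (intro bexI[of _ "\<lambda>y. of_real (f y)"]) auto
  qed
  show ?thesis
    by (rule that[OF c0]) (rule sampling_width_ge, rule main)
qed

text \<open>Ensures that the scale \<open>M\<close> chosen for the lower bound is at least the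
  square root of \<open>n\<close>, so that \<open>ln M\<close> and \<open>ln n\<close> are
  comparable. The bound is \<open>ln t \<le> t\<close> for a small power \<open>t\<close> of
  \<open>n\<close>.\<close>

lemma ln_power_le_sqrt:
  assumes "n \<ge> 1" "d \<ge> 1"
  shows "ln (real n) ^ (d - 1) \<le> (2 * real d) ^ (d - 1) * sqrt (real n)"
proof -
  define t where "t = real n powr (1 / (2 * real d))"
  have t: "t \<ge> 1" using assms by (simp add: t_def ge_one_powr_ge_zero)
  have "ln (real n) = 2 * real d * ln t" using assms by (simp add: t_def ln_powr)
  also have "\<dots> \<le> 2 * real d * t" using t assms ln_le_minus_one[of t] by (intro mult_left_mono) auto
  finally have "ln (real n) ^ (d - 1) \<le> (2 * real d * t) ^ (d - 1)"
    using assms by (intro power_mono) auto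
  also have "\<dots> = (2 * real d) ^ (d - 1) * t ^ (d - 1)" by (rule power_mult_distrib)
  also have "t ^ (d - 1) \<le> t ^ d" using t by (intro power_increasing) auto
  also have "t ^ d = sqrt (real n)"
    using assms by (simp add: t_def powr_realpow[symmetric] powr_powr powr_half_sqrt)
  finally show ?thesis by (simp add: mult_left_mono)
qed

theorem theorem2p17:
  fixes r p q :: real
  assumes "r > 1 / 2" and "1 < q" and "q \<le> 2" and "2 \<le> p"
  shows "\<exists>c>0. \<exists>C>0. \<forall>n::nat. n \<ge> 2 \<longrightarrow>
    ennreal (c * (ln (real n) ^ (CARD('d) - 1) / real n) powr r)
      \<le> sampling_width n torus
          (sobolev_ball r p :: (real ^ 'd \<Rightarrow> 'k :: {real_normed_field, euclidean_space}) set)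
          (Lp_space q) (Lp_norm q) \<and>
    sampling_width n torus
          (sobolev_ball r p :: (real ^ 'd \<Rightarrow> 'k) set) (Lp_space q) (Lp_norm q)
      \<le> ennreal (C * (ln (real n) ^ (CARD('d) - 1) / real n) powr r)"
proof -
  have q: "1 \<le> q" "q \<le> 2" using assms by auto
  define d where "d = CARD('d)"
  have d: "d \<ge> 1" by (simp add: d_def Suc_leI)
  define w where "w = (\<lambda>n. sampling_width n torus
          (sobolev_ball r p :: (real ^ 'd \<Rightarrow> 'k) set) (Lp_space q) (Lp_norm q))"
  define h where "h = (\<lambda>n. ln (real n) ^ (d - 1) / real n)"
  have ln23: "2 / 3 \<le> ln (real n)" if "n \<ge> 2" for n
  proof -
    have "ln 2 \<le> ln (real n)" using that by (intro ln_mono) auto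
    then show ?thesis using ln2_ge_two_thirds by linarith
  qed
  have hpos: "h n > 0" if "n \<ge> 2" for n
    unfolding h_def using ln23[OF that] that by (intro divide_pos_pos zero_less_power) auto
  have scale: "(\<kappa> / h n) powr - r = \<kappa> powr - r * h n powr r" if "n \<ge> 2" "\<kappa> > 0" for n \<kappa>
    using hpos[OF that(1)] that(2) by (simp add: powr_divide powr_minus_divide)
  have inv_h: "1 / h n * ln (real n) ^ (d - 1) = real n" if "n \<ge> 2" for n
    using ln23[OF that] that by (simp add: h_def)

  obtain c0 where c0: "c0 > 0"
    "\<And>M n. 1 \<le> M \<Longrightarrow> 1 \<le> n \<Longrightarrow> 2 * real n \<le> M / 2 * (ln M / CARD('d)) ^ (CARD('d) - 1) \<Longrightarrow>
      ennreal (c0 * M powr - r) \<le> w n"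
    unfolding w_def using sampling_width_lower[where 'd = 'd and 'k = 'k, OF assms(1,4) q] by blast
  \<comment> \<open>Chosen such that \<open>M = \<kappa> / h n\<close> gives exactly
    \<open>2 * n = M / 2 * (ln n / (2 * d)) ^ (d - 1)\<close>, the number of frequencies
    required.\<close>
  define \<kappa> where "\<kappa> = 4 * (2 * real d) ^ (d - 1)"
  have \<kappa>: "\<kappa> > 0" using d by (simp add: \<kappa>_def)
  have lower: "ennreal (c0 * \<kappa> powr - r * h n powr r) \<le> w n" if n: "n \<ge> 2" for n
  proof -
    define M where "M = \<kappa> / h n"
    have lnp: "ln (real n) > 0" using n by simp
    have "sqrt (real n) * ln (real n) ^ (d - 1) \<le> sqrt (real n) * ((2 * real d) ^ (d - 1) * sqrt (real n))"
      using ln_power_le_sqrt[of n d] n d by (intro mult_left_mono) auto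
    also have "\<dots> = (2 * real d) ^ (d - 1) * real n" by simp
    also have "\<dots> \<le> \<kappa> * real n" unfolding \<kappa>_def by (intro mult_right_mono) auto
    finally have Ms: "sqrt (real n) \<le> M"
      using lnp n by (simp add: M_def h_def field_simps)
    have "1 \<le> sqrt (real n)" using n by simp
    then have M1: "1 \<le> M" using Ms by linarith
    have "ln (real n) / 2 = ln (sqrt (real n))" using n by (simp add: ln_sqrt)
    also have "\<dots> \<le> ln M" using Ms n by (intro ln_mono) auto
    finally have lM: "ln (real n) / (2 * real d) \<le> ln M / real d" using d by (simp add: field_simps)
    have "2 * real n = M / 2 * (ln (real n) / (2 * real d)) ^ (d - 1)"
    proof -
      have "M / 2 * (ln (real n) / (2 * real d)) ^ (d - 1)
          = \<kappa> / (2 * (2 * real d) ^ (d - 1)) * (1 / h n * ln (real n) ^ (d - 1))"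
        by (simp add: M_def power_divide)
      also have "\<dots> = 2 * real n" unfolding inv_h[OF n] using d by (simp add: \<kappa>_def)
      finally show ?thesis by simp
    qed
    also have "\<dots> \<le> M / 2 * (ln M / real d) ^ (d - 1)"
      using lM lnp M1 by (intro mult_left_mono power_mono) auto
    finally have "ennreal (c0 * M powr - r) \<le> w n"
      using c0(2)[of M n] M1 n unfolding d_def by simp
    then show ?thesis unfolding M_def scale[OF n \<kappa>] by (simp add: mult.assoc)
  qed

  define C0 where "C0 = 2 * sqrt (DIM('k) * (14 + 2 * 2 powr p))"
  have "0 < 14 + 2 * 2 powr p" by (intro add_pos_nonneg) auto
  then have C0: "C0 > 0" by (simp add: C0_def)
  define A where "A = exp 1 * (5 + 2 / (2 * r - 1))"
  have A: "A > 0" unfolding A_def using assms(1) by (intro mult_pos_pos add_pos_nonneg) auto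
  have upper0: "w n \<le> ennreal (C0 * L powr - r)"
    if "L > 0" "L \<le> 1 \<or> 1 < L \<and> 1 / (2 * r - 1) \<le> ln L \<and> 16 * (A * L * (5 + 2 * ln L) ^ (d - 1)) + 1 \<le> real n" for n L
    using that unfolding w_def C0_def A_def d_def
    by (intro sampling_width_upper assms(1,4) q) auto
  \<comment> \<open>The first term forces \<open>L \<le> n\<close>; the second reduces the number of
    points, before rounding, to at most half of \<open>n\<close>.\<close>
  define \<mu> where "\<mu> = min ((2 / 3) ^ (d - 1)) (1 / (32 * A * 10 ^ (d - 1)))"
  have \<mu>: "\<mu> > 0" using A by (simp add: \<mu>_def)
  \<comment> \<open>The threshold beyond which the bound on the effective dimension applies to
    \<open>L\<close>.\<close>
  define \<Lambda> where "\<Lambda> = exp (1 / (2 * r - 1))"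
  have \<Lambda>: "\<Lambda> > 1" using assms(1) by (simp add: \<Lambda>_def)
  have upper: "w n \<le> ennreal (C0 * \<Lambda> powr r * \<mu> powr - r * h n powr r)" if n: "n \<ge> 2" for n
  proof -
    define L where "L = \<mu> / h n"
    have L0: "L > 0" using \<mu> hpos[OF n] by (simp add: L_def)
    have "w n \<le> ennreal (C0 * (\<Lambda> powr r * L powr - r))"
    proof (cases "L < \<Lambda>")
      case True
      \<comment> \<open>Below the threshold the zero algorithm suffices: its bound, the case
        \<open>L = 1\<close>, is too large by a factor of at most
        \<open>\<Lambda> powr r\<close>.\<close>
      have "w n \<le> ennreal (C0 * 1 powr - r)" by (rule upper0) auto
      also have "C0 * 1 powr - r \<le> C0 * (\<Lambda> powr r * L powr - r)"
      proof -
        have "1 \<le> (\<Lambda> / L) powr r" using True L0 assms(1) by (intro ge_one_powr_ge_zero) auto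
        also have "\<dots> = \<Lambda> powr r * L powr - r" using L0 \<Lambda> by (simp add: powr_divide powr_minus_divide)
        finally show ?thesis using C0 by simp
      qed
      finally show ?thesis by (simp add: ennreal_leI)
    next
      case False
      then have L1: "L > 1" using \<Lambda> by simp
      have "ln \<Lambda> \<le> ln L" using False \<Lambda> by (intro ln_mono) auto
      then have lnL: "1 / (2 * r - 1) \<le> ln L" by (simp add: \<Lambda>_def)
      have Ln: "L * ln (real n) ^ (d - 1) = \<mu> * real n"
      proof -
        have "L * ln (real n) ^ (d - 1) = \<mu> * (1 / h n * ln (real n) ^ (d - 1))" by (simp add: L_def)
        then show ?thesis unfolding inv_h[OF n] .
      qed
      have "L * (2 / 3) ^ (d - 1) \<le> L * ln (real n) ^ (d - 1)"
        using ln23[OF n] L0 by (intro mult_left_mono power_mono) auto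
      also have "\<dots> \<le> (2 / 3) ^ (d - 1) * real n"
        unfolding Ln by (intro mult_right_mono) (auto simp: \<mu>_def)
      finally have "L \<le> real n" by (simp add: mult.commute)
      then have "ln L \<le> ln (real n)" using L0 by (intro ln_mono) auto
      \<comment> \<open>Here \<open>ln n \<ge> 2 / 3\<close> gives
        \<open>5 \<le> 8 * ln n\<close>.\<close>
      then have "5 + 2 * ln L \<le> 10 * ln (real n)" using ln23[OF n] by linarith
      then have "A * L * (5 + 2 * ln L) ^ (d - 1) \<le> A * L * (10 * ln (real n)) ^ (d - 1)"
        using L0 L1 A by (intro mult_left_mono power_mono) auto
      also have "\<dots> = A * 10 ^ (d - 1) * (L * ln (real n) ^ (d - 1))"
        by (simp add: power_mult_distrib)
      also have "\<dots> = A * 10 ^ (d - 1) * \<mu> * real n" unfolding Ln by simp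
      also have "\<dots> \<le> 1 / 32 * real n"
      proof (rule mult_right_mono)
        have "A * 10 ^ (d - 1) * \<mu> \<le> A * 10 ^ (d - 1) * (1 / (32 * A * 10 ^ (d - 1)))"
          using A by (intro mult_left_mono) (auto simp: \<mu>_def)
        then show "A * 10 ^ (d - 1) * \<mu> \<le> 1 / 32" using A by simp
      qed simp
      finally have "16 * (A * L * (5 + 2 * ln L) ^ (d - 1)) + 1 \<le> real n" using n by simp
      then have "w n \<le> ennreal (C0 * L powr - r)" using L0 L1 lnL by (intro upper0) auto
      also have "C0 * L powr - r \<le> C0 * (\<Lambda> powr r * L powr - r)"
      proof -
        have "1 \<le> \<Lambda> powr r" using \<Lambda> assms(1) by (intro ge_one_powr_ge_zero) auto
        then have "1 * L powr - r \<le> \<Lambda> powr r * L powr - r" by (intro mult_right_mono) auto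
        then show ?thesis using C0 by simp
      qed
      finally show ?thesis by (simp add: ennreal_leI)
    qed
    then show ?thesis unfolding L_def scale[OF n \<mu>] by (simp add: mult.assoc)
  qed
  have "0 < c0 * \<kappa> powr - r" "0 < C0 * \<Lambda> powr r * \<mu> powr - r"
    using c0(1) \<kappa> C0 \<Lambda> \<mu> by simp_all
  then show ?thesis
    using lower upper unfolding w_def h_def d_def by blast
qed

end
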